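(* Let $\mathbb{A}$ be $\mathbb{C}$ or $\mathbb{H}$, let $m=\dim_{\mathbb{R}}\mathbb{A}\in\{2,4\}$, and let $n\ge1$. For every $F\in\mathcal{H}^2(\mathcal{D}_n)$ and every $\zeta=(\zeta',\zeta_{n+1})\in\mathcal{D}_n$, $$F(\zeta)=\int_{\partial\mathcal{D}_n}S(\zeta,\omega)F^b(\omega)\,d\beta(\omega),$$ where $$S(\zeta,\omega)=s\big(\zeta_{n+1}+\overline{\omega_{n+1}}-2\,\overline{\omega'}\cdot\zeta'\big),\qquad s(\nu)=\Big(-\frac{2}{\pi}\Big)^{\frac{mn}{2}}\frac{\partial^{\frac{mn}{2}}}{\partial x_0^{\frac{mn}{2}}}E(\nu),\qquad E(\nu)=\frac{\Gamma(\frac m2)}{2\pi^{m/2}}\frac{\overline\nu}{|\nu|^m},$$ for $\nu=\sum_{i=0}^{m-1}x_ie_i\in\mathbb{A}\setminus\{0\}$.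
   Context: For $\mathbb{A}=\mathbb{C}$ the real basis is $e_0=1,e_1=i$. For $\mathbb{A}=\mathbb{H}$ it is $e_0=1,e_1,e_2,e_3$ with $e_i^2=-1$ ($1\le i\le3$), $e_1e_2=e_3=-e_2e_1$, $e_2e_3=e_1=-e_3e_2$, $e_3e_1=e_2=-e_1e_3$. For $\nu=\sum_{i=0}^{m-1}x_ie_i\in\mathbb{A}$: $\mathrm{Re}\,\nu=x_0$, $\overline\nu=x_0-\sum_{i\ge1}x_ie_i$, $|\nu|=(\sum x_i^2)^{1/2}$. For $\zeta',\omega'\in\mathbb{A}^n$: $|\zeta'|^2=\sum_{i=1}^n|\zeta_i|^2$, $\overline{\omega'}\cdot\zeta'=\sum_{i=1}^n\overline{\omega_i}\,\zeta_i$. A $C^1$ function of several $\mathbb{A}$-variables is left regular if, with respect to each variable $x=\sum_{i=0}^{m-1} x_ie_i$, it satisfies $\sum_{i=0}^{m-1}e_i\frac{\partial f}{\partial x_i}=0$ (for $\mathbb{A}=\mathbb{C}$ this means holomorphic; for $\mathbb{A}=\mathbb{H}$ this is left $\mathbb{H}$-regularity in each variable). $\mathcal{D}_n=\{(\zeta',\zeta_{n+1})\in\mathbb{A}^n\times\mathbb{A}:\mathrm{Re}\,\zeta_{n+1}>|\zeta'|^2\}$, with boundary $\partial\mathcal{D}_n=\{\mathrm{Re}\,\zeta_{n+1}=|\zeta'|^2\}$. The measure $d\beta$ on $\partial\mathcal{D}_n$ is Lebesgue measure on $\mathbb{A}^n\times\mathbb{R}^{m-1}$ transported by $(\omega',t)\mapsto(\omega',|\omega'|^2+\sum_{i=1}^{m-1}e_it_i)$.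 For $\varepsilon>0$, $F_\varepsilon(\zeta',\zeta_{n+1})=F(\zeta',\zeta_{n+1}+\varepsilon)$. $\mathcal{H}^2(\mathcal{D}_n)$ is the space of left regular functions $F:\mathcal{D}_n\to\mathbb{A}$ with $\sup_{\varepsilon>0}\int_{\partial\mathcal{D}_n}|F_\varepsilon|^2\,d\beta<\infty$. For such $F$, $F^b\in L^2(\partial\mathcal{D}_n)$ denotes the boundary limit of $F_\varepsilon|_{\partial\mathcal{D}_n}$ as $\varepsilon\to0^+$, which exists in $L^2(\partial\mathcal{D}_n)$ norm and almost everywhere. *)

theory Defs
  imports "HOL-Analysis.Analysis"
begin

section \<open>The quaternions\<close>

codatatype quat = Quat (Re0: real) (Im1: real) (Im2: real) (Im3: real)

lemma quat_eq_iff: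
  "x = y \<longleftrightarrow> Re0 x = Re0 y \<and> Im1 x = Im1 y \<and> Im2 x = Im2 y \<and> Im3 x = Im3 y"
  by (auto intro: quat.expand)

instantiation quat :: ab_group_add
begin

primcorec zero_quat where
  "Re0 0 = 0" | "Im1 0 = 0" | "Im2 0 = 0" | "Im3 0 = 0"

primcorec plus_quat where
  "Re0 (x + y) = Re0 x + Re0 y"
| "Im1 (x + y) = Im1 x + Im1 y"
| "Im2 (x + y) = Im2 x + Im2 y"
| "Im3 (x + y) = Im3 x + Im3 y"

primcorec uminus_quat where
  "Re0 (- x) = - Re0 x"
| "Im1 (- x) = - Im1 x"
| "Im2 (- x) = - Im2 x"
| "Im3 (- x) = - Im3 x"

primcorec minus_quat where
  "Re0 (x - y) = Re0 x - Re0 y"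
| "Im1 (x - y) = Im1 x - Im1 y"
| "Im2 (x - y) = Im2 x - Im2 y"
| "Im3 (x - y) = Im3 x - Im3 y"

instance
  by standard (simp_all add: quat_eq_iff)

end

instantiation quat :: real_vector
begin

primcorec scaleR_quat where
  "Re0 (scaleR r x) = r * Re0 x"
| "Im1 (scaleR r x) = r * Im1 x"
| "Im2 (scaleR r x) = r * Im2 x"
| "Im3 (scaleR r x) = r * Im3 x"

instance
  by standard (simp_all add: quat_eq_iff algebra_simps)

end

instantiation quat :: real_inner
begin

definition inner_quat :: "quat \<Rightarrow> quat \<Rightarrow> real" where
  "inner_quat x y = Re0 x * Re0 y + Im1 x * Im1 y + Im2 x * Im2 y + Im3 x * Im3 y"

definition norm_quat :: "quat \<Rightarrow> real" where
  "norm_quat x = sqrt ((Re0 x)\<^sup>2 + (Im1 x)\<^sup>2 + (Im2 x)\<^sup>2 + (Im3 x)\<^sup>2)"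

definition sgn_quat :: "quat \<Rightarrow> quat" where
  "sgn_quat x = x /\<^sub>R norm x"

definition dist_quat :: "quat \<Rightarrow> quat \<Rightarrow> real" where
  "dist_quat x y = norm (x - y)"

definition uniformity_quat :: "(quat \<times> quat) filter" where
  "uniformity_quat = (INF e\<in>{0 <..}. principal {(x, y). dist x y < e})"

definition open_quat :: "quat set \<Rightarrow> bool" where
  "open_quat U \<longleftrightarrow> (\<forall>x\<in>U. eventually (\<lambda>(x', y). x' = x \<longrightarrow> y \<in> U) uniformity)"

instance
proof
  fix x y z :: quat and r :: real and U :: "quat set"
  show "dist x y = norm (x - y)" by (rule dist_quat_def)
  show "sgn x = x /\<^sub>R norm x" by (rule sgn_quat_def)
  show "uniformity = (INF e\<in>{0 <..}. principal {(x::quat, y). dist x y < e})"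
    by (rule uniformity_quat_def)
  show "open U \<longleftrightarrow> (\<forall>x\<in>U. eventually (\<lambda>(x', y). x' = x \<longrightarrow> y \<in> U) uniformity)"
    by (rule open_quat_def)
  show "inner x y = inner y x" by (simp add: inner_quat_def algebra_simps)
  show "inner (x + y) z = inner x z + inner y z" by (simp add: inner_quat_def algebra_simps)
  show "inner (r *\<^sub>R x) y = r * inner x y" by (simp add: inner_quat_def algebra_simps)
  show "0 \<le> inner x x" by (simp add: inner_quat_def)
  show "inner x x = 0 \<longleftrightarrow> x = 0"
    by (simp add: inner_quat_def quat_eq_iff add_nonneg_eq_0_iff)
  show "norm x = sqrt (inner x x)"
    by (simp add: norm_quat_def inner_quat_def power2_eq_square)
qed

end

instantiation quat :: real_div_algebra
begin

primcorec one_quat where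
  "Re0 1 = 1" | "Im1 1 = 0" | "Im2 1 = 0" | "Im3 1 = 0"

primcorec times_quat where
  "Re0 (x * y) = Re0 x * Re0 y - Im1 x * Im1 y - Im2 x * Im2 y - Im3 x * Im3 y"
| "Im1 (x * y) = Re0 x * Im1 y + Im1 x * Re0 y + Im2 x * Im3 y - Im3 x * Im2 y"
| "Im2 (x * y) = Re0 x * Im2 y - Im1 x * Im3 y + Im2 x * Re0 y + Im3 x * Im1 y"
| "Im3 (x * y) = Re0 x * Im3 y + Im1 x * Im2 y - Im2 x * Im1 y + Im3 x * Re0 y"

primcorec inverse_quat where
  "Re0 (inverse x) = Re0 x / ((Re0 x)\<^sup>2 + (Im1 x)\<^sup>2 + (Im2 x)\<^sup>2 + (Im3 x)\<^sup>2)"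
| "Im1 (inverse x) = - Im1 x / ((Re0 x)\<^sup>2 + (Im1 x)\<^sup>2 + (Im2 x)\<^sup>2 + (Im3 x)\<^sup>2)"
| "Im2 (inverse x) = - Im2 x / ((Re0 x)\<^sup>2 + (Im1 x)\<^sup>2 + (Im2 x)\<^sup>2 + (Im3 x)\<^sup>2)"
| "Im3 (inverse x) = - Im3 x / ((Re0 x)\<^sup>2 + (Im1 x)\<^sup>2 + (Im2 x)\<^sup>2 + (Im3 x)\<^sup>2)"

definition divide_quat :: "quat \<Rightarrow> quat \<Rightarrow> quat" where
  "divide_quat x y = x * inverse y"

instance
proof
  fix x y z :: quat and r :: real
  show "x * y * z = x * (y * z)" by (simp add: quat_eq_iff algebra_simps)
  show "(x + y) * z = x * z + y * z" by (simp add: quat_eq_iff algebra_simps)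
  show "x * (y + z) = x * y + x * z" by (simp add: quat_eq_iff algebra_simps)
  show "1 * x = x" by (simp add: quat_eq_iff)
  show "x * 1 = x" by (simp add: quat_eq_iff)
  show "(0::quat) \<noteq> 1" by (simp add: quat_eq_iff)
  show "r *\<^sub>R x * y = r *\<^sub>R (x * y)" by (simp add: quat_eq_iff algebra_simps)
  show "x * r *\<^sub>R y = r *\<^sub>R (x * y)" by (simp add: quat_eq_iff algebra_simps)
  show "x div y = x * inverse y" by (rule divide_quat_def)
  show "inverse (0::quat) = 0" by (simp add: quat_eq_iff)
  assume "x \<noteq> 0"
  then have "(Re0 x)\<^sup>2 + (Im1 x)\<^sup>2 + (Im2 x)\<^sup>2 + (Im3 x)\<^sup>2 \<noteq> 0"
    by (auto simp: quat_eq_iff add_nonneg_eq_0_iff)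
  then show "inverse x * x = 1" "x * inverse x = 1"
    by (simp_all add: quat_eq_iff power2_eq_square flip: diff_divide_distrib add_divide_distrib)
qed

end

instance quat :: real_normed_div_algebra
proof
  fix x y :: quat
  show "norm (x * y) = norm x * norm y"
    unfolding norm_quat_def real_sqrt_mult[symmetric] real_sqrt_eq_iff times_quat.sel
    by algebra
qed

definition "e1 = Quat 0 1 0 0"
definition "e2 = Quat 0 0 1 0"
definition "e3 = Quat 0 0 0 1"

lemma quat_unit_table:
  "e1 * e1 = -1" "e2 * e2 = -1" "e3 * e3 = -1"
  "e1 * e2 = e3" "e2 * e1 = - e3"
  "e2 * e3 = e1" "e3 * e2 = - e1"
  "e3 * e1 = e2" "e1 * e3 = - e2"
  by (simp_all add: quat_eq_iff e1_def e2_def e3_def)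

instantiation quat :: euclidean_space
begin

definition Basis_quat :: "quat set" where
  "Basis_quat = {1, e1, e2, e3}"

instance
proof
  fix x u v :: quat
  show "(Basis :: quat set) \<noteq> {}" "finite (Basis :: quat set)"
    by (simp_all add: Basis_quat_def)
  show "u \<in> Basis \<Longrightarrow> v \<in> Basis \<Longrightarrow> inner u v = (if u = v then 1 else 0)"
    by (auto simp: Basis_quat_def inner_quat_def quat_eq_iff e1_def e2_def e3_def)
  show "(\<forall>u\<in>Basis. inner x u = 0) \<longleftrightarrow> x = 0"
    by (simp add: Basis_quat_def inner_quat_def e1_def e2_def e3_def) (auto simp: quat_eq_iff)
qed

end

lemma DIM_quat [simp]: "DIM(quat) = 4"
  by (simp add: Basis_quat_def e1_def e2_def e3_def quat_eq_iff)

lemma quat_Basis_1 [iff]: "(1::quat) \<in> Basis"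
  by (simp add: Basis_quat_def)


section \<open>Notions common to the complex numbers and the quaternions\<close>

text \<open>
  Below, the type variable \<open>'a\<close> stands for \<open>complex\<close> or \<open>quat\<close>. In both cases \<open>Basis\<close> is
  the real basis \<open>e\<^sub>0 = 1, e\<^sub>1, \<dots>\<close>, the inner product with \<open>e\<close> in \<open>Basis\<close> is the coordinate
  along \<open>e\<close>, \<open>norm\<close> is the Euclidean norm, and \<open>m\<close> is \<open>DIM('a)\<close>.
  A point of \<open>A\<^sup>n \<times> A\<close> has type \<open>('a, 'n) point\<close> with \<open>n = CARD('n)\<close>, which is at least 1.
\<close>

type_synonym ('a, 'n) point = "('a ^ 'n) \<times> 'a"

definition re_part :: "'a::{real_normed_div_algebra, euclidean_space} \<Rightarrow> real" where
  "re_part \<nu> = \<nu> \<bullet> 1"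

definition conjugate :: "'a::{real_normed_div_algebra, euclidean_space} \<Rightarrow> 'a" where
  "conjugate \<nu> = of_real (re_part \<nu>) - (\<Sum>e\<in>Basis - {1}. (\<nu> \<bullet> e) *\<^sub>R e)"

lemma re_part_complex: "re_part = Re"
  by (simp add: fun_eq_iff re_part_def inner_complex_def)

lemma conjugate_complex: "conjugate = cnj"
proof -
  have "Basis - {1} = {\<i>}" by (auto simp: Basis_complex_def)
  then show ?thesis
    by (simp add: fun_eq_iff conjugate_def re_part_complex inner_complex_def complex_eq_iff)
qed

lemma re_part_quat: "re_part = Re0"
  by (simp add: fun_eq_iff re_part_def inner_quat_def)

lemma conjugate_quat: "conjugate \<nu> = Quat (Re0 \<nu>) (- Im1 \<nu>) (- Im2 \<nu>) (- Im3 \<nu>)"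
proof -
  have *: "Basis - {1} = {e1, e2, e3}"
    by (auto simp: Basis_quat_def e1_def e2_def e3_def quat_eq_iff)
  show ?thesis
    unfolding conjugate_def *
    by (simp add: re_part_quat of_real_def inner_quat_def e1_def e2_def e3_def quat_eq_iff)
qed

definition norm_sq :: "'a::{real_normed_div_algebra, euclidean_space} ^ 'n::finite \<Rightarrow> real" where
  "norm_sq z = (\<Sum>i\<in>UNIV. (norm (z $ i))\<^sup>2)"

definition conj_dot ::
  "'a::{real_normed_div_algebra, euclidean_space} ^ 'n::finite \<Rightarrow> 'a ^ 'n \<Rightarrow> 'a" where
  "conj_dot w z = (\<Sum>i\<in>UNIV. conjugate (w $ i) * z $ i)"

definition dir_deriv :: "'v::real_normed_vector \<Rightarrow> ('v \<Rightarrow> 'w::real_normed_vector) \<Rightarrow> 'v \<Rightarrow> 'w" where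
  "dir_deriv v f x = vector_derivative (\<lambda>t::real. f (x + t *\<^sub>R v)) (at 0)"


section \<open>Left regular functions and the Hardy space\<close>

definition C1_on :: "'v::real_normed_vector set \<Rightarrow> ('v \<Rightarrow> 'w::real_normed_vector) \<Rightarrow> bool" where
  "C1_on D f \<longleftrightarrow> (\<exists>f' :: 'v \<Rightarrow> 'v \<Rightarrow>\<^sub>L 'w.
     (\<forall>x\<in>D. (f has_derivative blinfun_apply (f' x)) (at x)) \<and> continuous_on D f')"

text \<open>
  For an open set \<open>D\<close>. The vector \<open>axis j e\<close> is \<open>e\<close> in the \<open>j\<close>-th slot of \<open>A\<^sup>n\<close>, so the two
  sums are the operators \<open>\<Sum>\<^sub>i e\<^sub>i \<partial>/\<partial>x\<^sub>i\<close> in the variable \<open>\<zeta>\<^sub>j\<close> and in the variable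
  \<open>\<zeta>\<^sub>n\<^sub>+\<^sub>1\<close>.
\<close>
definition left_regular_on ::
  "('a::{real_normed_div_algebra, euclidean_space}, 'n::finite) point set \<Rightarrow>
    (('a, 'n) point \<Rightarrow> 'a) \<Rightarrow> bool" where
  "left_regular_on D F \<longleftrightarrow> C1_on D F \<and>
     (\<forall>\<zeta>\<in>D. (\<forall>j. (\<Sum>e\<in>Basis. e * dir_deriv (axis j e, 0) F \<zeta>) = 0) \<and>
             (\<Sum>e\<in>Basis. e * dir_deriv (0, e) F \<zeta>) = 0)"

definition siegel_domain :: "('a::{real_normed_div_algebra, euclidean_space}, 'n::finite) point set" where
  "siegel_domain = {(z, w). re_part w > norm_sq z}"

definition siegel_boundary :: "('a::{real_normed_div_algebra, euclidean_space}, 'n::finite) point set" where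
  "siegel_boundary = {(z, w). re_part w = norm_sq z}"

text \<open>
  The factor \<open>\<real>\<^bsup>m-1\<^esup>\<close> of the parameter space consists of the functions on the imaginary units
  \<open>Basis - {1}\<close>, with the product of the one-dimensional Lebesgue measures.
\<close>
definition boundary_param ::
  "('a ^ 'n) \<times> ('a \<Rightarrow> real) \<Rightarrow> ('a::{real_normed_div_algebra, euclidean_space}, 'n::finite) point" where
  "boundary_param = (\<lambda>(w, t). (w, of_real (norm_sq w) + (\<Sum>e\<in>Basis - {1}. t e *\<^sub>R e)))"

definition boundary_measure ::
  "('a::{real_normed_div_algebra, euclidean_space}, 'n::finite) point measure" where
  "boundary_measure =
     completion (distr (lborel \<Otimes>\<^sub>M PiM (Basis - {1}) (\<lambda>_. lborel))
       (restrict_space borel siegel_boundary) boundary_param)"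

text \<open>
  The three lemmas below rule out the degenerate readings of \<open>distr\<close> and of the
  integrals over the boundary: the parametrization is measurable, the integrals are taken
  over the boundary only, and the translates of a function that is continuous on the domain
  are measurable there.
\<close>
lemma measurable_boundary_param:
  assumes "(1::'a::{real_normed_div_algebra, euclidean_space}) \<in> Basis"
  shows "(boundary_param :: ('a ^ 'n::finite) \<times> ('a \<Rightarrow> real) \<Rightarrow> _) \<in>
    lborel \<Otimes>\<^sub>M PiM (Basis - {1}) (\<lambda>_. lborel) \<rightarrow>\<^sub>M restrict_space borel siegel_boundary"
proof (rule measurable_restrict_space2)
  have "re_part (of_real r + (\<Sum>e\<in>Basis - {1::'a}. t e *\<^sub>R e)) = r" for r t
  proof -
    have "(\<Sum>e\<in>Basis - {1::'a}. t e * (e \<bullet> 1)) = 0"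
      using assms by (intro sum.neutral) (auto simp: inner_Basis)
    then show ?thesis
      using assms
      by (simp add: re_part_def inner_add_left inner_sum_left of_real_def)
  qed
  then show "boundary_param \<in> space (lborel \<Otimes>\<^sub>M PiM (Basis - {1}) (\<lambda>_. lborel))
      \<rightarrow> (siegel_boundary :: ('a, 'n) point set)"
    by (auto simp: boundary_param_def siegel_boundary_def)
  have "(\<lambda>w::'a ^ 'n. norm_sq w) \<in> borel_measurable borel"
    unfolding norm_sq_def by (intro borel_measurable_continuous_onI continuous_intros)
  then have [measurable]: "(\<lambda>w::'a ^ 'n. of_real (norm_sq w) :: 'a) \<in> borel_measurable borel"
    unfolding of_real_def by measurable
  have [measurable]: "(\<lambda>p. snd p e) \<in> borel_measurable
      ((lborel :: ('a ^ 'n) measure) \<Otimes>\<^sub>M PiM (Basis - {1}) (\<lambda>_. lborel))"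
    if "e \<in> Basis - {1::'a}" for e
    using that by measurable
  show "(boundary_param :: ('a ^ 'n) \<times> ('a \<Rightarrow> real) \<Rightarrow> _) \<in>
      lborel \<Otimes>\<^sub>M PiM (Basis - {1}) (\<lambda>_. lborel) \<rightarrow>\<^sub>M borel"
    unfolding boundary_param_def case_prod_beta borel_prod[symmetric]
    by (intro measurable_Pair borel_measurable_add borel_measurable_sum
        borel_measurable_scaleR) (auto intro!: measurable_compose[OF measurable_fst])
qed

lemma space_boundary_measure: "space boundary_measure = siegel_boundary"
  by (simp add: boundary_measure_def space_restrict_space)

definition shift :: "real \<Rightarrow> (('a::{real_normed_div_algebra, euclidean_space}, 'n::finite) point \<Rightarrow> 'a) \<Rightarrow>
    ('a, 'n) point \<Rightarrow> 'a" where
  "shift \<epsilon> F = (\<lambda>(z, w). F (z, w + of_real \<epsilon>))"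

lemma measurable_shift:
  fixes F :: "('a::{real_normed_div_algebra, euclidean_space}, 'n::finite) point \<Rightarrow> 'a"
  assumes "C1_on siegel_domain F" and "\<epsilon> > 0"
  shows "shift \<epsilon> F \<in> borel_measurable boundary_measure"
proof -
  have "continuous_on siegel_domain F"
    using assms(1) unfolding C1_on_def
    by (meson continuous_at_imp_continuous_on has_derivative_continuous)
  moreover have "(\<lambda>p. (fst p, snd p + of_real \<epsilon>)) ` siegel_boundary \<subseteq>
      (siegel_domain :: ('a, 'n) point set)"
    using assms(2)
    by (auto simp: siegel_boundary_def siegel_domain_def re_part_def inner_add_left of_real_def dot_square_norm)
  ultimately have "continuous_on siegel_boundary (\<lambda>p. F (fst p, snd p + of_real \<epsilon>))"
    by (auto intro!: continuous_on_compose2[of siegel_domain F] continuous_intros)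
  then have "shift \<epsilon> F \<in> borel_measurable (restrict_space borel siegel_boundary)"
    unfolding shift_def case_prod_beta by (rule borel_measurable_continuous_on_restrict)
  then show ?thesis
    unfolding boundary_measure_def
    by (intro measurable_completion) (simp add: measurable_distr_eq1)
qed

definition hardy2 :: "(('a::{real_normed_div_algebra, euclidean_space}, 'n::finite) point \<Rightarrow> 'a) set" where
  "hardy2 = {F. left_regular_on siegel_domain F \<and>
     (SUP \<epsilon>\<in>{0<..}. \<integral>\<^sup>+\<omega>. ennreal ((norm (shift \<epsilon> F \<omega>))\<^sup>2) \<partial>boundary_measure) < \<infinity>}"

text \<open>
  The boundary limit of \<open>F\<close> is an element of \<open>L\<^sup>2\<close>, hence unique only up to null sets;
  \<open>is_boundary_limit F f\<close> says that the function \<open>f\<close> represents it.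
\<close>
definition is_boundary_limit ::
  "(('a::{real_normed_div_algebra, euclidean_space}, 'n::finite) point \<Rightarrow> 'a) \<Rightarrow>
    (('a, 'n) point \<Rightarrow> 'a) \<Rightarrow> bool" where
  "is_boundary_limit F f \<longleftrightarrow>
     f \<in> borel_measurable boundary_measure \<and>
     (\<integral>\<^sup>+\<omega>. ennreal ((norm (f \<omega>))\<^sup>2) \<partial>boundary_measure) < \<infinity> \<and>
     ((\<lambda>\<epsilon>. \<integral>\<^sup>+\<omega>. ennreal ((norm (shift \<epsilon> F \<omega> - f \<omega>))\<^sup>2) \<partial>boundary_measure) \<longlongrightarrow> 0)
       (at_right 0)"


section \<open>The Cauchy-Szego kernel\<close>

definition cauchy_E :: "'a::{real_normed_div_algebra, euclidean_space} \<Rightarrow> 'a" where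
  "cauchy_E \<nu> = (Gamma (real DIM('a) / 2) / (2 * pi powr (real DIM('a) / 2))) *\<^sub>R
     (conjugate \<nu> /\<^sub>R norm \<nu> ^ DIM('a))"

text \<open>The division is exact, since \<open>m\<close> is even.\<close>
definition szego_s :: "nat \<Rightarrow> 'a::{real_normed_div_algebra, euclidean_space} \<Rightarrow> 'a" where
  "szego_s n \<nu> = (let k = DIM('a) * n div 2 in
     ((- 2 / pi) ^ k) *\<^sub>R (dir_deriv 1 ^^ k) cauchy_E \<nu>)"

definition szego_kernel ::
  "('a::{real_normed_div_algebra, euclidean_space}, 'n::finite) point \<Rightarrow> ('a, 'n) point \<Rightarrow> 'a" where
  "szego_kernel = (\<lambda>(z, z') (w, w'). szego_s CARD('n) (z' + conjugate w' - 2 * conj_dot w z))"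

end

theory Submission
  imports Defs
begin

text \<open>
  Write \<open>y\<^sub>0\<close> for the real part of \<open>y\<close>, put \<open>m = DIM('a)\<close> and \<open>k = m n / 2\<close>, and let \<open>E\<^sup>(\<^sup>j\<^sup>)\<close> be
  the \<open>j\<close>-th derivative of the Cauchy kernel \<open>E\<close> in the real direction. The domain has a group of
  affine automorphisms, the left translations of the Heisenberg group, that preserve left
  regularity, the boundary measure and the Szego kernel. They move every point to some
  \<open>(0, r)\<close> with \<open>r > 0\<close>, and there the kernel depends on \<open>\<omega>\<^sub>n\<^sub>+\<^sub>1\<close> only. Moreover it is enough to
  treat the translates \<open>F\<^sub>\<epsilon>\<close>, which are regular across the boundary: the kernel is square integrable
  on the boundary, so the formula survives the limit \<open>\<epsilon> \<rightarrow> 0\<close> in \<open>L\<^sup>2\<close>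
  (\<open>cauchy_szego_reproducing\<close>).

  At \<open>(0, r)\<close> the formula is the composition of three facts about \<open>F = F\<^sub>\<epsilon>\<close> and its slice
  \<open>G(y) = F(0, y)\<close>.

  \<^item> In the first \<open>n\<close> variables \<open>F\<close> is integrated against a function of \<open>|\<omega>'|\<^sup>2\<close>, so a mean value
    property replaces \<open>F(\<omega>', |\<omega>'|\<^sup>2 + t)\<close> by \<open>G(|\<omega>'|\<^sup>2 + t)\<close> (\<open>radial_mean_value\<close>). For
    functions that are only continuously differentiable it follows from the divergence
    theorem for the fields \<open>x\<^sub>j\<^sub>e - conjugate(x\<^sub>j) e\<close>: they have no divergence, are tangential to the
    spheres about 0, and applied to a regular function add up to the Euler derivative.

  \<^item> The image of Lebesgue measure under \<open>\<omega>' \<mapsto> |\<omega>'|\<^sup>2\<close> has density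
    \<open>\<pi>\<^sup>k u\<^sup>k\<^sup>-\<^sup>1 / (k-1)!\<close>, because \<open>A\<^sup>n\<close> has the even dimension \<open>2k\<close>. So the boundary integral of a
    function of \<open>|\<omega>'|\<^sup>2 + t\<close> is an integral over the half-space \<open>y\<^sub>0 > 0\<close> (\<open>integral_strip_radial\<close>).

  \<^item> What remains is
    \<open>G(r) = -2 (-2)\<^sup>k\<^sup>-\<^sup>1 / (k-1)! \<integral> y\<^sub>0\<^sup>k\<^sup>-\<^sup>1 E\<^sup>(\<^sup>k\<^sup>)(r + conjugate y) G(y) dy\<close> over \<open>y\<^sub>0 > 0\<close>
    (\<open>half_space_formula\<close>). Since \<open>r - y = (r + conjugate y) - 2 y\<^sub>0\<close>, the function
    \<open>W(y) = E(r - y) - \<Sum>\<^sub>j\<^sub><\<^sub>k (-2 y\<^sub>0)\<^sup>j / j! E\<^sup>(\<^sup>j\<^sup>)(r + conjugate y)\<close> is a Taylor remainder. It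
    vanishes for \<open>y\<^sub>0 = 0\<close>, its only singularity in the half-space is that of \<open>E(r - y)\<close>, and
    \<open>\<Sum>\<^sub>e (\<partial>W/\<partial>e) e\<close> telescopes to a point mass at \<open>r\<close> and the kernel above. The
    divergence theorem for \<open>W e G\<close> is then the formula.

  Integrability of \<open>G\<close> comes from the mean value property with the weight \<open>conjugate(G)\<close>: as \<open>G\<close> is
  itself radial in \<open>\<omega>'\<close>, this shows that passing to the slice decreases the \<open>L\<^sup>2\<close> norm
  (\<open>slice_norm_le\<close>).

  All divergence theorems reduce to one statement, \<open>integral_directional_derivative_eq_0\<close>, which rests on
  the translation invariance of Lebesgue measure. The class \<open>hypercomplex\<close> records what the proof uses of
  \<open>A\<close>: a multiplicative norm, an orthonormal basis that contains 1, and an even dimension. So the complex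
  numbers and the quaternions are treated at once.
\<close>

section \<open>Algebra of complex numbers and quaternions\<close>

class hypercomplex = real_normed_div_algebra + euclidean_space +
  assumes one_in_Basis: "1 \<in> Basis"
    and even_DIM: "even (card Basis)"

instance complex :: hypercomplex
  by standard (auto simp: Basis_complex_def)

instance quat :: hypercomplex
proof
  show "(1::quat) \<in> Basis" by simp
  have "card (Basis :: quat set) = 4" by simp
  then show "even (card (Basis :: quat set))" by simp
qed

lemma inner_one_one [simp]: "(1::'a::hypercomplex) \<bullet> 1 = 1"
  using one_in_Basis[where 'a='a] by (simp add: inner_Basis)

lemma DIM_pos_half: "DIM('a::hypercomplex) div 2 > 0"
  using even_DIM[where 'a='a] DIM_positive[where 'a='a] by presburger

lemma DIM_half: "DIM('a::hypercomplex) = 2 * (DIM('a) div 2)"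
  using even_DIM[where 'a='a] by simp

lemma conjugate_eq: "conjugate x = (2 * (x \<bullet> 1)) *\<^sub>R 1 - (x::'a::hypercomplex)"
proof -
  have "x = (\<Sum>e\<in>Basis. (x \<bullet> e) *\<^sub>R e)" by (simp add: euclidean_representation)
  also have "\<dots> = (x \<bullet> 1) *\<^sub>R 1 + (\<Sum>e\<in>Basis-{1}. (x \<bullet> e) *\<^sub>R e)"
    using one_in_Basis[where 'a='a] by (simp add: sum.remove)
  finally have "(\<Sum>e\<in>Basis-{1}. (x \<bullet> e) *\<^sub>R e) = x - (x \<bullet> 1) *\<^sub>R 1"
    by (simp add: algebra_simps)
  then show ?thesis
    unfolding conjugate_def re_part_def of_real_def mult_2 scaleR_add_left by simp
qed

lemma linear_conjugate: "bounded_linear (conjugate :: 'a::hypercomplex \<Rightarrow> 'a)"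
proof -
  have "(conjugate :: 'a \<Rightarrow> 'a) = (\<lambda>x. (2 * (x \<bullet> 1)) *\<^sub>R 1 - x)"
    by (simp add: fun_eq_iff conjugate_eq)
  moreover have "bounded_linear (\<lambda>x::'a. (2 * (x \<bullet> 1)) *\<^sub>R (1::'a) - x)"
    by (intro bounded_linear_intros bounded_linear_sub bounded_linear_ident
        bounded_linear_scaleR_const bounded_linear_mult_const bounded_linear_const_mult bounded_linear_inner_left)
  ultimately show ?thesis by simp
qed

lemmas conjugate_add = linear_add[OF bounded_linear.linear[OF linear_conjugate]]
lemmas conjugate_scaleR = linear_cmul[OF bounded_linear.linear[OF linear_conjugate]]
lemmas conjugate_sum = linear_sum[OF bounded_linear.linear[OF linear_conjugate]]
lemmas continuous_on_conjugate [continuous_intros] = bounded_linear.continuous_on[OF linear_conjugate]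

lemma conjugate_conjugate [simp]: "conjugate (conjugate x) = (x::'a::hypercomplex)"
  by (simp add: conjugate_eq inner_diff_left inner_scaleR_left)

lemma conjugate_of_real [simp]: "conjugate (of_real r) = (of_real r :: 'a::hypercomplex)"
  by (simp add: conjugate_eq of_real_def inner_scaleR_left algebra_simps flip: scaleR_add_left)

lemma inner_mult_left_same:
  fixes a x y :: "'a::hypercomplex"
  shows "(a * x) \<bullet> (a * y) = (norm a)\<^sup>2 * (x \<bullet> y)"
proof -
  have "(norm (a * (x + y)))\<^sup>2 = (norm a)\<^sup>2 * (norm (x + y))\<^sup>2"
    by (simp add: norm_mult power_mult_distrib)
  moreover have "(norm (a * x))\<^sup>2 = (norm a)\<^sup>2 * (norm x)\<^sup>2" "(norm (a * y))\<^sup>2 = (norm a)\<^sup>2 * (norm y)\<^sup>2"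
    by (simp_all add: norm_mult power_mult_distrib)
  ultimately show ?thesis
    by (simp add: power2_norm_eq_inner distrib_left inner_add_left inner_add_right inner_commute algebra_simps)
qed

text \<open>
  Polarize \<open>|(1 + a) x| = |1 + a| |x|\<close>: this gives the adjoint of left multiplication, and with it
  all rules for the conjugate, without multiplication tables.
\<close>
lemma inner_conjugate_mult:
  fixes a x y :: "'a::hypercomplex"
  shows "(conjugate a * x) \<bullet> y = x \<bullet> (a * y)"
proof -
  have "((1 + a) * x) \<bullet> ((1 + a) * y) = (norm (1 + a))\<^sup>2 * (x \<bullet> y)"
    by (rule inner_mult_left_same)
  moreover have "(a * x) \<bullet> (a * y) = (norm a)\<^sup>2 * (x \<bullet> y)"
    by (rule inner_mult_left_same)
  moreover have "(norm (1 + a))\<^sup>2 = 1 + 2 * (a \<bullet> 1) + (norm a)\<^sup>2"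
    by (simp add: power2_norm_eq_inner inner_add_left inner_add_right inner_commute)
  ultimately have "(a * x) \<bullet> y + x \<bullet> (a * y) = 2 * (a \<bullet> 1) * (x \<bullet> y)"
    by (simp add: distrib_right inner_add_left inner_add_right algebra_simps)
  then show ?thesis
    by (simp add: conjugate_eq left_diff_distrib inner_diff_left)
qed

lemma conjugate_mult: "conjugate (a * b) = conjugate b * conjugate (a::'a::hypercomplex)"
proof -
  have "(conjugate (a * b) * 1) \<bullet> y = (conjugate b * conjugate a * 1) \<bullet> y" for y
    by (simp only: inner_conjugate_mult mult.assoc)
  then show ?thesis by (metis mult_1_right vector_eq_rdot)
qed

lemma conjugate_mult_self: "conjugate a * a = of_real ((norm (a::'a::hypercomplex))\<^sup>2)"
proof -
  have "(conjugate a * a) \<bullet> y = of_real ((norm a)\<^sup>2) \<bullet> y" for y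
    using inner_mult_left_same[of a 1 y]
    by (simp add: inner_conjugate_mult of_real_def)
  then show ?thesis by (metis vector_eq_rdot)
qed

lemma norm_conjugate [simp]: "norm (conjugate x) = norm (x::'a::hypercomplex)"
proof -
  have "(norm (conjugate x))\<^sup>2 = (norm x)\<^sup>2"
    by (simp add: power2_norm_eq_inner conjugate_eq inner_diff_left inner_diff_right inner_commute algebra_simps)
  then show ?thesis by (simp add: power2_eq_iff_nonneg)
qed

lemma inner_conjugate_one [simp]: "conjugate x \<bullet> 1 = (x::'a::hypercomplex) \<bullet> 1"
  by (simp add: conjugate_eq inner_diff_left)

text \<open>
  \<open>\<Sum>\<^sub>e e \<otimes> e\<close> is the same for every orthonormal basis, and left multiplication by a conjugate is a
  multiple of an isometry with adjoint \<open>a\<close>. Hence \<open>x \<mapsto> f (conjugate a * x)\<close> is left regular when \<open>f\<close> is.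
\<close>
lemma sum_Basis_mult_conjugate:
  fixes L :: "'a::hypercomplex \<Rightarrow> 'a"
  assumes "linear L"
  shows "(\<Sum>e\<in>Basis. e * L (conjugate a * e)) = a * (\<Sum>e\<in>Basis. e * L e)"
proof -
  have "L (conjugate a * e) = (\<Sum>u\<in>Basis. (e \<bullet> (a * u)) *\<^sub>R L u)" for e
  proof -
    have "conjugate a * e = (\<Sum>u\<in>Basis. ((conjugate a * e) \<bullet> u) *\<^sub>R u)"
      by (simp add: euclidean_representation)
    then have "L (conjugate a * e) = L (\<Sum>u\<in>Basis. ((conjugate a * e) \<bullet> u) *\<^sub>R u)" by simp
    also have "\<dots> = (\<Sum>u\<in>Basis. ((conjugate a * e) \<bullet> u) *\<^sub>R L u)"
      by (simp add: linear_sum[OF assms] linear_cmul[OF assms])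
    finally show ?thesis by (simp add: inner_conjugate_mult)
  qed
  then have "(\<Sum>e\<in>Basis. e * L (conjugate a * e)) = (\<Sum>e\<in>Basis. \<Sum>u\<in>Basis. (e \<bullet> (a * u)) *\<^sub>R (e * L u))"
    by (simp add: sum_distrib_left)
  also have "\<dots> = (\<Sum>u\<in>Basis. \<Sum>e\<in>Basis. (e \<bullet> (a * u)) *\<^sub>R (e * L u))"
    by (rule sum.swap)
  also have "\<dots> = (\<Sum>u\<in>Basis. (\<Sum>e\<in>Basis. ((a * u) \<bullet> e) *\<^sub>R e) * L u)"
    by (simp add: sum_distrib_right inner_commute)
  also have "\<dots> = (\<Sum>u\<in>Basis. (a * u) * L u)"
    by (simp only: euclidean_representation)
  finally show ?thesis by (simp add: sum_distrib_left mult.assoc)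
qed

lemma conjugate_mult_Basis_self:
  "e \<in> Basis \<Longrightarrow> conjugate e * (e::'a::hypercomplex) = 1"
  by (simp add: conjugate_mult_self)

definition imag :: "'a::hypercomplex \<Rightarrow> 'a" where
  "imag y = y - (y \<bullet> 1) *\<^sub>R 1"

lemma imag_inner_one [simp]: "imag y \<bullet> 1 = 0"
  by (simp add: imag_def inner_diff_left)

lemma linear_imag: "bounded_linear (imag :: 'a::hypercomplex \<Rightarrow> 'a)"
  unfolding imag_def
  by (intro bounded_linear_sub bounded_linear_ident
        bounded_linear_scaleR_const bounded_linear_inner_left)

lemmas continuous_on_imag [continuous_intros] = bounded_linear.continuous_on[OF linear_imag]

section \<open>Integrals of directional derivatives\<close>

lemma integral_lborel_translate:
  fixes f :: "'v::euclidean_space \<Rightarrow> 'w::euclidean_space"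
  assumes [measurable]: "f \<in> borel_measurable borel"
  shows "(\<integral>x. f (x + c) \<partial>lborel) = (\<integral>x. f x \<partial>lborel)"
proof -
  have "(\<integral>x. f x \<partial>lborel) = (\<integral>x. f x \<partial>(distr lborel borel ((+) c)))"
    by (simp add: lborel_distr_plus)
  also have "\<dots> = (\<integral>x. f (c + x) \<partial>lborel)" by (rule integral_distr) auto
  finally show ?thesis by (simp add: add.commute)
qed

lemma nn_integral_lborel_translate:
  fixes f :: "'v::euclidean_space \<Rightarrow> ennreal"
  assumes [measurable]: "f \<in> borel_measurable borel"
  shows "(\<integral>\<^sup>+x. f (x + c) \<partial>lborel) = (\<integral>\<^sup>+x. f x \<partial>lborel)"
proof -
  have "(\<integral>\<^sup>+x. f x \<partial>lborel) = (\<integral>\<^sup>+x. f x \<partial>(distr lborel borel ((+) c)))"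
    by (simp add: lborel_distr_plus)
  also have "\<dots> = (\<integral>\<^sup>+x. f (c + x) \<partial>lborel)" by (rule nn_integral_distr) auto
  finally show ?thesis by (simp add: add.commute)
qed

lemma integrable_lborel_translate:
  fixes f :: "'v::euclidean_space \<Rightarrow> 'w::euclidean_space"
  assumes "integrable lborel f"
  shows "integrable lborel (\<lambda>x. f (x + c))"
proof -
  have "integrable (distr lborel borel ((+) c)) f" using assms by (simp add: lborel_distr_plus)
  then have "integrable lborel (\<lambda>x. f (c + x))" by (subst (asm) integrable_distr_eq) (use assms in auto)
  then show ?thesis by (simp add: add.commute)
qed

lemma integrable_bounded_support:
  fixes f :: "'v::euclidean_space \<Rightarrow> 'w::euclidean_space"
  assumes "f \<in> borel_measurable borel" "\<And>x. norm (f x) \<le> B" "\<And>x. norm x > R \<Longrightarrow> f x = 0"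
  shows "integrable lborel f"
proof (rule integrableI_bounded_set)
  show "cball 0 R \<in> sets lborel" by simp
  show "emeasure lborel (cball (0::'v) R) < \<infinity>"
    by (rule emeasure_bounded_finite) simp
qed (use assms in auto)

text \<open>
  Fubini and the fundamental theorem of calculus in \<open>s\<close>. Finitely many exceptional parameters on each line are allowed because the half-space
  argument uses functions with a kink on a hyperplane.
\<close>
lemma integral_increment:
  fixes K k :: "'v::euclidean_space \<Rightarrow> real \<Rightarrow> 'w::euclidean_space"
  assumes cont: "\<And>x. continuous_on {0..1} (K x)"
    and deriv: "\<And>x. \<exists>S. finite S \<and> (\<forall>s. s \<notin> S \<longrightarrow> 0 < s \<longrightarrow> s < 1 \<longrightarrow> (K x has_vector_derivative k x s) (at s))"
    and meas: "(\<lambda>(x, s). indicator {0..1} s *\<^sub>R k x s) \<in> borel_measurable (lborel \<Otimes>\<^sub>M lborel)"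
    and bdd: "\<And>x s. s \<in> {0..1} \<Longrightarrow> norm (k x s) \<le> B"
    and supp: "\<And>x s. s \<in> {0..1} \<Longrightarrow> norm x > R \<Longrightarrow> k x s = 0"
    and c: "\<And>s. s \<in> {0<..1} \<Longrightarrow> (\<integral>x. k x s \<partial>lborel) = c"
  shows "(\<integral>x. K x 1 - K x 0 \<partial>lborel) = c"
proof -
  have B: "0 \<le> B" using bdd[of 0 0] norm_ge_zero[of "k 0 0"] by (meson atLeastAtMost_iff order_refl order_trans zero_le_one)
  define f where "f = (\<lambda>(x, s). indicator {0..1::real} s *\<^sub>R k x s)"
  have f_meas [measurable]: "f \<in> borel_measurable (lborel \<Otimes>\<^sub>M lborel)"
    using meas by (simp add: f_def)
  have line: "(\<integral>s. f (x, s) \<partial>lborel) = K x 1 - K x 0" for x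
  proof -
    obtain S where S: "finite S"
      "\<And>s. s \<notin> S \<Longrightarrow> 0 < s \<Longrightarrow> s < 1 \<Longrightarrow> (K x has_vector_derivative k x s) (at s)"
      using deriv by blast
    have "((\<lambda>s. k x s) has_integral (K x 1 - K x 0)) {0..1}"
      by (rule fundamental_theorem_of_calculus_interior_strong[OF S(1)]) (use S cont in auto)
    moreover have "set_integrable lborel {0..1} (k x)"
      unfolding set_integrable_def
    proof (rule integrable_bounded_support[where B=B and R=1])
      have "(\<lambda>s. f (x, s)) \<in> borel_measurable borel" by measurable
      then show "(\<lambda>s. indicat_real {0..1} s *\<^sub>R k x s) \<in> borel_measurable borel" by (simp add: f_def)
      show "norm (indicat_real {0..1} s *\<^sub>R k x s) \<le> B" for s
        using bdd[of s x] B by (auto simp: indicator_def)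
      show "indicat_real {0..1} s *\<^sub>R k x s = 0" if "norm s > 1" for s :: real
        using that by (auto simp: indicator_def)
    qed
    ultimately show ?thesis
      unfolding f_def using set_borel_integral_eq_integral(2)
      by (fastforce simp: set_lebesgue_integral_def dest: integral_unique)
  qed
  have int_f: "integrable (lborel \<Otimes>\<^sub>M lborel) f"
  proof (rule integrableI_bounded_set[OF _ f_meas])
    let ?A = "cball (0::'v) R \<times> {0..1::real}"
    show "?A \<in> sets (lborel \<Otimes>\<^sub>M lborel)" by auto
    have "emeasure (lborel \<Otimes>\<^sub>M lborel) ?A =
        emeasure lborel (cball (0::'v) R) * emeasure lborel {0..1::real}"
      by (rule lborel.emeasure_pair_measure_Times) auto
    also have "\<dots> < \<infinity>"
      using emeasure_bounded_finite[of "cball (0::'v) R"] by (simp add: ennreal_mult_less_top)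
    finally show "emeasure (lborel \<Otimes>\<^sub>M lborel) ?A < \<infinity>" .
    show "AE z in lborel \<Otimes>\<^sub>M lborel. z \<in> ?A \<longrightarrow> norm (f z) \<le> B"
      using bdd B by (auto simp: f_def indicator_def split_beta)
    have "f (x, s) = 0" if "(x, s) \<notin> ?A" for x s
      using that supp[of s x] by (auto simp: f_def indicator_def)
    then show "AE z in lborel \<Otimes>\<^sub>M lborel. z \<notin> ?A \<longrightarrow> f z = 0" by (intro AE_I2) (metis surj_pair)
  qed
  have "(\<integral>x. (\<integral>s. f (x, s) \<partial>lborel) \<partial>lborel) = (\<integral>s. (\<integral>x. f (x, s) \<partial>lborel) \<partial>lborel)"
    using lborel_pair.Fubini_integral[of "\<lambda>x s. f (x, s)"] int_f by simp
  also have "\<dots> = (\<integral>s. indicator {0..1::real} s *\<^sub>R c \<partial>lborel)"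
  proof (rule integral_cong_AE)
    show "AE s in lborel. (\<integral>x. f (x, s) \<partial>lborel) = indicator {0..1::real} s *\<^sub>R c"
      using AE_lborel_singleton[of "0::real"] by eventually_elim (auto simp: f_def c indicator_def)
  qed measurable
  also have "\<dots> = c"
    by (subst has_bochner_integral_integral_eq[OF has_bochner_integral_scaleR_left[OF has_bochner_integral_real_indicator]]) auto
  finally show ?thesis by (simp add: line)
qed

text \<open>
  The divergence theorem for compact support in its simplest form: \<open>\<integral> g(x + v) - g(x) dx = 0\<close> by
  translation invariance, and the integrand is the integral of the derivative along the segment.
\<close>
lemma integral_directional_derivative_eq_0:
  fixes g g' :: "'v::euclidean_space \<Rightarrow> 'w::euclidean_space"
  assumes cont: "continuous_on UNIV g"
    and meas [measurable]: "g' \<in> borel_measurable borel"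
    and bdd: "\<And>x. norm (g' x) \<le> B"
    and supp: "\<And>x. norm x > R \<Longrightarrow> g x = 0" "\<And>x. norm x > R \<Longrightarrow> g' x = 0"
    and deriv: "\<And>x. \<exists>S. finite S \<and>
      (\<forall>s. s \<notin> S \<longrightarrow> ((\<lambda>s. g (x + s *\<^sub>R v)) has_vector_derivative g' (x + s *\<^sub>R v)) (at s))"
  shows "integral\<^sup>L lborel g' = 0"
proof -
  have "bounded (g ` cball 0 R)"
    by (intro compact_imp_bounded compact_continuous_image continuous_on_subset[OF cont]) auto
  then obtain M where M: "\<forall>y\<in>g ` cball 0 R. norm y \<le> M" unfolding bounded_iff by blast
  have "norm (g x) \<le> max M 0" for x
  proof (cases "norm x > R")
    case False
    then have "norm (g x) \<le> M" using M by auto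
    then show ?thesis by simp
  qed (simp add: supp(1))
  then have int_g: "integrable lborel g"
    using supp(1) by (intro integrable_bounded_support[of g "max M 0" R] borel_measurable_continuous_onI[OF cont]) auto
  have "(\<integral>x. g (x + 1 *\<^sub>R v) - g (x + 0 *\<^sub>R v) \<partial>lborel) = integral\<^sup>L lborel g'"
  proof (rule integral_increment[where K="\<lambda>x s. g (x + s *\<^sub>R v)" and k="\<lambda>x s. g' (x + s *\<^sub>R v)" and B=B and R="R + norm v"])
    show "continuous_on {0..1} (\<lambda>s. g (x + s *\<^sub>R v))" for x
      by (intro continuous_on_compose2[OF cont] continuous_intros) auto
    show "\<exists>S. finite S \<and> (\<forall>s. s \<notin> S \<longrightarrow> 0 < s \<longrightarrow> s < 1 \<longrightarrow>
        ((\<lambda>s. g (x + s *\<^sub>R v)) has_vector_derivative g' (x + s *\<^sub>R v)) (at s))" for x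
      using deriv[of x] by blast
    show "(\<lambda>(x, s). indicat_real {0..1} s *\<^sub>R g' (x + s *\<^sub>R v)) \<in> borel_measurable (lborel \<Otimes>\<^sub>M lborel)"
      by measurable
    show "g' (x + s *\<^sub>R v) = 0" if "s \<in> {0..1}" "norm x > R + norm v" for x s
    proof -
      have "norm (s *\<^sub>R v) \<le> norm v" using that by (simp add: mult_left_le_one_le)
      moreover have "norm x \<le> norm (x + s *\<^sub>R v) + norm (s *\<^sub>R v)"
        using norm_triangle_ineq4[of "x + s *\<^sub>R v" "s *\<^sub>R v"] by simp
      ultimately have "norm (x + s *\<^sub>R v) > R" using that by linarith
      then show ?thesis by (rule supp(2))
    qed
    show "(\<integral>x. g' (x + s *\<^sub>R v) \<partial>lborel) = integral\<^sup>L lborel g'" for s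
      by (rule integral_lborel_translate) measurable
  qed (rule bdd)
  moreover have "(\<integral>x. g (x + v) - g x \<partial>lborel) = (\<integral>x. g (x + v) \<partial>lborel) - (\<integral>x. g x \<partial>lborel)"
    using int_g by (intro Bochner_Integration.integral_diff integrable_lborel_translate)
  ultimately show ?thesis
    by (simp add: integral_lborel_translate borel_measurable_continuous_onI[OF cont])
qed

lemma has_derivative_line:
  assumes "(g has_derivative g') (at (x + s *\<^sub>R v))"
  shows "((\<lambda>s. g (x + s *\<^sub>R v)) has_vector_derivative g' v) (at s)"
proof -
  have "((\<lambda>s. g (x + s *\<^sub>R v)) has_derivative (\<lambda>t. g' (t *\<^sub>R v))) (at s)"
    by (rule has_derivative_compose[where f="\<lambda>s. x + s *\<^sub>R v", OF _ assms]) (auto intro!: derivative_eq_intros)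
  then show ?thesis
    unfolding has_vector_derivative_def
    by (simp add: linear_cmul[OF has_derivative_linear[OF assms]])
qed

lemma bounded_if_continuous_bounded_support:
  fixes f :: "'v::euclidean_space \<Rightarrow> 'w::real_normed_vector"
  assumes "continuous_on UNIV f" "\<And>x. norm x > R \<Longrightarrow> f x = 0"
  obtains B where "B \<ge> 0" "\<And>x. norm (f x) \<le> B"
proof -
  have "bounded (f ` cball 0 R)"
    by (intro compact_imp_bounded compact_continuous_image continuous_on_subset[OF assms(1)]) auto
  then obtain M where M: "\<forall>y\<in>f ` cball 0 R. norm y \<le> M" unfolding bounded_iff by blast
  have "norm (f x) \<le> max M 0" for x
  proof (cases "norm x > R")
    case False
    then have "norm (f x) \<le> M" using M by auto
    then show ?thesis by simp
  qed (simp add: assms(2))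
  then show ?thesis using that[of "max M 0"] by simp
qed

lemma integral_has_derivative_eq_0:
  fixes g :: "'v::euclidean_space \<Rightarrow> 'w::euclidean_space"
  assumes deriv: "\<And>x. (g has_derivative g' x) (at x)"
    and cont: "continuous_on UNIV (\<lambda>x. g' x v)"
    and supp: "\<And>x. norm x > R \<Longrightarrow> g x = 0"
  shows "(\<integral>x. g' x v \<partial>lborel) = 0" and "integrable lborel (\<lambda>x. g' x v)"
proof -
  have supp': "g' x v = 0" if "norm x > R" for x
  proof -
    have "(g has_derivative (\<lambda>_. 0)) (at x)"
      by (rule has_derivative_transform_within_open[of "\<lambda>_. 0" _ _ _ "- cball 0 R"]) (use that supp in auto)
    then have "g' x = (\<lambda>_. 0)" by (rule has_derivative_unique[OF deriv])
    then show ?thesis by simp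
  qed
  obtain B where "B \<ge> 0" and B: "\<And>x. norm (g' x v) \<le> B"
    by (rule bounded_if_continuous_bounded_support[OF cont supp']) auto
  show "(\<integral>x. g' x v \<partial>lborel) = 0"
  proof (rule integral_directional_derivative_eq_0[OF _ _ B supp supp'])
    show "continuous_on UNIV g"
      by (rule has_derivative_continuous_on) (use deriv has_derivative_at_withinI in blast)
    show "(\<lambda>x. g' x v) \<in> borel_measurable borel" by (rule borel_measurable_continuous_onI[OF cont])
    show "\<exists>S. finite S \<and> (\<forall>s. s \<notin> S \<longrightarrow>
        ((\<lambda>s. g (x + s *\<^sub>R v)) has_vector_derivative g' (x + s *\<^sub>R v) v) (at s))" for x
      by (intro exI[of _ "{}"]) (auto intro: has_derivative_line deriv)
  qed
  show "integrable lborel (\<lambda>x. g' x v)"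
    by (rule integrable_bounded_support[OF borel_measurable_continuous_onI[OF cont] B supp'])
qed

section \<open>The boundary measure and polar coordinates\<close>

text \<open>
  On the strip the real part of the last variable runs through an interval of length 1. Functions that
  ignore this real part thus have the same integral over the strip as over \<open>A\<^sup>n\<close> times the
  imaginary hyperplane, while all computations take place in Lebesgue measure on \<open>A\<^sup>n \<times> A\<close>.
\<close>
definition strip :: "('v::euclidean_space \<times> 'a::hypercomplex) measure" where
  "strip = density lborel (\<lambda>z. indicator {0..1} (snd z \<bullet> 1))"

lemma sets_strip [measurable_cong, simp]: "sets strip = sets borel"
  by (simp add: strip_def)

lemma space_strip [simp]: "space strip = UNIV"
  by (simp add: strip_def)

lemma borel_measurable_imag [measurable]: "imag \<in> borel_measurable borel"
  by (intro borel_measurable_continuous_onI continuous_intros)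

lemma borel_measurable_conjugate [measurable]: "(conjugate :: 'a::hypercomplex \<Rightarrow> 'a) \<in> borel_measurable borel"
  by (intro borel_measurable_continuous_onI continuous_intros)

lemma borel_measurable_of_real' [measurable (raw)]:
  "f \<in> borel_measurable M \<Longrightarrow> (\<lambda>x. of_real (f x) :: 'a::hypercomplex) \<in> borel_measurable M"
  unfolding of_real_def by (intro borel_measurable_scaleR borel_measurable_const)

lemma borel_measurable_snd_inner:
  "(\<lambda>z::'v::euclidean_space \<times> 'a::euclidean_space. snd z \<bullet> c) \<in> borel_measurable borel"
  by (intro borel_measurable_continuous_onI continuous_intros)

lemma nn_integral_strip:
  fixes f :: "'v::euclidean_space \<times> 'a::hypercomplex \<Rightarrow> ennreal"
  assumes [measurable]: "f \<in> borel_measurable borel"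
  shows "(\<integral>\<^sup>+z. f z \<partial>strip) =
    (\<integral>\<^sup>+x. \<integral>\<^sup>+y. indicator {0..1} (y \<bullet> 1) * f (x, y) \<partial>lborel \<partial>lborel)"
proof -
  have [measurable]: "f \<in> borel_measurable (lborel \<Otimes>\<^sub>M lborel)"
    by (simp add: lborel_prod)
  have ind: "(\<lambda>z::'v \<times> 'a. indicator {0..1} (snd z \<bullet> 1) :: ennreal) \<in> borel_measurable lborel"
    using measurable_compose[OF borel_measurable_snd_inner borel_measurable_indicator[of "{0..1}"]] by simp
  have "(\<integral>\<^sup>+z. f z \<partial>strip) = (\<integral>\<^sup>+z. indicator {0..1} (snd z \<bullet> 1) * f z \<partial>lborel)"
    unfolding strip_def by (rule nn_integral_density[OF ind]) (simp add: assms)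
  also have "\<dots> = (\<integral>\<^sup>+z. indicator {0..1} (snd z \<bullet> 1) * f z \<partial>(lborel \<Otimes>\<^sub>M lborel))"
    by (simp only: lborel_prod)
  also have "\<dots> = (\<integral>\<^sup>+x. \<integral>\<^sup>+y. indicator {0..1} (snd (x, y) \<bullet> 1) * f (x, y) \<partial>lborel \<partial>lborel)"
    by (rule lborel.nn_integral_fst[symmetric]) measurable
  finally show ?thesis by simp
qed

text \<open>
  Lebesgue measure on \<open>A\<close> is the product of the one on the real axis and the one on the imaginary units, and
  the real axis contributes the factor 1, the length of \<open>[0, 1]\<close>.
\<close>
lemma nn_integral_imaginary_units:
  fixes h :: "'a::hypercomplex \<Rightarrow> ennreal"
  assumes [measurable]: "h \<in> borel_measurable borel"
  shows "(\<integral>\<^sup>+t. h (\<Sum>e\<in>Basis-{1}. t e *\<^sub>R e) \<partial>PiM (Basis-{1}) (\<lambda>_. lborel)) =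
    (\<integral>\<^sup>+y. indicator {0..1} (y \<bullet> 1) * h (imag y) \<partial>lborel)"
proof -
  interpret product_sigma_finite "\<lambda>_::'a. lborel :: real measure" ..
  let ?J = "Basis - {1::'a}"
  have J: "insert 1 ?J = (Basis :: 'a set)" using one_in_Basis[where 'a='a] by auto
  have re: "(\<Sum>e\<in>Basis. f e *\<^sub>R e) \<bullet> (1::'a) = f 1" for f :: "'a \<Rightarrow> real"
    by (rule inner_sum_left_Basis[OF one_in_Basis])
  have im: "imag (\<Sum>e\<in>Basis. f e *\<^sub>R (e::'a)) = (\<Sum>e\<in>?J. f e *\<^sub>R e)" for f :: "'a \<Rightarrow> real"
    unfolding imag_def re using one_in_Basis[where 'a='a] by (simp add: sum.remove)
  have "(\<integral>\<^sup>+y. indicator {0..1} (y \<bullet> 1) * h (imag y) \<partial>lborel) =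
      (\<integral>\<^sup>+f. indicator {0..1} (f 1) * h (\<Sum>e\<in>?J. f e *\<^sub>R e) \<partial>PiM (insert 1 ?J) (\<lambda>_. lborel))"
    unfolding J by (subst lborel_eq[where 'a='a], subst nn_integral_distr) (auto simp: re im)
  also have "\<dots> = (\<integral>\<^sup>+t. \<integral>\<^sup>+u. indicator {0..1} ((t(1 := u)) 1) *
      h (\<Sum>e\<in>?J. (t(1 := u)) e *\<^sub>R e) \<partial>lborel \<partial>PiM ?J (\<lambda>_. lborel))"
  proof (rule product_nn_integral_insert)
    have comp: "(\<lambda>f. f e) \<in> borel_measurable (PiM (insert 1 ?J) (\<lambda>_. lborel))"
      if "e \<in> insert 1 ?J" for e
      using measurable_component_singleton[of e "insert 1 ?J" "\<lambda>_. lborel"] that by simp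
    have [measurable]: "(\<lambda>f. \<Sum>e\<in>?J. f e *\<^sub>R e) \<in> borel_measurable (PiM (insert 1 ?J) (\<lambda>_. lborel))"
      by (intro borel_measurable_sum borel_measurable_scaleR borel_measurable_const comp) auto
    have [measurable]: "(\<lambda>f. f 1) \<in> borel_measurable (PiM (insert 1 ?J) (\<lambda>_. lborel))"
      by (rule comp) simp
    show "(\<lambda>f. indicator {0..1} (f 1) * h (\<Sum>e\<in>?J. f e *\<^sub>R e))
        \<in> borel_measurable (PiM (insert 1 ?J) (\<lambda>_. lborel))"
      by measurable
  qed auto
  also have "\<dots> = (\<integral>\<^sup>+t. \<integral>\<^sup>+u. h (\<Sum>e\<in>?J. t e *\<^sub>R e) * indicator {0..1} (u::real) \<partial>lborel \<partial>PiM ?J (\<lambda>_. lborel))"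
    by (intro nn_integral_cong) (auto simp: mult.commute intro!: arg_cong[where f=h] sum.cong)
  also have "\<dots> = (\<integral>\<^sup>+t. h (\<Sum>e\<in>?J. t e *\<^sub>R e) \<partial>PiM ?J (\<lambda>_. lborel))"
    by (subst nn_integral_cmult_indicator) auto
  finally show ?thesis by simp
qed

lemma norm_sq_eq: "norm_sq x = x \<bullet> (x :: 'a::hypercomplex ^ 'n::finite)"
  by (simp add: norm_sq_def inner_vec_def power2_norm_eq_inner)

definition strip_param :: "('a::hypercomplex ^ 'n::finite) \<times> 'a \<Rightarrow> ('a, 'n) point" where
  "strip_param = (\<lambda>(x, y). (x, of_real (x \<bullet> x) + imag y))"

lemma strip_param_measurable [measurable]:
  "strip_param \<in> strip \<rightarrow>\<^sub>M restrict_space borel siegel_boundary"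
proof (rule measurable_restrict_space2)
  show "strip_param \<in> space strip \<rightarrow> siegel_boundary"
    by (auto simp: strip_param_def siegel_boundary_def norm_sq_eq re_part_def inner_add_left of_real_def)
  show "strip_param \<in> borel_measurable strip"
    unfolding strip_param_def case_prod_beta
    by (subst measurable_cong_sets[OF sets_strip refl]) (intro borel_measurable_continuous_onI continuous_intros)
qed

lemma boundary_measure_eq_strip:
  "(boundary_measure :: ('a::hypercomplex, 'n::finite) point measure) =
    completion (distr strip (restrict_space borel siegel_boundary) strip_param)"
proof -
  let ?R = "restrict_space borel siegel_boundary :: ('a, 'n) point measure"
  let ?P = "PiM (Basis - {1}) (\<lambda>_. lborel) :: ('a \<Rightarrow> real) measure"
  let ?M = "(lborel :: ('a ^ 'n) measure) \<Otimes>\<^sub>M ?P"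
  interpret P: product_sigma_finite "\<lambda>_::'a. lborel :: real measure" ..
  interpret P: sigma_finite_measure ?P by (rule P.sigma_finite) simp
  have bp [measurable]: "boundary_param \<in> ?M \<rightarrow>\<^sub>M ?R"
    by (rule measurable_boundary_param) (rule one_in_Basis)
  have "distr ?M ?R boundary_param = distr strip ?R strip_param"
  proof (rule measure_eqI)
    fix X assume "X \<in> sets (distr ?M ?R boundary_param)"
    then have X [measurable]: "X \<in> sets ?R" by simp
    then obtain Y where Y [measurable]: "Y \<in> sets borel" and XY: "X = siegel_boundary \<inter> Y"
      unfolding sets_restrict_space by auto
    have "emeasure (distr ?M ?R boundary_param) X = (\<integral>\<^sup>+z. indicator X z \<partial>distr ?M ?R boundary_param)"
      by simp
    also have "\<dots> = (\<integral>\<^sup>+z. indicator X (boundary_param z) \<partial>?M)"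
      by (rule nn_integral_distr) auto
    also have "\<dots> = (\<integral>\<^sup>+x. \<integral>\<^sup>+t. indicator X (boundary_param (x, t)) \<partial>?P \<partial>lborel)"
      by (rule P.nn_integral_fst[symmetric]) measurable
    also have "\<dots> = (\<integral>\<^sup>+x. \<integral>\<^sup>+y. indicator {0..1} (y \<bullet> 1) * indicator X (strip_param (x, y)) \<partial>lborel \<partial>lborel)"
    proof (rule nn_integral_cong)
      fix x :: "'a ^ 'n"
      have "(\<integral>\<^sup>+t. indicator X (boundary_param (x, t)) \<partial>?P) =
          (\<integral>\<^sup>+t. indicator Y (x, of_real (x \<bullet> x) + (\<Sum>e\<in>Basis-{1}. t e *\<^sub>R e)) \<partial>?P)"
        using measurable_space[OF bp]
        by (intro nn_integral_cong) (auto simp: XY indicator_def boundary_param_def norm_sq_eq space_pair_measure space_restrict_space)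
      also have "\<dots> = (\<integral>\<^sup>+y. indicator {0..1} (y \<bullet> 1) * indicator Y (x, of_real (x \<bullet> x) + imag y) \<partial>lborel)"
        by (rule nn_integral_imaginary_units) measurable
      also have "\<dots> = (\<integral>\<^sup>+y. indicator {0..1} (y \<bullet> 1) * indicator X (strip_param (x, y)) \<partial>lborel)"
        using measurable_space[OF strip_param_measurable]
        by (intro nn_integral_cong) (auto simp: XY indicator_def strip_param_def space_restrict_space)
      finally show "(\<integral>\<^sup>+t. indicator X (boundary_param (x, t)) \<partial>?P) =
        (\<integral>\<^sup>+y. indicator {0..1} (y \<bullet> 1) * indicator X (strip_param (x, y)) \<partial>lborel)" .
    qed
    also have "\<dots> = (\<integral>\<^sup>+z. indicator X (strip_param z) \<partial>strip)"
      by (subst nn_integral_strip) auto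
    also have "\<dots> = (\<integral>\<^sup>+z. indicator X z \<partial>distr strip ?R strip_param)"
      by (rule nn_integral_distr[symmetric]) auto
    finally show "emeasure (distr ?M ?R boundary_param) X = emeasure (distr strip ?R strip_param) X"
      by simp
  qed simp
  then show ?thesis unfolding boundary_measure_def by (rule arg_cong)
qed

text \<open>
  The area of the sphere of radius \<open>sqrt u\<close> in dimension \<open>2 k\<close>, divided by \<open>2 sqrt u\<close>: the density of the
  squared norm.
\<close>
definition radial_weight :: "nat \<Rightarrow> real \<Rightarrow> real" where
  "radial_weight k u = (if u > 0 then pi ^ k / fact (k - 1) * u ^ (k - 1) else 0)"

lemma radial_weight_nonneg [simp]: "radial_weight k u \<ge> 0"
  by (simp add: radial_weight_def)

lemma borel_measurable_radial_weight [measurable]: "radial_weight k \<in> borel_measurable borel"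
  unfolding radial_weight_def by measurable

text \<open>
  Both measures give \<open>{..a}\<close> the volume of the ball of radius \<open>sqrt a\<close>. This replaces polar coordinates.
\<close>
lemma distr_inner_self:
  assumes k: "DIM('v::euclidean_space) = 2 * k" "k > 0"
  shows "distr (lborel :: 'v measure) borel (\<lambda>x. x \<bullet> x) = density lborel (\<lambda>u. ennreal (radial_weight k u))"
    (is "?M = ?N")
proof -
  have eq: "emeasure ?M {..a} = ennreal (pi ^ k / fact k * (max a 0) ^ k)"
    "emeasure ?N {..a} = ennreal (pi ^ k / fact k * (max a 0) ^ k)" for a
  proof -
    have "emeasure ?M {..a} = emeasure lborel {x::'v. x \<bullet> x \<le> a}"
      by (subst emeasure_distr) (auto intro!: arg_cong[where f="emeasure lborel"])
    also have "\<dots> = ennreal (pi ^ k / fact k * (max a 0) ^ k)"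
    proof (cases "a \<ge> 0")
      case True
      have "{x::'v. x \<bullet> x \<le> a} = cball 0 (sqrt a)"
        using True by (auto simp: norm_eq_sqrt_inner)
      moreover have "sqrt a ^ DIM('v) = a ^ k" using True by (simp add: k power_mult)
      ultimately show ?thesis using True
        by (simp add: emeasure_cball k unit_ball_vol_even[of k, simplified])
    next
      case False
      then have "{x::'v. x \<bullet> x \<le> a} = {}" by (auto simp: not_le) (smt (verit) inner_ge_zero)
      then show ?thesis using False k by simp
    qed
    finally show "emeasure ?M {..a} = ennreal (pi ^ k / fact k * (max a 0) ^ k)" .
    let ?F = "\<lambda>u. pi ^ k / fact k * u ^ k :: real"
    let ?f = "\<lambda>u. pi ^ k / fact (k - 1) * u ^ (k - 1) :: real"
    have "emeasure ?N {..a} = (\<integral>\<^sup>+u. ennreal (radial_weight k u) * indicator {..a} u \<partial>lborel)"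
      by (rule emeasure_density) auto
    also have "\<dots> = (\<integral>\<^sup>+u. ennreal (?f u) * indicator {0..max a 0} u \<partial>lborel)"
      using AE_lborel_singleton[of 0]
      by (intro nn_integral_cong_AE, eventually_elim) (auto simp: radial_weight_def indicator_def)
    also have "\<dots> = ?F (max a 0) - ?F 0"
    proof (rule nn_integral_FTC_Icc)
      show "(?F has_real_derivative ?f x) (at x)" for x
      proof -
        have "(?F has_real_derivative pi ^ k / fact k * (real k * x ^ (k - 1))) (at x)"
          by (auto intro!: derivative_eq_intros)
        moreover have "pi ^ k / fact k * (real k * x ^ (k - 1)) = ?f x"
          using k(2) by (simp add: fact_reduce)
        ultimately show ?thesis by simp
      qed
    qed auto
    finally show "emeasure ?N {..a} = ennreal (pi ^ k / fact k * (max a 0) ^ k)"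
      using k by (simp add: zero_power)
  qed
  show ?thesis
  proof (rule measure_eqI_generator_eq[where E="range (\<lambda>a. {..a::real})" and \<Omega>=UNIV and A="\<lambda>i. {..real i}"])
    show "Int_stable (range (\<lambda>a. {..a::real}))"
      by (auto simp: Int_stable_def intro!: exI[of _ "min _ _"])
    show "sets ?M = sigma_sets UNIV (range (\<lambda>a. {..a}))" "sets ?N = sigma_sets UNIV (range (\<lambda>a. {..a}))"
      by (simp_all add: borel_eq_atMost)
    show "(\<Union>i. {..real i}) = UNIV" using real_arch_simple by auto
    show "emeasure ?M {..real i} \<noteq> \<infinity>" for i by (simp add: eq)
  qed (auto simp: eq)
qed

lemma nn_integral_inner_self:
  fixes f :: "real \<Rightarrow> ennreal"
  assumes k: "DIM('v::euclidean_space) = 2 * k" "k > 0" and [measurable]: "f \<in> borel_measurable borel"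
  shows "(\<integral>\<^sup>+x. f ((x::'v) \<bullet> x) \<partial>lborel) = (\<integral>\<^sup>+u. ennreal (radial_weight k u) * f u \<partial>lborel)"
proof -
  have "(\<integral>\<^sup>+x. f ((x::'v) \<bullet> x) \<partial>lborel) = (\<integral>\<^sup>+u. f u \<partial>distr (lborel :: 'v measure) borel (\<lambda>x. x \<bullet> x))"
    by (subst nn_integral_distr) auto
  also have "\<dots> = (\<integral>\<^sup>+u. ennreal (radial_weight k u) * f u \<partial>lborel)"
    by (simp add: distr_inner_self[OF k] nn_integral_density)
  finally show ?thesis .
qed

text \<open>
  By the density of \<open>|x|\<^sup>2\<close>, the point \<open>u + imag y\<close> has to be integrated over \<open>u\<close> and the strip. The
  translations \<open>u \<mapsto> u + y\<^sub>0\<close> and \<open>y \<mapsto> y - u\<close> turn \<open>(u, imag y)\<close> into the real and imaginary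
  part of a single variable, and the integral over the strip direction becomes 1.
\<close>
lemma distr_strip_paraboloid:
  assumes k: "DIM('v::euclidean_space) = 2 * k" "k > 0"
  shows "distr (strip :: ('v \<times> 'a::hypercomplex) measure) borel (\<lambda>(x, y). of_real (x \<bullet> x) + imag y) =
    density lborel (\<lambda>y. ennreal (radial_weight k (y \<bullet> 1)))" (is "?M = ?N")
proof (rule measure_eqI)
  fix X assume "X \<in> sets ?M"
  then have [measurable]: "X \<in> sets borel" by simp
  let ?I = "indicator {0..1::real} :: real \<Rightarrow> ennreal"
  let ?w = "\<lambda>u. ennreal (radial_weight k u)"
  let ?q = "\<lambda>(x::'v, y::'a). of_real (x \<bullet> x) + imag y"
  have [measurable]: "?q \<in> borel_measurable borel"
    unfolding case_prod_beta by (intro borel_measurable_continuous_onI continuous_intros)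
  have [measurable]: "?q \<in> borel_measurable strip" by measurable
  have dec: "of_real (u + y \<bullet> 1) + imag y = y + of_real u" for y :: 'a and u
    by (simp add: imag_def of_real_def scaleR_add_left)
  have dec': "(y + of_real u) \<bullet> 1 = u + y \<bullet> 1" for y :: 'a and u
    by (simp add: of_real_def inner_add_left)
  have "emeasure ?M X = (\<integral>\<^sup>+z. indicator X z \<partial>?M)" by simp
  also have "\<dots> = (\<integral>\<^sup>+z. indicator X (?q z) \<partial>strip)"
    by (rule nn_integral_distr) auto
  also have "\<dots> = (\<integral>\<^sup>+x. \<integral>\<^sup>+y. ?I (y \<bullet> 1) * indicator X (?q (x, y)) \<partial>lborel \<partial>lborel)"
    by (rule nn_integral_strip) measurable
  also have "\<dots> = (\<integral>\<^sup>+(x::'v). \<integral>\<^sup>+y. ?I (y \<bullet> 1) * indicator X (of_real (x \<bullet> x) + imag y) \<partial>lborel \<partial>lborel)"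
    by simp
  also have "\<dots> = (\<integral>\<^sup>+y. \<integral>\<^sup>+(x::'v). ?I (y \<bullet> 1) * indicator X (of_real (x \<bullet> x) + imag y) \<partial>lborel \<partial>lborel)"
    by (rule lborel_pair.Fubini') measurable
  also have "\<dots> = (\<integral>\<^sup>+y. \<integral>\<^sup>+u. ?w u * (?I (y \<bullet> 1) * indicator X (of_real u + imag y)) \<partial>lborel \<partial>lborel)"
    by (intro nn_integral_cong nn_integral_inner_self[OF k]) measurable
  also have "\<dots> = (\<integral>\<^sup>+y. \<integral>\<^sup>+u. ?w (u + y \<bullet> 1) * (?I (y \<bullet> 1) * indicator X (of_real (u + y \<bullet> 1) + imag y)) \<partial>lborel \<partial>lborel)"
    by (intro nn_integral_cong nn_integral_lborel_translate[symmetric]) measurable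
  also have "\<dots> = (\<integral>\<^sup>+y. \<integral>\<^sup>+u. ?w (u + y \<bullet> 1) * (?I (y \<bullet> 1) * indicator X (y + of_real u)) \<partial>lborel \<partial>lborel)"
    by (simp only: dec)
  also have "\<dots> = (\<integral>\<^sup>+u. \<integral>\<^sup>+y. ?w (u + y \<bullet> 1) * (?I (y \<bullet> 1) * indicator X (y + of_real u)) \<partial>lborel \<partial>lborel)"
    by (rule lborel_pair.Fubini') measurable
  also have "\<dots> = (\<integral>\<^sup>+u. \<integral>\<^sup>+y. ?w ((y + of_real u) \<bullet> 1) * (?I ((y + of_real u) \<bullet> 1 - u) * indicator X (y + of_real u)) \<partial>lborel \<partial>lborel)"
    unfolding dec' by simp
  also have "\<dots> = (\<integral>\<^sup>+u. \<integral>\<^sup>+y. ?w (y \<bullet> 1) * (?I (y \<bullet> 1 - u) * indicator X y) \<partial>lborel \<partial>lborel)"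
    by (intro nn_integral_cong nn_integral_lborel_translate) measurable
  also have "\<dots> = (\<integral>\<^sup>+y. \<integral>\<^sup>+u. ?w (y \<bullet> 1) * (?I (y \<bullet> 1 - u) * indicator X y) \<partial>lborel \<partial>lborel)"
    by (rule lborel_pair.Fubini') measurable
  also have "\<dots> = (\<integral>\<^sup>+y. \<integral>\<^sup>+u. (?w (y \<bullet> 1) * indicator X y) * indicator {y \<bullet> 1 - 1 .. y \<bullet> 1} u \<partial>lborel \<partial>lborel)"
    by (intro nn_integral_cong) (auto simp: indicator_def)
  also have "\<dots> = (\<integral>\<^sup>+y. ?w (y \<bullet> 1) * indicator X y \<partial>lborel)"
    by (subst nn_integral_cmult_indicator) auto
  also have "\<dots> = emeasure ?N X" by (rule emeasure_density[symmetric]) auto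
  finally show "emeasure ?M X = emeasure ?N X" .
qed simp

section \<open>Real derivatives of the Cauchy kernel\<close>

text \<open>
  The coordinates of \<open>E\<close> and of its derivatives are polynomials in the coordinates of \<open>\<nu>\<close> and
  \<open>Inv = |\<nu>|\<^sup>-\<^sup>2\<close>. Formal differentiation of such expressions yields derivatives of all orders
  together with the symmetry of mixed partial derivatives.
\<close>
datatype 'a rational_expr = Cst real | Crd 'a | Inv | Add "'a rational_expr" "'a rational_expr" | Mul "'a rational_expr" "'a rational_expr"

primrec reval :: "'a::real_inner rational_expr \<Rightarrow> 'a \<Rightarrow> real" where
  "reval (Cst c) \<nu> = c"
| "reval (Crd a) \<nu> = \<nu> \<bullet> a"
| "reval Inv \<nu> = inverse (\<nu> \<bullet> \<nu>)"
| "reval (Add f g) \<nu> = reval f \<nu> + reval g \<nu>"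
| "reval (Mul f g) \<nu> = reval f \<nu> * reval g \<nu>"

primrec rderiv :: "'a::real_inner \<Rightarrow> 'a rational_expr \<Rightarrow> 'a rational_expr" where
  "rderiv h (Cst c) = Cst 0"
| "rderiv h (Crd a) = Cst (h \<bullet> a)"
| "rderiv h Inv = Mul (Mul (Cst (-2)) (Crd h)) (Mul Inv Inv)"
| "rderiv h (Add f g) = Add (rderiv h f) (rderiv h g)"
| "rderiv h (Mul f g) = Add (Mul (rderiv h f) g) (Mul f (rderiv h g))"

lemma reval_has_derivative:
  "\<nu> \<noteq> 0 \<Longrightarrow> (reval f has_derivative (\<lambda>h. reval (rderiv h f) \<nu>)) (at \<nu>)"
proof (induction f)
  case (Cst c)
  have "reval (Cst c) = (\<lambda>\<nu>::'a. c)" by (simp add: fun_eq_iff)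
  then show ?case by simp
next
  case (Crd a)
  have "reval (Crd a) = (\<lambda>\<nu>. \<nu> \<bullet> a)" by (simp add: fun_eq_iff)
  then show ?case by (auto intro!: derivative_eq_intros)
next
  case Inv
  have "reval Inv = (\<lambda>\<nu>::'a. inverse (\<nu> \<bullet> \<nu>))" by (simp add: fun_eq_iff)
  then show ?case using Inv
    by (auto intro!: derivative_eq_intros simp: fun_eq_iff inner_commute algebra_simps)
next
  case (Add f g)
  have "reval (Add f g) = (\<lambda>\<nu>. reval f \<nu> + reval g \<nu>)" by (simp add: fun_eq_iff)
  then show ?case using Add by (auto intro!: derivative_eq_intros)
next
  case (Mul f g)
  have "reval (Mul f g) = (\<lambda>\<nu>. reval f \<nu> * reval g \<nu>)" by (simp add: fun_eq_iff)
  then show ?case using Mul by (auto intro!: derivative_eq_intros simp: fun_eq_iff algebra_simps)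
qed

text \<open>
  Through this symmetry every real derivative of the Cauchy kernel inherits its right regularity.
\<close>
lemma reval_rderiv_commute: "reval (rderiv h (rderiv k f)) \<nu> = reval (rderiv k (rderiv h f)) \<nu>"
  by (induction f) (auto simp: inner_commute algebra_simps)

lemma continuous_on_reval: "continuous_on (- {0}) (reval f)"
  by (intro has_derivative_continuous_on[where f'="\<lambda>\<nu> h. reval (rderiv h f) \<nu>"])
    (auto intro: has_derivative_at_withinI reval_has_derivative)

lemma borel_measurable_reval [measurable]: "reval (f :: 'a::euclidean_space rational_expr) \<in> borel_measurable borel"
proof (induction f)
  case (Crd a)
  have "reval (Crd a) = (\<lambda>\<nu>. \<nu> \<bullet> a)" by (simp add: fun_eq_iff)
  then show ?case by simp
qed (simp_all flip: fun_eq_iff add: reval.simps[abs_def])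

text \<open>
  Expressions are not unique, so an identity between their values has to be differentiated as an identity of
  functions.
\<close>
lemma sum_reval_rderiv_eq_0:
  fixes q :: "'i \<Rightarrow> 'w::real_normed_vector"
  assumes "finite I" and 0: "\<And>\<nu>. \<nu> \<noteq> 0 \<Longrightarrow> (\<Sum>i\<in>I. reval (X i) \<nu> *\<^sub>R q i) = 0" and "\<nu> \<noteq> 0"
  shows "(\<Sum>i\<in>I. reval (rderiv h (X i)) \<nu> *\<^sub>R q i) = 0"
proof -
  have "((\<lambda>\<nu>. \<Sum>i\<in>I. reval (X i) \<nu> *\<^sub>R q i) has_derivative (\<lambda>h. \<Sum>i\<in>I. reval (rderiv h (X i)) \<nu> *\<^sub>R q i)) (at \<nu>)"
    by (intro has_derivative_sum has_derivative_scaleR_left reval_has_derivative assms)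
  moreover have "((\<lambda>\<nu>. \<Sum>i\<in>I. reval (X i) \<nu> *\<^sub>R q i) has_derivative (\<lambda>h. 0)) (at \<nu>)"
    by (rule has_derivative_transform_within_open[of "\<lambda>_. 0" _ _ _ "- {0}"]) (use assms in auto)
  ultimately show ?thesis using has_derivative_unique by (metis (no_types, lifting))
qed

lemma sum_reval_rderiv_funpow_eq_0:
  fixes q :: "'i \<Rightarrow> 'w::real_normed_vector"
  assumes "finite I" and "\<And>\<nu>. \<nu> \<noteq> 0 \<Longrightarrow> (\<Sum>i\<in>I. reval (X i) \<nu> *\<^sub>R q i) = 0"
  shows "\<nu> \<noteq> 0 \<Longrightarrow> (\<Sum>i\<in>I. reval ((rderiv h ^^ j) (X i)) \<nu> *\<^sub>R q i) = 0"
proof (induction j arbitrary: \<nu>)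
  case (Suc j)
  have "(\<Sum>i\<in>I. reval (rderiv h ((rderiv h ^^ j) (X i))) \<nu> *\<^sub>R q i) = 0"
    by (rule sum_reval_rderiv_eq_0[OF assms(1) Suc.IH Suc.prems])
  then show ?case by simp
qed (simp add: assms)

lemma reval_rderiv_cong:
  assumes "\<And>\<nu>. \<nu> \<noteq> 0 \<Longrightarrow> reval f \<nu> = reval g \<nu>" and "\<nu> \<noteq> 0"
  shows "reval (rderiv h f) \<nu> = reval (rderiv h g) \<nu>"
proof -
  have "(reval f has_derivative (\<lambda>h. reval (rderiv h g) \<nu>)) (at \<nu>)"
    by (rule has_derivative_transform_within_open[of "reval g" _ _ _ "- {0}"])
      (use assms in \<open>auto intro: reval_has_derivative\<close>)
  then show ?thesis using has_derivative_unique[OF reval_has_derivative[OF assms(2), of f]] by metis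
qed

lemma reval_rderiv_rderiv_funpow:
  "\<nu> \<noteq> 0 \<Longrightarrow> reval (rderiv h ((rderiv k ^^ j) f)) \<nu> = reval ((rderiv k ^^ j) (rderiv h f)) \<nu>"
proof (induction j arbitrary: \<nu>)
  case (Suc j)
  have "reval (rderiv h (rderiv k ((rderiv k ^^ j) f))) \<nu> = reval (rderiv k (rderiv h ((rderiv k ^^ j) f))) \<nu>"
    by (rule reval_rderiv_commute)
  also have "\<dots> = reval (rderiv k ((rderiv k ^^ j) (rderiv h f))) \<nu>"
    by (rule reval_rderiv_cong[OF Suc.IH Suc.prems])
  finally show ?case by simp
qed simp

definition cauchy_const :: "'a::hypercomplex itself \<Rightarrow> real" where
  "cauchy_const _ = Gamma (real DIM('a) / 2) / (2 * pi powr (real DIM('a) / 2))"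

text \<open>
  The coefficient of \<open>conjugate b\<close> in \<open>E\<close>.
\<close>
definition cauchy_expr :: "'a::hypercomplex \<Rightarrow> 'a rational_expr" where
  "cauchy_expr b = Mul (Cst (cauchy_const TYPE('a))) (Mul (Crd b) (((\<lambda>f. Mul Inv f) ^^ (DIM('a) div 2)) (Cst 1)))"

definition cauchy_deriv :: "nat \<Rightarrow> 'a::hypercomplex \<Rightarrow> 'a" where
  "cauchy_deriv j \<nu> = (\<Sum>b\<in>Basis. reval ((rderiv 1 ^^ j) (cauchy_expr b)) \<nu> *\<^sub>R conjugate b)"

text \<open>
  The total derivative at \<open>\<nu>\<close> in the direction \<open>h\<close>.
\<close>
definition cauchy_deriv' :: "nat \<Rightarrow> 'a::hypercomplex \<Rightarrow> 'a \<Rightarrow> 'a" where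
  "cauchy_deriv' j \<nu> h = (\<Sum>b\<in>Basis. reval (rderiv h ((rderiv 1 ^^ j) (cauchy_expr b))) \<nu> *\<^sub>R conjugate b)"

lemma reval_Inv_funpow: "reval (((\<lambda>f. Mul Inv f) ^^ p) f) \<nu> = inverse (\<nu> \<bullet> \<nu>) ^ p * reval f \<nu>"
  by (induction p) auto

lemma reval_cauchy_expr:
  "reval (cauchy_expr b) (\<nu>::'a::hypercomplex) =
     cauchy_const TYPE('a) * ((\<nu> \<bullet> b) * inverse (\<nu> \<bullet> \<nu>) ^ (DIM('a) div 2))"
  by (simp add: cauchy_expr_def reval_Inv_funpow)

lemma norm_power_DIM: "norm (\<nu>::'a::hypercomplex) ^ DIM('a) = (\<nu> \<bullet> \<nu>) ^ (DIM('a) div 2)"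
  by (subst DIM_half) (simp add: power_mult power2_norm_eq_inner)

lemma conjugate_representation:
  "conjugate (\<nu>::'a::hypercomplex) = (\<Sum>b\<in>Basis. (\<nu> \<bullet> b) *\<^sub>R conjugate b)"
proof -
  have "conjugate \<nu> = conjugate (\<Sum>b\<in>Basis. (\<nu> \<bullet> b) *\<^sub>R b)" by (simp add: euclidean_representation)
  then show ?thesis by (simp add: conjugate_sum conjugate_scaleR)
qed

lemma cauchy_E_eq:
  "cauchy_E (\<nu>::'a::hypercomplex) =
     cauchy_const TYPE('a) *\<^sub>R (inverse (\<nu> \<bullet> \<nu>) ^ (DIM('a) div 2) *\<^sub>R conjugate \<nu>)"
  by (simp add: cauchy_E_def norm_power_DIM cauchy_const_def power_inverse)

lemma cauchy_deriv_0: "cauchy_deriv 0 \<nu> = cauchy_E (\<nu>::'a::hypercomplex)"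
proof -
  have "cauchy_deriv 0 \<nu> = cauchy_const TYPE('a) *\<^sub>R (inverse (\<nu> \<bullet> \<nu>) ^ (DIM('a) div 2) *\<^sub>R
      (\<Sum>b\<in>Basis. (\<nu> \<bullet> b) *\<^sub>R conjugate b))"
    by (simp add: cauchy_deriv_def reval_cauchy_expr scaleR_sum_right mult_ac)
  then show ?thesis by (simp add: cauchy_E_eq conjugate_representation[of \<nu>])
qed

lemma cauchy_deriv_has_derivative: "\<nu> \<noteq> 0 \<Longrightarrow> (cauchy_deriv j has_derivative cauchy_deriv' j \<nu>) (at \<nu>)"
  unfolding cauchy_deriv_def cauchy_deriv'_def
  by (intro has_derivative_sum has_derivative_scaleR_left reval_has_derivative)

lemma cauchy_deriv'_one: "cauchy_deriv' j \<nu> 1 = cauchy_deriv (Suc j) \<nu>"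
  by (simp add: cauchy_deriv_def cauchy_deriv'_def)

lemma continuous_on_cauchy_deriv: "continuous_on (- {0}) (cauchy_deriv j)"
  unfolding cauchy_deriv_def by (intro continuous_intros continuous_on_reval)

lemma continuous_on_cauchy_deriv': "continuous_on (- {0}) (\<lambda>\<nu>. cauchy_deriv' j \<nu> h)"
  unfolding cauchy_deriv'_def by (intro continuous_intros continuous_on_reval)

lemma borel_measurable_cauchy_deriv [measurable]: "cauchy_deriv j \<in> borel_measurable borel"
  unfolding cauchy_deriv_def by measurable

lemma dir_deriv_funpow_cauchy_E:
  "\<nu> \<noteq> 0 \<Longrightarrow> (dir_deriv 1 ^^ j) cauchy_E \<nu> = cauchy_deriv j (\<nu>::'a::hypercomplex)"
proof (induction j arbitrary: \<nu>)
  case 0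
  then show ?case by (simp add: cauchy_deriv_0)
next
  case (Suc j)
  let ?g = "(dir_deriv 1 ^^ j) cauchy_E :: 'a \<Rightarrow> 'a"
  have "(?g has_derivative cauchy_deriv' j \<nu>) (at \<nu>)"
    by (rule has_derivative_transform_within_open[OF cauchy_deriv_has_derivative[OF Suc.prems, of j], of "- {0}"])
      (use Suc in auto)
  then have "(?g has_derivative cauchy_deriv' j \<nu>) (at (\<nu> + 0 *\<^sub>R 1))" by simp
  then have "((\<lambda>t. ?g (\<nu> + t *\<^sub>R 1)) has_derivative (\<lambda>t. cauchy_deriv' j \<nu> (t *\<^sub>R 1))) (at 0)"
    by (rule has_derivative_compose[rotated]) (auto intro!: derivative_eq_intros)
  moreover have "cauchy_deriv' j \<nu> (t *\<^sub>R 1) = t *\<^sub>R cauchy_deriv' j \<nu> 1" for t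
    using cauchy_deriv_has_derivative[OF Suc.prems, of j] by (simp add: has_derivative_linear linear_cmul)
  ultimately have "((\<lambda>t. ?g (\<nu> + t *\<^sub>R 1)) has_vector_derivative cauchy_deriv' j \<nu> 1) (at 0)"
    by (simp add: has_vector_derivative_def)
  then have "dir_deriv 1 ?g \<nu> = cauchy_deriv' j \<nu> 1"
    by (subst dir_deriv_def) (rule vector_derivative_at)
  then show ?case by (simp add: cauchy_deriv'_one)
qed

text \<open>
  For \<open>j = 0\<close> this is a computation with \<open>\<Sum>\<^sub>e (conjugate e) e = m\<close> and
  \<open>(conjugate \<nu>) \<nu> = |\<nu>|\<^sup>2\<close>; the derivative in the real direction then commutes with the operator.
\<close>
lemma cauchy_deriv_right_regular: "\<nu> \<noteq> 0 \<Longrightarrow> (\<Sum>e\<in>Basis. cauchy_deriv' j \<nu> e * e) = (0::'a::hypercomplex)"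
proof -
  assume \<nu>: "\<nu> \<noteq> 0"
  let ?p = "DIM('a) div 2"
  let ?X = "\<lambda>z::'a \<times> 'a. rderiv (fst z) (cauchy_expr (snd z))"
  have *: "(\<Sum>z\<in>Basis \<times> Basis. reval (?X z) \<mu> *\<^sub>R (conjugate (snd z) * fst z)) = 0" if \<mu>: "\<mu> \<noteq> 0" for \<mu>
  proof -
    let ?E = "\<lambda>\<mu>::'a. cauchy_const TYPE('a) *\<^sub>R (inverse (\<mu> \<bullet> \<mu>) ^ ?p *\<^sub>R conjugate \<mu>)"
    let ?E' = "\<lambda>h. cauchy_const TYPE('a) *\<^sub>R (inverse (\<mu> \<bullet> \<mu>) ^ ?p *\<^sub>R conjugate h
        - (real (2 * ?p) * (h \<bullet> \<mu>) * inverse (\<mu> \<bullet> \<mu>) ^ (Suc ?p)) *\<^sub>R conjugate \<mu>)"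
    have pw: "Suc (?p - 1) = ?p" using DIM_pos_half[where 'a='a] by simp
    have "(?E has_derivative ?E') (at \<mu>)"
    proof -
      have 1: "(conjugate has_derivative conjugate) (at \<mu>)"
        by (rule bounded_linear_imp_has_derivative[OF linear_conjugate])
      have "((\<lambda>\<mu>::'a. inverse (\<mu> \<bullet> \<mu>) ^ ?p) has_derivative
          (\<lambda>h. real ?p * - (inverse (\<mu> \<bullet> \<mu>) * (\<mu> \<bullet> h + h \<bullet> \<mu>) * inverse (\<mu> \<bullet> \<mu>)) *
            inverse (\<mu> \<bullet> \<mu>) ^ (?p - 1))) (at \<mu>)"
        using \<mu> by (auto intro!: derivative_eq_intros)
      also have "(\<lambda>h. real ?p * - (inverse (\<mu> \<bullet> \<mu>) * (\<mu> \<bullet> h + h \<bullet> \<mu>) * inverse (\<mu> \<bullet> \<mu>)) *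
            inverse (\<mu> \<bullet> \<mu>) ^ (?p - 1)) =
          (\<lambda>h. - (real (2 * ?p) * (h \<bullet> \<mu>) * (inverse (\<mu> \<bullet> \<mu>) * inverse (\<mu> \<bullet> \<mu>) ^ (Suc (?p - 1)))))"
        by (simp add: fun_eq_iff inner_commute)
      finally have "((\<lambda>\<mu>::'a. inverse (\<mu> \<bullet> \<mu>) ^ ?p) has_derivative
          (\<lambda>h. - (real (2 * ?p) * (h \<bullet> \<mu>) * inverse (\<mu> \<bullet> \<mu>) ^ (Suc ?p)))) (at \<mu>)"
        by (simp only: pw power_Suc)
      from has_derivative_scaleR[OF this 1] show ?thesis
        by (rule has_derivative_scaleR_right[THEN has_derivative_eq_rhs]) (simp add: algebra_simps)
    qed
    moreover have "?E = cauchy_deriv 0"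
      by (simp add: fun_eq_iff cauchy_deriv_0 cauchy_E_eq)
    ultimately have "(cauchy_deriv 0 has_derivative ?E') (at \<mu>)" by (simp only:)
    then have "cauchy_deriv' 0 \<mu> = ?E'" by (rule has_derivative_unique[OF cauchy_deriv_has_derivative[OF \<mu>]])
    then have E': "cauchy_deriv' 0 \<mu> h = ?E' h" for h by (rule fun_cong)
    have "(\<Sum>z\<in>Basis \<times> Basis. reval (?X z) \<mu> *\<^sub>R (conjugate (snd z) * fst z)) = (\<Sum>e\<in>Basis. cauchy_deriv' 0 \<mu> e * e)"
      by (simp add: cauchy_deriv'_def sum_distrib_right sum.cartesian_product split_beta)
    also have "\<dots> = (\<Sum>e\<in>Basis. cauchy_const TYPE('a) *\<^sub>R (inverse (\<mu> \<bullet> \<mu>) ^ ?p *\<^sub>R 1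
        - (real (2 * ?p) * inverse (\<mu> \<bullet> \<mu>) ^ (Suc ?p)) *\<^sub>R (conjugate \<mu> * ((\<mu> \<bullet> e) *\<^sub>R e))))"
      by (intro sum.cong refl) (simp add: E' left_diff_distrib conjugate_mult_Basis_self inner_commute mult_ac)
    also have "\<dots> = cauchy_const TYPE('a) *\<^sub>R ((real DIM('a) * inverse (\<mu> \<bullet> \<mu>) ^ ?p) *\<^sub>R 1
        - (real (2 * ?p) * inverse (\<mu> \<bullet> \<mu>) ^ (Suc ?p)) *\<^sub>R (conjugate \<mu> * (\<Sum>e\<in>Basis. (\<mu> \<bullet> e) *\<^sub>R e)))"
      by (simp only: scaleR_sum_right[symmetric] sum_subtractf sum_constant_scaleR
          sum_distrib_left[symmetric] scaleR_scaleR mult.commute[of "real DIM('a)"])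
    also have "\<dots> = 0"
      using \<mu> DIM_half[where 'a='a]
      by (simp only: euclidean_representation conjugate_mult_self power2_norm_eq_inner)
        (simp add: of_real_def)
    finally show ?thesis .
  qed
  have "(\<Sum>e\<in>Basis. cauchy_deriv' j \<nu> e * e) = (\<Sum>e\<in>Basis. \<Sum>b\<in>Basis. reval ((rderiv 1 ^^ j) (rderiv e (cauchy_expr b))) \<nu> *\<^sub>R (conjugate b * e))"
    by (simp add: cauchy_deriv'_def sum_distrib_right reval_rderiv_rderiv_funpow[OF \<nu>])
  also have "\<dots> = (\<Sum>z\<in>Basis \<times> Basis. reval ((rderiv 1 ^^ j) (?X z)) \<nu> *\<^sub>R (conjugate (snd z) * fst z))"
    by (simp add: sum.cartesian_product split_beta)
  also have "\<dots> = 0"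
    by (rule sum_reval_rderiv_funpow_eq_0[OF _ * \<nu>]) auto
  finally show ?thesis .
qed

lemma cauchy_deriv_homogeneous:
  assumes "\<nu> \<noteq> 0" "r > 0"
  shows "cauchy_deriv j (r *\<^sub>R \<nu> :: 'a::hypercomplex) = inverse r ^ (DIM('a) - 1 + j) *\<^sub>R cauchy_deriv j \<nu>"
  using assms(1)
proof (induction j arbitrary: \<nu>)
  case 0
  let ?p = "DIM('a) div 2"
  have D: "DIM('a) - 1 = 2 * ?p - 1" "Suc (2 * ?p - 1) = 2 * ?p"
    using DIM_half[where 'a='a] DIM_pos_half[where 'a='a] by auto
  have "inverse r ^ (2 * ?p) = inverse r ^ (2 * ?p - 1) * inverse r" by (metis D(2) power_Suc2)
  then have "inverse (r * (r * (\<nu> \<bullet> \<nu>))) ^ ?p * r = inverse r ^ (2 * ?p - 1) * inverse (\<nu> \<bullet> \<nu>) ^ ?p"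
    using assms(2) by (simp add: power_mult power2_eq_square power_mult_distrib mult_ac)
  then show ?case
    unfolding cauchy_deriv_0 cauchy_E_eq D by (simp add: conjugate_scaleR mult_ac)
next
  case (Suc j)
  let ?c = "inverse r ^ (DIM('a) - 1 + j)"
  have r: "r *\<^sub>R \<nu> \<noteq> 0" using assms(2) Suc.prems by simp
  have "((\<lambda>\<nu>. cauchy_deriv j (r *\<^sub>R \<nu>)) has_derivative (\<lambda>h. cauchy_deriv' j (r *\<^sub>R \<nu>) (r *\<^sub>R h))) (at \<nu>)"
    by (rule has_derivative_compose[where f="\<lambda>\<nu>. r *\<^sub>R \<nu>", OF _ cauchy_deriv_has_derivative[OF r]])
      (auto intro!: derivative_eq_intros)
  moreover have "((\<lambda>\<nu>. cauchy_deriv j (r *\<^sub>R \<nu>)) has_derivative (\<lambda>h. ?c *\<^sub>R cauchy_deriv' j \<nu> h)) (at \<nu>)"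
    by (rule has_derivative_transform_within_open[of "\<lambda>\<nu>. ?c *\<^sub>R cauchy_deriv j \<nu>" _ _ _ "- {0}"])
      (use Suc in \<open>auto intro!: has_derivative_scaleR_right cauchy_deriv_has_derivative\<close>)
  ultimately have "cauchy_deriv' j (r *\<^sub>R \<nu>) (r *\<^sub>R 1) = ?c *\<^sub>R cauchy_deriv' j \<nu> 1"
    using has_derivative_unique by metis
  moreover have "cauchy_deriv' j (r *\<^sub>R \<nu>) (r *\<^sub>R 1) = r *\<^sub>R cauchy_deriv' j (r *\<^sub>R \<nu>) 1"
    using cauchy_deriv_has_derivative[OF r, of j] by (simp add: has_derivative_linear linear_cmul)
  ultimately have "r *\<^sub>R cauchy_deriv (Suc j) (r *\<^sub>R \<nu>) = ?c *\<^sub>R cauchy_deriv (Suc j) \<nu>" by (simp add: cauchy_deriv'_one)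
  then have "inverse r *\<^sub>R (r *\<^sub>R cauchy_deriv (Suc j) (r *\<^sub>R \<nu>)) = inverse r *\<^sub>R (?c *\<^sub>R cauchy_deriv (Suc j) \<nu>)" by simp
  then have "cauchy_deriv (Suc j) (r *\<^sub>R \<nu>) = (inverse r * ?c) *\<^sub>R cauchy_deriv (Suc j) \<nu>" using assms(2) by simp
  then show ?case unfolding add_Suc_right power_Suc .
qed

text \<open>
  Homogeneity reduces the estimate to the unit sphere, where compactness gives the constant.
\<close>
lemma cauchy_deriv_bound:
  obtains C where "C \<ge> 0" "\<And>\<nu>::'a::hypercomplex. \<nu> \<noteq> 0 \<Longrightarrow> norm (cauchy_deriv j \<nu>) \<le> C * inverse (norm \<nu>) ^ (DIM('a) - 1 + j)"
proof -
  have "compact (cauchy_deriv j ` sphere (0::'a) 1)"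
    by (intro compact_continuous_image continuous_on_subset[OF continuous_on_cauchy_deriv]) auto
  then have "bounded (cauchy_deriv j ` sphere (0::'a) 1)" by (rule compact_imp_bounded)
  then obtain C where "\<forall>y\<in>cauchy_deriv j ` sphere (0::'a) 1. norm y \<le> C" unfolding bounded_iff by blast
  then have C: "norm (cauchy_deriv j \<nu>) \<le> C" if "norm \<nu> = 1" for \<nu> :: 'a
    using that by auto
  have "norm (cauchy_deriv j \<nu>) \<le> C * inverse (norm \<nu>) ^ (DIM('a) - 1 + j)" if "\<nu> \<noteq> 0" for \<nu> :: 'a
  proof -
    have "cauchy_deriv j (norm \<nu> *\<^sub>R (\<nu> /\<^sub>R norm \<nu>)) = inverse (norm \<nu>) ^ (DIM('a) - 1 + j) *\<^sub>R cauchy_deriv j (\<nu> /\<^sub>R norm \<nu>)"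
      using that by (intro cauchy_deriv_homogeneous) auto
    then have "norm (cauchy_deriv j \<nu>) = inverse (norm \<nu>) ^ (DIM('a) - 1 + j) * norm (cauchy_deriv j (\<nu> /\<^sub>R norm \<nu>))"
      using that by simp
    also have "\<dots> \<le> inverse (norm \<nu>) ^ (DIM('a) - 1 + j) * C"
      using that by (intro mult_left_mono C) auto
    finally show ?thesis by (simp add: mult.commute)
  qed
  moreover have "C \<ge> 0" using order_trans[OF norm_ge_zero C[of 1]] by simp
  ultimately show ?thesis using that by blast
qed

section \<open>The mean value property in the first variables\<close>

lemma axis_scaleR: "r *\<^sub>R axis j e = axis j (r *\<^sub>R e)" for e :: "'a::real_vector"
  by (simp add: vec_eq_iff axis_def)

lemma sum_axis_Basis:
  fixes L :: "('a::hypercomplex ^ 'n::finite) \<Rightarrow> 'b::real_normed_vector"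
  assumes "linear L"
  shows "(\<Sum>j\<in>UNIV. \<Sum>e\<in>Basis. (x $ j \<bullet> e) *\<^sub>R L (axis j e)) = L x"
proof -
  have "(\<Sum>j\<in>UNIV. \<Sum>e\<in>Basis. (x $ j \<bullet> e) *\<^sub>R axis j e) = x"
  proof -
    have "(\<Sum>e\<in>Basis. (x $ j \<bullet> e) *\<^sub>R axis j e) = axis j (x $ j)" for j
    proof -
      have "(\<Sum>e\<in>Basis. axis j ((x $ j \<bullet> e) *\<^sub>R e)) = axis j (\<Sum>e\<in>Basis. (x $ j \<bullet> e) *\<^sub>R e)"
        by (simp add: vec_eq_iff axis_def sum.If_cases if_distrib cong: if_cong)
      then show ?thesis by (simp add: axis_scaleR euclidean_representation)
    qed
    moreover have "(\<Sum>j\<in>UNIV. axis j (x $ j)) = x"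
      by (simp add: vec_eq_iff axis_def if_distrib cong: if_cong)
    ultimately show ?thesis by simp
  qed
  then have "L x = L (\<Sum>j\<in>UNIV. \<Sum>e\<in>Basis. (x $ j \<bullet> e) *\<^sub>R axis j e)" by simp
  then show ?thesis by (simp add: linear_sum[OF assms] linear_cmul[OF assms])
qed

text \<open>
  The terms with \<open>conjugate (x\<^sub>j) * e\<close> cancel by regularity, and the others add up to the derivative along \<open>x\<close>.
\<close>
lemma sum_tangential:
  fixes L :: "('a::hypercomplex ^ 'n::finite) \<Rightarrow> 'a"
  assumes L: "linear L" and reg: "\<And>j. (\<Sum>e\<in>Basis. e * L (axis j e)) = 0"
  shows "(\<Sum>j\<in>UNIV. \<Sum>e\<in>Basis. (of_real (x $ j \<bullet> e) - conjugate (x $ j) * e) * L (axis j e)) = L x"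
    (is "(\<Sum>j\<in>UNIV. \<Sum>e\<in>Basis. ?a j e * _) = _")
proof -
  have "(\<Sum>e\<in>Basis. ?a j e * L (axis j e)) = (\<Sum>e\<in>Basis. (x $ j \<bullet> e) *\<^sub>R L (axis j e))" for j
  proof -
    have "(\<Sum>e\<in>Basis. ?a j e * L (axis j e)) =
        (\<Sum>e\<in>Basis. (x $ j \<bullet> e) *\<^sub>R L (axis j e)) - conjugate (x $ j) * (\<Sum>e\<in>Basis. e * L (axis j e))"
      by (simp add: left_diff_distrib sum_subtractf sum_distrib_left mult.assoc of_real_def)
    then show ?thesis by (simp add: reg)
  qed
  then show ?thesis by (simp add: sum_axis_Basis[OF L])
qed

text \<open>
  The fields are tangential to the spheres: applied to \<open>|y|\<^sup>2\<close> they give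
  \<open>2 (|y|\<^sup>2 - (conjugate y) y) = 0\<close>.
\<close>
lemma sum_tangential_radial:
  fixes y :: "'a::hypercomplex"
  shows "(\<Sum>e\<in>Basis. (y \<bullet> e) *\<^sub>R (of_real (y \<bullet> e) - conjugate y * e)) = 0"
proof -
  have "(\<Sum>e\<in>Basis. (y \<bullet> e) *\<^sub>R (of_real (y \<bullet> e) - conjugate y * e)) =
     of_real (\<Sum>e\<in>Basis. (y \<bullet> e) * (y \<bullet> e)) - conjugate y * (\<Sum>e\<in>Basis. (y \<bullet> e) *\<^sub>R e)"
  proof -
    have "(y \<bullet> e) *\<^sub>R (of_real (y \<bullet> e) - conjugate y * e) =
        of_real ((y \<bullet> e) * (y \<bullet> e)) - conjugate y * ((y \<bullet> e) *\<^sub>R e)" for e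
      by (simp add: scaleR_right_diff_distrib of_real_def)
    then show ?thesis by (simp only: sum_subtractf sum_distrib_left of_real_sum)
  qed
  also have "\<dots> = 0"
    by (simp add: euclidean_representation conjugate_mult_self euclidean_inner[of y y, symmetric] power2_norm_eq_inner
       del: of_real_power)
  finally show ?thesis .
qed

lemma inner_axis_self: "x \<bullet> axis j e = x $ j \<bullet> (e::'a::real_inner)"
  by (simp add: inner_axis)

text \<open>
  The integrand is, up to the factor \<open>\<rho>\<close>, the divergence of the tangential fields times
  \<open>h(|x|\<^sup>2) H(\<rho> x, |x|\<^sup>2 + w)\<close>. The fields have no divergence and do not see the dependence on
  \<open>|x|\<^sup>2\<close>, in \<open>h\<close> or in the last argument of \<open>H\<close>, so only the derivative in the first argument survives.
\<close>
lemma radial_derivative_integral_eq_0: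
  fixes H :: "('a::hypercomplex ^ 'n::finite) \<times> 'a \<Rightarrow> 'a" and \<rho> :: real
  assumes deriv: "\<And>p. p \<in> D \<Longrightarrow> (H has_derivative blinfun_apply (H' p)) (at p)"
    and contH': "continuous_on D H'"
    and reg: "\<And>p j. p \<in> D \<Longrightarrow> (\<Sum>e\<in>Basis. e * H' p (axis j e, 0)) = 0"
    and dom: "\<And>x. (\<rho> *\<^sub>R x, of_real (x \<bullet> x) + w) \<in> D"
    and \<rho>: "\<rho> \<noteq> 0"
    and h: "\<And>s. s \<ge> 0 \<Longrightarrow> (h has_vector_derivative h' s) (at s)"
    and conth': "continuous_on {0..} h'"
    and hR: "\<And>s. s \<ge> R \<Longrightarrow> h s = 0"
  shows "(\<integral>x. h (x \<bullet> x) * H' (\<rho> *\<^sub>R x, of_real (x \<bullet> x) + w) (x, 0) \<partial>lborel) = 0"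
proof -
  let ?q = "\<lambda>x::'a ^ 'n. (\<rho> *\<^sub>R x, of_real (x \<bullet> x) + w)"
  let ?v = "\<lambda>j e. axis j e :: 'a ^ 'n"
  define a where "a = (\<lambda>j e (x::'a ^ 'n). of_real (x \<bullet> ?v j e) - conjugate (x $ j) * (e::'a))"
  define g where "g = (\<lambda>j e x. h (x \<bullet> x) * (a j e x * H (?q x)))"
  define g' where "g' = (\<lambda>j e x u. h (x \<bullet> x) * (a j e x * H' (?q x) (\<rho> *\<^sub>R u, of_real (2 * (x \<bullet> u))) +
      (of_real (u \<bullet> ?v j e) - conjugate (u $ j) * e) * H (?q x)) +
      ((2 * (x \<bullet> u)) *\<^sub>R h' (x \<bullet> x)) * (a j e x * H (?q x)))"
  have q: "(?q has_derivative (\<lambda>u. (\<rho> *\<^sub>R u, of_real (2 * (x \<bullet> u))))) (at x)" for x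
    by (auto intro!: derivative_eq_intros simp: of_real_def inner_commute fun_eq_iff)
  have hd: "((\<lambda>x::'a^'n. h (x \<bullet> x)) has_derivative (\<lambda>u. (2 * (x \<bullet> u)) *\<^sub>R h' (x \<bullet> x))) (at x)" for x
  proof -
    have "(h has_derivative (\<lambda>s. s *\<^sub>R h' (x \<bullet> x))) (at (x \<bullet> x))"
      using h by (simp add: has_vector_derivative_def)
    moreover have "((\<lambda>x::'a^'n. x \<bullet> x) has_derivative (\<lambda>u. 2 * (x \<bullet> u))) (at x)"
      by (auto intro!: derivative_eq_intros simp: inner_commute fun_eq_iff)
    ultimately show ?thesis by (rule has_derivative_compose[rotated])
  qed
  have ad: "(a j e has_derivative (\<lambda>u. of_real (u \<bullet> ?v j e) - conjugate (u $ j) * e)) (at x)" for j e x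
  proof -
    have "bounded_linear (\<lambda>u::'a^'n. conjugate (u $ j) * e)"
      by (intro bounded_linear_compose[OF bounded_linear_mult_left]
          bounded_linear_compose[OF linear_conjugate] bounded_linear_vec_nth)
    from bounded_linear_imp_has_derivative[OF this]
    show ?thesis unfolding a_def
      by (rule has_derivative_diff[rotated]) (auto intro!: derivative_eq_intros simp: of_real_def)
  qed
  have Hq: "((\<lambda>x. H (?q x)) has_derivative (\<lambda>u. H' (?q x) (\<rho> *\<^sub>R u, of_real (2 * (x \<bullet> u))))) (at x)" for x
    by (rule has_derivative_compose[where f="?q", OF q deriv[OF dom]])
  have gd: "(g j e has_derivative g' j e x) (at x)" for j e x
    unfolding g_def g'_def by (intro has_derivative_mult hd ad Hq)
  have contH: "continuous_on UNIV (\<lambda>x. H (?q x))"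
    by (rule has_derivative_continuous_on) (use Hq has_derivative_at_withinI in blast)
  have contH'q: "continuous_on UNIV (\<lambda>x. H' (?q x))"
    by (rule continuous_on_compose2[OF contH']) (use dom in \<open>auto intro!: continuous_intros\<close>)
  have conth: "continuous_on {0..} h"
    by (rule continuous_at_imp_continuous_on) (auto intro: has_vector_derivative_continuous h)
  have contg': "continuous_on UNIV (\<lambda>x. g' j e x (?v j e))" for j e
    unfolding g'_def a_def
    by (intro continuous_intros contH contH'q continuous_on_compose2[OF conth]
      continuous_on_compose2[OF conth'] continuous_on_of_real) auto
  have supp: "g j e x = 0" if "norm x > max 1 R" for j e x
  proof -
    have "R \<le> norm x * norm x" using that
      by (smt (verit) max.strict_boundedE mult_less_cancel_right1 max.cobounded1 max.cobounded2 norm_ge_zero)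
    then show ?thesis by (simp add: g_def hR flip: power2_norm_eq_inner power2_eq_square)
  qed
  have z: "(\<integral>x. g' j e x (?v j e) \<partial>lborel) = 0" "integrable lborel (\<lambda>x. g' j e x (?v j e))" for j e
    by (rule integral_has_derivative_eq_0[OF gd contg' supp]; assumption)+
  have sum_g': "(\<Sum>j\<in>UNIV. \<Sum>e\<in>Basis. g' j e x (?v j e)) = \<rho> *\<^sub>R (h (x \<bullet> x) * H' (?q x) (x, 0))" for x
  proof -
    define L where "L = (\<lambda>u. H' (?q x) (u, 0))"
    have "bounded_linear L" unfolding L_def
      by (intro bounded_linear_compose[OF blinfun.bounded_linear_right] bounded_linear_Pair bounded_linear_ident bounded_linear_zero)
    then have L: "linear L" by (rule bounded_linear.linear)
    have split: "H' (?q x) (\<rho> *\<^sub>R u, of_real c) = \<rho> *\<^sub>R L u + c *\<^sub>R H' (?q x) (0, 1)" for u c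
    proof -
      have *: "(\<rho> *\<^sub>R u, of_real c) = \<rho> *\<^sub>R (u, 0) + c *\<^sub>R (0, 1::'a)" by (simp add: of_real_def)
      show ?thesis unfolding * L_def by (simp only: blinfun.add_right blinfun.scaleR_right)
    qed
    have a: "a j e x = of_real (x $ j \<bullet> e) - conjugate (x $ j) * e" for j e
      by (simp add: a_def inner_axis_self)
    have 1: "g' j e x (?v j e) = \<rho> *\<^sub>R (h (x \<bullet> x) * (a j e x * L (?v j e))) +
        2 *\<^sub>R (h (x \<bullet> x) * (((x $ j \<bullet> e) *\<^sub>R a j e x) * H' (?q x) (0, 1))) +
        2 *\<^sub>R (h' (x \<bullet> x) * (((x $ j \<bullet> e) *\<^sub>R a j e x) * H (?q x)))" if "e \<in> Basis" for j e
    proof -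
      have "?v j e $ j = e" by (simp add: axis_def)
      then have "of_real (?v j e \<bullet> ?v j e) - conjugate (?v j e $ j) * e = 0"
        using that by (simp add: inner_axis_self conjugate_mult_self inner_Basis)
      then show ?thesis
        unfolding g'_def split inner_axis_self by (simp add: distrib_left mult.assoc)
    qed
    have "(\<Sum>j\<in>UNIV. \<Sum>e\<in>Basis. g' j e x (?v j e)) = (\<Sum>j\<in>UNIV. \<Sum>e\<in>Basis.
        \<rho> *\<^sub>R (h (x \<bullet> x) * (a j e x * L (?v j e))) +
        2 *\<^sub>R (h (x \<bullet> x) * (((x $ j \<bullet> e) *\<^sub>R a j e x) * H' (?q x) (0, 1))) +
        2 *\<^sub>R (h' (x \<bullet> x) * (((x $ j \<bullet> e) *\<^sub>R a j e x) * H (?q x))))"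
      by (intro sum.cong refl 1)
    also have "\<dots> = \<rho> *\<^sub>R (h (x \<bullet> x) * (\<Sum>j\<in>UNIV. \<Sum>e\<in>Basis. a j e x * L (?v j e))) +
        2 *\<^sub>R (h (x \<bullet> x) * ((\<Sum>j\<in>UNIV. \<Sum>e\<in>Basis. (x $ j \<bullet> e) *\<^sub>R a j e x) * H' (?q x) (0, 1))) +
        2 *\<^sub>R (h' (x \<bullet> x) * ((\<Sum>j\<in>UNIV. \<Sum>e\<in>Basis. (x $ j \<bullet> e) *\<^sub>R a j e x) * H (?q x)))"
      by (simp add: sum.distrib scaleR_sum_right sum_distrib_left sum_distrib_right)
    also have "(\<Sum>j\<in>UNIV. \<Sum>e\<in>Basis. (x $ j \<bullet> e) *\<^sub>R a j e x) = 0"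
      by (simp add: a sum_tangential_radial)
    also have "(\<Sum>j\<in>UNIV. \<Sum>e\<in>Basis. a j e x * L (?v j e)) = L x"
      unfolding a by (rule sum_tangential[OF L]) (simp add: L_def reg[OF dom])
    finally show ?thesis by (simp add: L_def)
  qed
  have "0 = (\<Sum>j\<in>UNIV. \<Sum>e\<in>Basis. \<integral>x. g' j e x (?v j e) \<partial>lborel)" by (simp add: z(1))
  also have "\<dots> = (\<integral>x. (\<Sum>j\<in>UNIV. \<Sum>e\<in>Basis. g' j e x (?v j e)) \<partial>lborel)"
    by (simp add: Bochner_Integration.integral_sum z(2) Bochner_Integration.integrable_sum)
  also have "\<dots> = \<rho> *\<^sub>R (\<integral>x. h (x \<bullet> x) * H' (?q x) (x, 0) \<partial>lborel)"
    by (simp add: sum_g')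
  finally show ?thesis using \<rho> by simp
qed

lemma integrable_continuous_bounded_support:
  fixes f :: "'v::euclidean_space \<Rightarrow> 'w::euclidean_space"
  assumes "continuous_on UNIV f" "\<And>x. norm x > R \<Longrightarrow> f x = 0"
  shows "integrable lborel f"
proof -
  obtain B where "B \<ge> 0" and B: "\<And>x. norm (f x) \<le> B"
    by (rule bounded_if_continuous_bounded_support[OF assms]) auto
  show ?thesis
    by (rule integrable_bounded_support[OF borel_measurable_continuous_onI[OF assms(1)] B assms(2)])
qed

text \<open>
  The integral of \<open>h(|x|\<^sup>2) H(s x, |x|\<^sup>2 + w)\<close> does not depend on \<open>s\<close>; compare \<open>s = 1\<close> with \<open>s = 0\<close>. The
  weight takes values in \<open>A\<close> and stands on the left, so that the kernel itself can be a weight.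
\<close>
lemma radial_mean_value:
  fixes H :: "('a::hypercomplex ^ 'n::finite) \<times> 'a \<Rightarrow> 'a"
  assumes deriv: "\<And>p. p \<in> D \<Longrightarrow> (H has_derivative blinfun_apply (H' p)) (at p)"
    and contH': "continuous_on D H'"
    and reg: "\<And>p j. p \<in> D \<Longrightarrow> (\<Sum>e\<in>Basis. e * H' p (axis j e, 0)) = 0"
    and dom: "\<And>x s. 0 \<le> s \<Longrightarrow> s \<le> 1 \<Longrightarrow> (s *\<^sub>R x, of_real (x \<bullet> x) + w) \<in> D"
    and h: "\<And>s. s \<ge> 0 \<Longrightarrow> (h has_vector_derivative h' s) (at s)"
    and conth': "continuous_on {0..} h'"
    and hR: "\<And>s. s \<ge> R \<Longrightarrow> h s = 0"
  shows "(\<integral>(x::'a^'n). h (x \<bullet> x) * H (x, of_real (x \<bullet> x) + w) \<partial>lborel) =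
    (\<integral>(x::'a^'n). h (x \<bullet> x) * H (0, of_real (x \<bullet> x) + w) \<partial>lborel)"
proof -
  define K where "K = (\<lambda>(x::'a^'n) s. h (x \<bullet> x) * H (s *\<^sub>R x, of_real (x \<bullet> x) + w))"
  define k where "k = (\<lambda>(x::'a^'n) s. h (x \<bullet> x) * H' (s *\<^sub>R x, of_real (x \<bullet> x) + w) (x, 0))"
  have conth: "continuous_on {0..} h"
    by (rule continuous_at_imp_continuous_on) (auto intro: has_vector_derivative_continuous h)
  have contH: "continuous_on D H"
    by (rule has_derivative_continuous_on) (use deriv has_derivative_at_withinI in blast)
  have big: "h (x \<bullet> x) = 0" if "norm x > max 1 R" for x :: "'a ^ 'n"
  proof -
    have "norm x * 1 \<le> norm x * norm x" using that by (intro mult_left_mono) auto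
    then have "R \<le> x \<bullet> x" using that by (simp flip: power2_norm_eq_inner power2_eq_square)
    then show ?thesis by (rule hR)
  qed
  have contK: "continuous_on UNIV (\<lambda>x. K x s)" if "0 \<le> s" "s \<le> 1" for s
    unfolding K_def by (intro continuous_intros continuous_on_compose2[OF conth] continuous_on_compose2[OF contH])
      (use dom that in auto)
  have contk: "continuous_on (UNIV \<times> {0..1}) (\<lambda>z. k (fst z) (snd z))"
    unfolding k_def by (intro continuous_intros continuous_on_compose2[OF conth] continuous_on_compose2[OF contH'])
      (use dom in auto)
  have intK: "integrable lborel (\<lambda>x. K x s)" if "0 \<le> s" "s \<le> 1" for s
    by (rule integrable_continuous_bounded_support[OF contK[OF that], of "max 1 R"])
      (use big in \<open>auto simp: K_def\<close>)
  have "compact ((\<lambda>z. k (fst z) (snd z)) ` (cball 0 (max 1 R) \<times> {0..1}))"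
    by (intro compact_continuous_image continuous_on_subset[OF contk] compact_Times) auto
  then have "bounded ((\<lambda>z. k (fst z) (snd z)) ` (cball 0 (max 1 R) \<times> {0..1}))"
    by (rule compact_imp_bounded)
  then obtain B where B: "\<forall>y\<in>(\<lambda>z. k (fst z) (snd z)) ` (cball 0 (max 1 R) \<times> {0..1}). norm y \<le> B"
    unfolding bounded_iff by blast
  have "(\<integral>x. K x 1 - K x 0 \<partial>lborel) = 0"
  proof (rule integral_increment)
    show "continuous_on {0..1} (K x)" for x
      unfolding K_def by (intro continuous_intros continuous_on_compose2[OF contH]) (use dom in auto)
    show "\<exists>S. finite S \<and> (\<forall>s. s \<notin> S \<longrightarrow> 0 < s \<longrightarrow> s < 1 \<longrightarrow> (K x has_vector_derivative k x s) (at s))" for x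
    proof (intro exI[of _ "{}"] conjI allI impI)
      fix s :: real assume s: "0 < s" "s < 1"
      have "((\<lambda>s. H ((0, of_real (x \<bullet> x) + w) + s *\<^sub>R (x, 0))) has_vector_derivative
          H' (s *\<^sub>R x, of_real (x \<bullet> x) + w) (x, 0)) (at s)"
        by (rule has_derivative_line) (use deriv[OF dom, of s x] s in simp)
      then show "(K x has_vector_derivative k x s) (at s)"
        unfolding K_def k_def by (simp add: has_vector_derivative_mult_right)
    qed simp
    have "(\<lambda>z. indicator (UNIV \<times> {0..1}) z *\<^sub>R k (fst z) (snd z)) \<in> borel_measurable borel"
      by (rule borel_measurable_continuous_on_indicator[OF _ contk])
        (auto intro!: borel_closed closed_Times)
    then show "(\<lambda>(x, s). indicat_real {0..1} s *\<^sub>R k x s) \<in> borel_measurable (lborel \<Otimes>\<^sub>M lborel)"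
      by (simp add: lborel_prod case_prod_beta indicator_times)
    show "norm (k x s) \<le> max B 0" if "s \<in> {0..1}" for x s
    proof (cases "norm x > max 1 R")
      case True
      then show ?thesis by (simp only: k_def big) simp
    next
      case False
      then have "(x, s) \<in> cball 0 (max 1 R) \<times> {0..1}" using that by auto
      then show ?thesis using B by force
    qed
    show "k x s = 0" if "norm x > max 1 R" for x s
      using that by (simp only: k_def big) simp
    show "(\<integral>x. k x s \<partial>lborel) = 0" if "s \<in> {0<..1}" for s
      unfolding k_def
      by (rule radial_derivative_integral_eq_0[OF deriv contH' reg _ _ h conth' hR]) (use that dom in auto)
  qed
  then have "(\<integral>x. K x 1 \<partial>lborel) = (\<integral>x. K x 0 \<partial>lborel)"
    by (simp add: Bochner_Integration.integral_diff intK)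
  then show ?thesis by (simp add: K_def)
qed

section \<open>Decay at infinity and a smoothed Cauchy kernel\<close>

lemma half_DIM_cases:
  obtains p where "p > 0" "DIM('a::hypercomplex) = 2 * p" "DIM('a) div 2 = p"
  using DIM_half[where 'a='a] DIM_pos_half[where 'a='a] by metis

abbreviation decay :: "'a::real_normed_vector \<Rightarrow> real" where
  "decay y \<equiv> inverse (1 + norm y)"

lemma decay_pos: "decay y > 0"
  by (simp add: add_pos_nonneg)

lemma integrable_decay:
  "integrable lborel (\<lambda>y::'a::hypercomplex. decay y ^ (2 * DIM('a)))"
proof (rule integrableI_nonneg)
  obtain p where p: "p > 0" "DIM('a) = 2 * p" using half_DIM_cases[where 'a='a] by metis
  let ?c = "pi ^ p / fact (p - 1)"
  show "(\<lambda>y::'a. decay y ^ (2 * DIM('a))) \<in> borel_measurable lborel" by measurable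
  show "AE y::'a in lborel. 0 \<le> decay y ^ (2 * DIM('a))" by (simp add: add_nonneg_nonneg)
  have le: "decay y ^ (2 * DIM('a)) \<le> inverse (1 + y \<bullet> y) ^ (2 * p)" for y :: 'a
  proof -
    have "(1 + y \<bullet> y) \<le> (1 + norm y)\<^sup>2"
      by (simp add: power2_eq_square algebra_simps power2_norm_eq_inner[symmetric])
    then have "inverse ((1 + norm y)\<^sup>2) \<le> inverse (1 + y \<bullet> y)"
      by (rule le_imp_inverse_le) (simp add: add_pos_nonneg)
    then have "inverse ((1 + norm y)\<^sup>2) ^ (2 * p) \<le> inverse (1 + y \<bullet> y) ^ (2 * p)"
      by (intro power_mono) auto
    then show ?thesis by (simp add: p(2) power_inverse flip: power_mult)
  qed
  have "(\<integral>\<^sup>+(y::'a). ennreal (decay y ^ (2 * DIM('a))) \<partial>lborel) \<le>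
      (\<integral>\<^sup>+(y::'a). ennreal (inverse (1 + y \<bullet> y) ^ (2 * p)) \<partial>lborel)"
    by (intro nn_integral_mono ennreal_leI le)
  also have "\<dots> = (\<integral>\<^sup>+u. ennreal (radial_weight p u) * ennreal (inverse (1 + u) ^ (2 * p)) \<partial>lborel)"
    by (rule nn_integral_inner_self[OF p(2,1)]) measurable
  also have "\<dots> \<le> (\<integral>\<^sup>+u. ennreal (?c * inverse (1 + u) ^ 2) * indicator {0..} u \<partial>lborel)"
  proof (rule nn_integral_mono)
    fix u :: real
    have "radial_weight p u * inverse (1 + u) ^ (2 * p) \<le> ?c * inverse (1 + u) ^ 2" if "u > 0"
    proof -
      have "u ^ (p - 1) \<le> (1 + u) ^ (p - 1)" using that by (intro power_mono) auto
      then have "radial_weight p u * inverse (1 + u) ^ (2 * p) \<le> ?c * (1 + u) ^ (p - 1) * inverse (1 + u) ^ (2 * p)"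
        using that by (auto simp: radial_weight_def intro!: mult_right_mono divide_right_mono)
      also have "\<dots> = ?c * inverse (1 + u) ^ (p + 1)"
      proof -
        have "inverse (1 + u) ^ (2 * p) = inverse (1 + u) ^ (p - 1) * inverse (1 + u) ^ (p + 1)"
          using p by (simp flip: power_add power_Suc add: mult_2)
        moreover have "(1 + u) ^ (p - 1) * inverse (1 + u) ^ (p - 1) = 1"
          using that by (simp flip: power_mult_distrib)
        ultimately show ?thesis by (simp add: mult.assoc del: power_Suc)
      qed
      also have "\<dots> \<le> ?c * inverse (1 + u) ^ 2"
        using that p by (intro mult_left_mono power_decreasing) (auto simp: inverse_le_1_iff)
      finally show ?thesis .
    qed
    then show "ennreal (radial_weight p u) * ennreal (inverse (1 + u) ^ (2 * p)) \<le>
        ennreal (?c * inverse (1 + u) ^ 2) * indicator {0..} u"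
      by (cases "u > 0") (auto simp: radial_weight_def ennreal_mult[symmetric] intro!: ennreal_leI)
  qed
  also have "\<dots> = ennreal (0 - (- ?c * inverse (1 + 0)))"
  proof (rule nn_integral_FTC_atLeast)
    show "((\<lambda>u. - ?c * inverse (1 + u)) has_real_derivative ?c * (inverse (1 + u))\<^sup>2) (at u)" if "0 \<le> u" for u
      using that by (auto intro!: derivative_eq_intros simp: power2_eq_square)
    show "((\<lambda>u. - ?c * inverse (1 + u)) \<longlongrightarrow> 0) at_top"
      by (intro tendsto_mult_right_zero tendsto_inverse_0_at_top filterlim_tendsto_add_at_top[OF tendsto_const] filterlim_ident)
  qed auto
  also have "\<dots> < \<infinity>" by simp
  finally show "(\<integral>\<^sup>+(y::'a). ennreal (decay y ^ (2 * DIM('a))) \<partial>lborel) < \<infinity>" .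
qed

text \<open>
  Near 0 continuity is enough, since there the weight is bounded below.
\<close>
lemma decay_bound_of_eventual:
  fixes f :: "'a::euclidean_space \<Rightarrow> 'b::real_normed_vector"
  assumes "continuous_on UNIV f" and far: "\<And>y. norm y > \<rho> \<Longrightarrow> norm (f y) \<le> C * decay y ^ q"
  obtains C' where "C' \<ge> 0" "\<And>y. norm (f y) \<le> C' * decay y ^ q"
proof -
  have "bounded (f ` cball 0 \<rho>)"
    by (intro compact_imp_bounded compact_continuous_image continuous_on_subset[OF assms(1)]) auto
  then obtain M where M: "\<forall>y\<in>f ` cball 0 \<rho>. norm y \<le> M" unfolding bounded_iff by blast
  define C' where "C' = max 0 C + max 0 M * (1 + \<bar>\<rho>\<bar>) ^ q"
  have "norm (f y) \<le> C' * decay y ^ q" for y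
  proof (cases "norm y > \<rho>")
    case True
    have "norm (f y) \<le> C * decay y ^ q" by (rule far[OF True])
    also have "\<dots> \<le> C' * decay y ^ q" unfolding C'_def
      by (intro mult_right_mono) (auto simp: add_nonneg_nonneg intro!: add_increasing2)
    finally show ?thesis .
  next
    case False
    have "(1 + norm y) ^ q \<le> (1 + \<bar>\<rho>\<bar>) ^ q" using False by (intro power_mono) auto
    then have "1 \<le> (1 + \<bar>\<rho>\<bar>) ^ q * decay y ^ q"
      by (simp add: power_inverse field_simps add_pos_nonneg)
    then have "max 0 M * 1 \<le> max 0 M * ((1 + \<bar>\<rho>\<bar>) ^ q * decay y ^ q)"
      by (rule mult_left_mono) simp
    moreover have "norm (f y) \<le> M" using False M by auto
    ultimately have "norm (f y) \<le> max 0 M * ((1 + \<bar>\<rho>\<bar>) ^ q * decay y ^ q)" by linarith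
    also have "\<dots> \<le> C' * decay y ^ q" unfolding C'_def mult.assoc[symmetric]
      by (intro mult_right_mono) (auto simp: add_nonneg_nonneg)
    finally show ?thesis .
  qed
  moreover have "C' \<ge> 0" by (simp add: C'_def)
  ultimately show ?thesis using that by blast
qed

text \<open>
  The function \<open>1 / s\<close>, continued below \<open>d\<close> by its tangent so that it is continuously differentiable
  everywhere.
\<close>
definition smooth_inverse :: "real \<Rightarrow> real \<Rightarrow> real" where
  "smooth_inverse d s = (if s \<le> d then 2 / d - s / d\<^sup>2 else 1 / s)"

lemma smooth_inverse_derivative:
  assumes "d > 0"
  shows "(smooth_inverse d has_real_derivative - (1 / (max s d)\<^sup>2)) (at s)"
proof -
  consider "s < d" | "s = d" | "s > d" by linarith
  then show ?thesis
  proof cases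
    case 1
    have "((\<lambda>s. 2 / d - s / d\<^sup>2) has_real_derivative - (1 / (max s d)\<^sup>2)) (at s)"
      using 1 assms by (auto intro!: derivative_eq_intros simp: power2_eq_square power4_eq_xxxx)
    then show ?thesis
      by (rule has_field_derivative_transform_within_open[of _ _ _ "{..<d}"]) (use 1 in \<open>auto simp: smooth_inverse_def\<close>)
  next
    case 3
    have "((\<lambda>s. 1 / s) has_real_derivative - (1 / (max s d)\<^sup>2)) (at s)"
      using 3 assms by (auto intro!: derivative_eq_intros simp: power2_eq_square)
    then show ?thesis
      by (rule has_field_derivative_transform_within_open[of _ _ _ "{d<..}"]) (use 3 in \<open>auto simp: smooth_inverse_def\<close>)
  next
    case 2
    have l: "((\<lambda>s. 2 / d - s / d\<^sup>2) has_real_derivative - (1 / d\<^sup>2)) (at d within {..d})"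
      using assms by (auto intro!: derivative_eq_intros simp: power2_eq_square power4_eq_xxxx)
    have r: "((\<lambda>s. 1 / s) has_real_derivative - (1 / d\<^sup>2)) (at d within {d..})"
      using assms by (auto intro!: derivative_eq_intros simp: power2_eq_square)
    have l': "(smooth_inverse d has_real_derivative - (1 / d\<^sup>2)) (at d within {..d})"
      unfolding has_field_derivative_def
      by (rule has_derivative_transform[OF _ _ l[unfolded has_field_derivative_def]]) (auto simp: smooth_inverse_def)
    have r': "(smooth_inverse d has_real_derivative - (1 / d\<^sup>2)) (at d within {d..})"
      unfolding has_field_derivative_def
      by (rule has_derivative_transform[OF _ _ r[unfolded has_field_derivative_def]]) (use assms in \<open>auto simp: smooth_inverse_def power2_eq_square field_simps\<close>)
    have "(smooth_inverse d has_real_derivative - (1 / d\<^sup>2)) (at d within ({..d} \<union> {d..}))"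
      using l' r' unfolding has_field_derivative_iff unfolding at_within_union by (rule filterlim_sup)
    moreover have "{..d} \<union> {d..} = (UNIV :: real set)" by auto
    ultimately show ?thesis using 2 by simp
  qed
qed

lemma smooth_inverse_deriv_identity: "d > 0 \<Longrightarrow> smooth_inverse d s - s / (max s d)\<^sup>2 = 2 / d * max 0 (1 - s / d)"
  by (auto simp: smooth_inverse_def max_def field_simps power2_eq_square)

lemma continuous_on_smooth_inverse: "d > 0 \<Longrightarrow> continuous_on UNIV (smooth_inverse d)"
  by (meson DERIV_isCont continuous_at_imp_continuous_on smooth_inverse_derivative)

text \<open>
  The Cauchy kernel with \<open>|\<nu>|\<^sup>-\<^sup>2\<close> smoothed inside the ball of radius \<open>sqrt d\<close>. Its right Dirac
  derivative, the point mass for \<open>E\<close> itself, becomes the radial bump function \<open>bump\<close>.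
\<close>
definition smooth_cauchy :: "real \<Rightarrow> 'a::hypercomplex \<Rightarrow> 'a" where
  "smooth_cauchy d \<nu> = cauchy_const TYPE('a) *\<^sub>R (smooth_inverse d (\<nu> \<bullet> \<nu>) ^ (DIM('a) div 2) *\<^sub>R conjugate \<nu>)"

definition smooth_cauchy' :: "real \<Rightarrow> 'a::hypercomplex \<Rightarrow> 'a \<Rightarrow> 'a" where
  "smooth_cauchy' d \<nu> h = cauchy_const TYPE('a) *\<^sub>R (smooth_inverse d (\<nu> \<bullet> \<nu>) ^ (DIM('a) div 2) *\<^sub>R conjugate h -
    (real DIM('a) * smooth_inverse d (\<nu> \<bullet> \<nu>) ^ (DIM('a) div 2 - 1) / (max (\<nu> \<bullet> \<nu>) d)\<^sup>2 * (\<nu> \<bullet> h)) *\<^sub>R conjugate \<nu>)"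

definition bump :: "'a::hypercomplex itself \<Rightarrow> real \<Rightarrow> real \<Rightarrow> real" where
  "bump _ d s = cauchy_const TYPE('a) * (real DIM('a) * smooth_inverse d s ^ (DIM('a) div 2 - 1) * (2 / d * max 0 (1 - s / d)))"

lemma smooth_cauchy_has_derivative:
  assumes "d > 0"
  shows "(smooth_cauchy d has_derivative smooth_cauchy' d \<nu>) (at (\<nu>::'a::hypercomplex))"
proof -
  let ?p = "DIM('a) div 2"
  have 1: "(conjugate has_derivative conjugate) (at \<nu>)"
    by (rule bounded_linear_imp_has_derivative[OF linear_conjugate])
  have 2: "((\<lambda>\<nu>::'a. \<nu> \<bullet> \<nu>) has_derivative (\<lambda>h. 2 * (\<nu> \<bullet> h))) (at \<nu>)"
    by (auto intro!: derivative_eq_intros simp: inner_commute fun_eq_iff)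
  have "((\<lambda>\<nu>::'a. smooth_inverse d (\<nu> \<bullet> \<nu>)) has_derivative (\<lambda>h. - (1 / (max (\<nu> \<bullet> \<nu>) d)\<^sup>2) * (2 * (\<nu> \<bullet> h)))) (at \<nu>)"
    using has_derivative_compose[OF 2 smooth_inverse_derivative[OF assms, unfolded has_field_derivative_def]] .
  then have "((\<lambda>\<nu>::'a. smooth_inverse d (\<nu> \<bullet> \<nu>) ^ ?p) has_derivative
      (\<lambda>h. real ?p * (- (1 / (max (\<nu> \<bullet> \<nu>) d)\<^sup>2) * (2 * (\<nu> \<bullet> h))) * smooth_inverse d (\<nu> \<bullet> \<nu>) ^ (?p - 1))) (at \<nu>)"
    by (rule has_derivative_power)
  from has_derivative_scaleR_right[OF has_derivative_scaleR[OF this 1], of "cauchy_const TYPE('a)"]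
  have *: "(smooth_cauchy d has_derivative (\<lambda>h. cauchy_const TYPE('a) *\<^sub>R (smooth_inverse d (\<nu> \<bullet> \<nu>) ^ ?p *\<^sub>R conjugate h +
      (real ?p * (- (1 / (max (\<nu> \<bullet> \<nu>) d)\<^sup>2) * (2 * (\<nu> \<bullet> h))) * smooth_inverse d (\<nu> \<bullet> \<nu>) ^ (?p - 1)) *\<^sub>R conjugate \<nu>))) (at \<nu>)"
    unfolding smooth_cauchy_def[abs_def] .
  have "real DIM('a) = 2 * real ?p" using DIM_half[where 'a='a] by (metis of_nat_mult of_nat_numeral)
  then show ?thesis
    by (intro has_derivative_eq_rhs[OF *]) (simp add: smooth_cauchy'_def[abs_def] fun_eq_iff mult_ac)
qed

lemma smooth_cauchy_right_derivative:
  assumes "d > 0"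
  shows "(\<Sum>e\<in>Basis. smooth_cauchy' d \<nu> e * e) = of_real (bump TYPE('a) d (\<nu> \<bullet> \<nu>) :: real) * (1::'a::hypercomplex)"
proof -
  let ?p = "DIM('a) div 2" and ?s = "\<nu> \<bullet> \<nu>" and ?c = "cauchy_const TYPE('a)"
  let ?q = "real DIM('a) * smooth_inverse d ?s ^ (?p - 1) / (max ?s d)\<^sup>2"
  have pw: "smooth_inverse d ?s ^ ?p = smooth_inverse d ?s ^ (?p - 1) * smooth_inverse d ?s"
    using DIM_pos_half[where 'a='a] by (metis Suc_diff_1 power_Suc2)
  have "(\<Sum>e\<in>Basis. smooth_cauchy' d \<nu> e * e) = (\<Sum>e\<in>Basis. ?c *\<^sub>R (smooth_inverse d ?s ^ ?p *\<^sub>R 1 - ?q *\<^sub>R (conjugate \<nu> * ((\<nu> \<bullet> e) *\<^sub>R e))))"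
    by (intro sum.cong refl) (simp add: smooth_cauchy'_def left_diff_distrib conjugate_mult_Basis_self)
  also have "\<dots> = ?c *\<^sub>R ((smooth_inverse d ?s ^ ?p * real DIM('a)) *\<^sub>R 1 - ?q *\<^sub>R (conjugate \<nu> * (\<Sum>e\<in>Basis. (\<nu> \<bullet> e) *\<^sub>R e)))"
    by (simp only: scaleR_sum_right[symmetric] sum_subtractf sum_constant_scaleR
          sum_distrib_left[symmetric] scaleR_scaleR)
  also have "\<dots> = ?c *\<^sub>R ((smooth_inverse d ?s ^ ?p * real DIM('a) - ?q * ?s) *\<^sub>R 1)"
    by (simp only: euclidean_representation conjugate_mult_self power2_norm_eq_inner)
      (simp add: of_real_def scaleR_left_diff_distrib)
  also have "\<dots> = of_real (?c * (real DIM('a) * smooth_inverse d ?s ^ (?p - 1) * (smooth_inverse d ?s - ?s / (max ?s d)\<^sup>2)))"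
    by (simp add: pw of_real_def algebra_simps)
  finally show ?thesis by (simp add: bump_def smooth_inverse_deriv_identity[OF assms])
qed

lemma smooth_cauchy_far: "d > 0 \<Longrightarrow> \<nu> \<bullet> \<nu> \<ge> d \<Longrightarrow> smooth_cauchy d \<nu> = cauchy_deriv 0 \<nu>"
  by (auto simp: smooth_cauchy_def cauchy_deriv_0 cauchy_E_eq smooth_inverse_def inverse_eq_divide power2_eq_square field_simps)

lemma bump_far: "d > 0 \<Longrightarrow> s \<ge> d \<Longrightarrow> bump T d s = 0"
  by (simp add: bump_def max_def field_simps)

lemma continuous_on_bump: "d > 0 \<Longrightarrow> continuous_on UNIV (bump T d)"
  unfolding bump_def[abs_def] by (intro continuous_intros continuous_on_smooth_inverse) auto

lemma cauchy_const_nonneg: "cauchy_const TYPE('a::hypercomplex) \<ge> 0"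
  unfolding cauchy_const_def by (intro divide_nonneg_nonneg Gamma_real_nonneg) auto

lemma bump_nonneg: "d > 0 \<Longrightarrow> bump (T :: 'a::hypercomplex itself) d s \<ge> 0"
proof (cases "s \<ge> d")
  case False
  assume d: "d > 0"
  have "smooth_inverse d s = (2 * d - s) / d\<^sup>2" using False d by (simp add: smooth_inverse_def field_simps power2_eq_square)
  then have "smooth_inverse d s \<ge> 0" using False d by simp
  then show ?thesis unfolding bump_def
    using d by (intro mult_nonneg_nonneg cauchy_const_nonneg zero_le_power) auto
qed (simp add: bump_far)

text \<open>
  In terms of \<open>u = |y|\<^sup>2\<close> the integrand is the derivative of \<open>(u \<psi>(u))\<^sup>p\<close>, where \<open>\<psi>\<close> is the smoothed
  inverse and \<open>m = 2 p\<close>; this function is 0 at 0 and 1 at \<open>d\<close>. The constant in \<open>E\<close> is the one that makes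
  the total mass 1.
\<close>
lemma nn_integral_bump:
  assumes "d > 0"
  shows "(\<integral>\<^sup>+(y::'a::hypercomplex). ennreal (bump TYPE('a) d (y \<bullet> y)) \<partial>lborel) = 1"
proof -
  obtain p where p: "p > 0" "DIM('a) = 2 * p" "DIM('a) div 2 = p" using half_DIM_cases[where 'a='a] by metis
  let ?c = "pi ^ p / fact (p - 1)"
  let ?F = "\<lambda>u. (2 * u / d - u\<^sup>2 / d\<^sup>2) ^ p"
  let ?f = "\<lambda>u. real p * (2 / d - 2 * u / d\<^sup>2) * (2 * u / d - u\<^sup>2 / d\<^sup>2) ^ (p - 1)"
  have [measurable]: "bump TYPE('a) d \<in> borel_measurable borel"
    by (rule borel_measurable_continuous_onI[OF continuous_on_bump[OF assms]])
  have C: "?c * cauchy_const TYPE('a) = 1 / 2"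
  proof -
    have "real DIM('a) / 2 = real p" by (simp add: p(2))
    moreover have "Gamma (real p) = fact (p - 1)"
      using Gamma_fact[of "p - 1", where 'a=real] p(1) by (simp add: of_nat_diff)
    ultimately show ?thesis by (simp add: cauchy_const_def powr_realpow)
  qed
  have eq: "radial_weight p u * bump TYPE('a) d u = ?f u" if "0 < u" "u \<le> d" for u
  proof -
    have "radial_weight p u * bump TYPE('a) d u = (?c * cauchy_const TYPE('a)) * (2 * p) *
        (u ^ (p - 1) * smooth_inverse d u ^ (p - 1)) * (2 / d * (1 - u / d))"
      using that assms by (simp add: radial_weight_def bump_def p(2) max_def)
    also have "\<dots> = real p * (u * smooth_inverse d u) ^ (p - 1) * (2 / d * (1 - u / d))"
      unfolding C by (simp add: power_mult_distrib)
    also have "u * smooth_inverse d u = 2 * u / d - u\<^sup>2 / d\<^sup>2" using that by (simp add: smooth_inverse_def algebra_simps power2_eq_square)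
    also have "2 / d * (1 - u / d) = 2 / d - 2 * u / d\<^sup>2"
      by (simp add: right_diff_distrib power2_eq_square)
    finally show ?thesis by simp
  qed
  have "(\<integral>\<^sup>+(y::'a). ennreal (bump TYPE('a) d (y \<bullet> y)) \<partial>lborel) =
      (\<integral>\<^sup>+u. ennreal (radial_weight p u) * ennreal (bump TYPE('a) d u) \<partial>lborel)"
    by (rule nn_integral_inner_self[OF p(2,1)]) measurable
  also have "\<dots> = (\<integral>\<^sup>+u. ennreal (?f u) * indicator {0..d} u \<partial>lborel)"
  proof (rule nn_integral_cong_AE)
    show "AE u in lborel. ennreal (radial_weight p u) * ennreal (bump TYPE('a) d u) = ennreal (?f u) * indicator {0..d} u"
      using AE_lborel_singleton[of "0::real"]
    proof eventually_elim
      fix u :: real assume "u \<noteq> 0"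
      then consider "u < 0" | "0 < u" "u \<le> d" | "u > d" by linarith
      then show "ennreal (radial_weight p u) * ennreal (bump TYPE('a) d u) = ennreal (?f u) * indicator {0..d} u"
      proof cases
        case 2
        then have "ennreal (radial_weight p u) * ennreal (bump TYPE('a) d u) = ennreal (?f u)"
          by (subst eq[OF 2, symmetric]) (simp add: ennreal_mult bump_nonneg[OF assms])
        then show ?thesis using 2 by simp
      qed (use assms in \<open>auto simp: radial_weight_def bump_far\<close>)
    qed
  qed
  also have "\<dots> = ?F d - ?F 0"
  proof (rule nn_integral_FTC_Icc)
    show "(?F has_real_derivative ?f u) (at u)" for u
    proof -
      have "((\<lambda>u. 2 * u / d - u\<^sup>2 / d\<^sup>2) has_real_derivative (2 / d - 2 * u / d\<^sup>2)) (at u)"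
        using assms by (auto intro!: derivative_eq_intros simp: power2_eq_square power4_eq_xxxx field_simps)
      from DERIV_power[OF this, of p] show ?thesis by (simp add: mult_ac)
    qed
    show "0 \<le> ?f u" if "u \<in> {0..d}" for u
    proof -
      have "u * u \<le> u * (2 * d)" using that assms by (intro mult_left_mono) auto
      then have "u\<^sup>2 / d\<^sup>2 \<le> 2 * u / d"
        using assms by (simp add: field_simps power2_eq_square)
      moreover have "2 * u / d\<^sup>2 \<le> 2 / d"
        using that assms by (simp add: field_simps power2_eq_square)
      ultimately have "0 \<le> 2 / d - 2 * u / d\<^sup>2" "0 \<le> 2 * u / d - u\<^sup>2 / d\<^sup>2" by simp_all
      then show ?thesis by simp
    qed
  qed (use assms in auto)
  also have "\<dots> = 1" using assms p(1) by (simp add: power2_eq_square)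
  finally show ?thesis by simp
qed

section \<open>The divergence theorem on the half-space\<close>

text \<open>
  Continuing \<open>u\<close> by 0 beyond the boundary keeps it continuous, with a kink that every line meets at most once
  unless it runs inside the boundary, where the continuation is 0.
\<close>
lemma half_space_divergence:
  fixes u :: "'a::hypercomplex \<Rightarrow> 'w::euclidean_space"
  assumes \<epsilon>: "\<epsilon> > 0"
    and deriv: "\<And>y. y \<bullet> 1 > - \<epsilon> \<Longrightarrow> (u has_derivative u' y) (at y)"
    and cont: "continuous_on {y. y \<bullet> 1 > - \<epsilon>} (\<lambda>y. u' y v)"
    and supp: "\<And>y. norm y > R \<Longrightarrow> u y = 0"
    and vanish: "\<And>y. y \<bullet> 1 = 0 \<Longrightarrow> u y = 0"
  shows "(\<integral>y. indicator {y. y \<bullet> 1 > 0} y *\<^sub>R u' y v \<partial>lborel) = 0"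
    and "integrable lborel (\<lambda>y. indicator {y. y \<bullet> 1 > 0} y *\<^sub>R u' y v)"
proof -
  define g where "g = (\<lambda>y. if y \<bullet> 1 \<le> 0 then 0 else u y)"
  define g' where "g' = (\<lambda>y. indicator {y. y \<bullet> 1 > 0} y *\<^sub>R u' y v)"
  have op: "open {y::'a. y \<bullet> 1 > c}" for c
    by (simp add: open_halfspace_component_gt)
  have contu: "continuous_on {y. y \<bullet> 1 > - \<epsilon>} u"
    by (rule has_derivative_continuous_on) (use deriv has_derivative_at_withinI in blast)
  have contg: "continuous_on UNIV g"
    unfolding g_def
    by (intro continuous_on_cases_le continuous_intros continuous_on_subset[OF contu])
      (use \<epsilon> vanish in auto)
  have g'_pos: "g' y = u' y v" if "y \<bullet> 1 > 0" for y using that by (simp add: g'_def)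
  have g'_neg: "g' y = 0" if "\<not> y \<bullet> 1 > 0" for y using that by (simp add: g'_def)
  have gd_pos: "(g has_derivative u' y) (at y)" if "y \<bullet> 1 > 0" for y
    by (rule has_derivative_transform_within_open[OF deriv op[of 0]]) (use that \<epsilon> in \<open>auto simp: g_def\<close>)
  have gd_neg: "(g has_derivative (\<lambda>_. 0)) (at y)" if "y \<bullet> 1 < 0" for y
    by (rule has_derivative_transform_within_open[of "\<lambda>_. 0" _ _ _ "{y. y \<bullet> 1 < 0}"])
      (use that in \<open>auto simp: g_def open_halfspace_component_lt\<close>)
  have suppg: "g y = 0" if "norm y > R" for y using supp[OF that] by (simp add: g_def)
  have suppg': "g' y = 0" if "norm y > R" for y
  proof (cases "y \<bullet> 1 > 0")
    case True
    have "(g has_derivative (\<lambda>_. 0)) (at y)"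
      by (rule has_derivative_transform_within_open[of "\<lambda>_. 0" _ _ _ "- cball 0 R"]) (use that suppg in auto)
    then have "u' y = (\<lambda>_. 0)" by (rule has_derivative_unique[OF gd_pos[OF True]])
    then show ?thesis by (simp add: g'_def)
  qed (rule g'_neg)
  have meas: "g' \<in> borel_measurable borel"
    unfolding g'_def
    by (rule borel_measurable_continuous_on_indicator[OF _ continuous_on_subset[OF cont]])
      (use \<epsilon> op in auto)
  let ?K = "cball 0 R \<inter> {y::'a. y \<bullet> 1 \<ge> 0}"
  have "compact ?K"
    by (intro compact_Int_closed) (auto simp: closed_halfspace_component_ge)
  then have "bounded ((\<lambda>y. u' y v) ` ?K)"
    by (intro compact_imp_bounded compact_continuous_image continuous_on_subset[OF cont]) (use \<epsilon> in auto)
  then obtain B where B: "\<forall>z\<in>(\<lambda>y. u' y v) ` ?K. norm z \<le> B" unfolding bounded_iff by blast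
  have bdd: "norm (g' y) \<le> max B 0" for y
  proof (cases "y \<bullet> 1 > 0 \<and> norm y \<le> R")
    case True
    then have "norm (u' y v) \<le> B" using B by auto
    then show ?thesis using True by (simp add: g'_pos)
  qed (use g'_neg[of y] suppg'[of y] in auto)
  have lines: "\<exists>S. finite S \<and> (\<forall>s. s \<notin> S \<longrightarrow> ((\<lambda>s. g (x + s *\<^sub>R v)) has_vector_derivative g' (x + s *\<^sub>R v)) (at s))" for x
  proof -
    have pos: "((\<lambda>s. g (x + s *\<^sub>R v)) has_vector_derivative g' (x + s *\<^sub>R v)) (at s)" if "(x + s *\<^sub>R v) \<bullet> 1 > 0" for s
      unfolding g'_pos[OF that] by (rule has_derivative_line[OF gd_pos[OF that]])
    have neg: "((\<lambda>s. g (x + s *\<^sub>R v)) has_vector_derivative g' (x + s *\<^sub>R v)) (at s)" if "(x + s *\<^sub>R v) \<bullet> 1 < 0" for s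
      using has_derivative_line[OF gd_neg[OF that]] g'_neg[of "x + s *\<^sub>R v"] that by simp
    show ?thesis
    proof (cases "v \<bullet> 1 = 0")
      case False
      have "s \<notin> {- (x \<bullet> 1) / (v \<bullet> 1)} \<Longrightarrow> (x + s *\<^sub>R v) \<bullet> 1 \<noteq> 0" for s
        using False by (auto simp: inner_add_left field_simps)
      then show ?thesis using pos neg
        by (intro exI[of _ "{- (x \<bullet> 1) / (v \<bullet> 1)}"]) (meson finite.emptyI finite.insertI linorder_neqE_linordered_idom)
    next
      case True
      then have re: "(x + s *\<^sub>R v) \<bullet> 1 = x \<bullet> 1" for s by (simp add: inner_add_left)
      show ?thesis
      proof (cases "x \<bullet> 1 = 0")
        case True
        then show ?thesis
          by (intro exI[of _ "{}"]) (simp add: g_def g'_def re)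
      next
        case False
        then show ?thesis using pos neg
          by (intro exI[of _ "{}"]) (metis finite.emptyI linorder_neqE_linordered_idom re)
      qed
    qed
  qed
  show "(\<integral>y. indicator {y. y \<bullet> 1 > 0} y *\<^sub>R u' y v \<partial>lborel) = 0"
    using integral_directional_derivative_eq_0[OF contg meas bdd suppg suppg' lines] by (simp add: g'_def)
  show "integrable lborel (\<lambda>y. indicator {y. y \<bullet> 1 > 0} y *\<^sub>R u' y v)"
    using integrable_bounded_support[OF meas bdd suppg'] by (simp add: g'_def)
qed

text \<open>
  The square makes the cutoff continuously differentiable at \<open>s = R\<^sup>2\<close>.
\<close>
definition cutoff :: "real \<Rightarrow> real \<Rightarrow> real" where
  "cutoff R s = (max 0 (1 - s / R\<^sup>2))\<^sup>2"

lemma cutoff_derivative: "(cutoff R has_real_derivative - 2 * max 0 (1 - s / R\<^sup>2) / R\<^sup>2) (at s)"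
proof -
  have *: "((\<lambda>x. (max 0 x)\<^sup>2) has_real_derivative 2 * max 0 x) (at x)" for x :: real
  proof -
    consider "x < 0" | "x = 0" | "x > 0" by linarith
    then show ?thesis
    proof cases
      case 1
      have "((\<lambda>x. 0) has_real_derivative 2 * max 0 x) (at x)" using 1 by simp
      then show ?thesis
        by (rule has_field_derivative_transform_within_open[of _ _ _ "{..<0}"]) (use 1 in auto)
    next
      case 3
      have "((\<lambda>x. x\<^sup>2) has_real_derivative 2 * max 0 x) (at x)" using 3 by (auto intro!: derivative_eq_intros)
      then show ?thesis
        by (rule has_field_derivative_transform_within_open[of _ _ _ "{0<..}"]) (use 3 in auto)
    next
      case 2
      have "((\<lambda>y. ((max 0 y)\<^sup>2 - (max 0 0)\<^sup>2) / (y - 0)) \<longlongrightarrow> 0) (at (0::real))"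
      proof (rule Lim_null_comparison)
        show "\<forall>\<^sub>F y in at 0. norm (((max 0 y)\<^sup>2 - (max 0 0)\<^sup>2) / (y - 0)) \<le> norm (y::real)"
          by (rule always_eventually) (auto simp: max_def power2_eq_square)
        show "((\<lambda>y::real. norm y) \<longlongrightarrow> 0) (at 0)" by (intro tendsto_norm_zero tendsto_ident_at)
      qed
      then show ?thesis unfolding has_field_derivative_iff 2 by simp
    qed
  qed
  have "((\<lambda>s. 1 - s / R\<^sup>2) has_real_derivative - (1 / R\<^sup>2)) (at s)"
    by (cases "R = 0") (auto intro!: derivative_eq_intros simp: power2_eq_square power4_eq_xxxx)
  from DERIV_chain2[OF * this] show ?thesis
    unfolding cutoff_def[abs_def] by simp
qed

lemma cutoff_nonneg: "0 \<le> cutoff R s"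
  by (simp add: cutoff_def)

lemma cutoff_le_1: "0 \<le> s \<Longrightarrow> cutoff R s \<le> 1"
  unfolding cutoff_def by (intro power_le_one) auto

lemma cutoff_far: "R > 0 \<Longrightarrow> s \<ge> R\<^sup>2 \<Longrightarrow> cutoff R s = 0"
  by (simp add: cutoff_def max_def field_simps)

lemma cutoff_tendsto_1: "(\<lambda>n. cutoff (real (Suc n)) s) \<longlonglongrightarrow> 1"
proof -
  have "(\<lambda>n. (max 0 (1 - s * (inverse (real (Suc n)))\<^sup>2))\<^sup>2) \<longlonglongrightarrow> (max 0 (1 - s * 0\<^sup>2))\<^sup>2"
    by (intro tendsto_intros LIMSEQ_inverse_real_of_nat)
  then show ?thesis by (simp add: cutoff_def divide_inverse power_inverse)
qed

lemma continuous_on_cutoff: "continuous_on UNIV (cutoff R)"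
  by (meson DERIV_isCont continuous_at_imp_continuous_on cutoff_derivative)

lemma continuous_on_cutoff': "continuous_on UNIV (\<lambda>s::real. - 2 * max 0 (1 - s / R\<^sup>2) / R\<^sup>2)"
  by (cases "R = 0") (auto intro!: continuous_intros)

section \<open>The Taylor remainder of the Cauchy kernel\<close>

text \<open>
  With \<open>E\<close> in place of its smoothed version this is the remainder of order \<open>k\<close> in the Taylor expansion of
  \<open>E(r - y)\<close> about the reflected point \<open>r + conjugate y\<close>, from which \<open>r - y\<close> differs by the real number
  \<open>- 2 y\<^sub>0\<close>.
\<close>
definition taylor_kernel :: "real \<Rightarrow> nat \<Rightarrow> real \<Rightarrow> 'a::hypercomplex \<Rightarrow> 'a" where
  "taylor_kernel d k r y = smooth_cauchy d (of_real r - y) -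
     (\<Sum>j<k. ((-2 * (y \<bullet> 1)) ^ j / fact j) *\<^sub>R cauchy_deriv j (of_real r + conjugate y))"

definition taylor_kernel' :: "real \<Rightarrow> nat \<Rightarrow> real \<Rightarrow> 'a::hypercomplex \<Rightarrow> 'a \<Rightarrow> 'a" where
  "taylor_kernel' d k r y h = - smooth_cauchy' d (of_real r - y) h -
     (\<Sum>j<k. ((-2 * (y \<bullet> 1)) ^ j / fact j) *\<^sub>R cauchy_deriv' j (of_real r + conjugate y) (conjugate h) +
        (real j * (-2 * (h \<bullet> 1)) * (-2 * (y \<bullet> 1)) ^ (j - 1) / fact j) *\<^sub>R cauchy_deriv j (of_real r + conjugate y))"

text \<open>
  Up to the sign, \<open>y\<^sub>0\<^sup>i\<close> times the kernel that reproduces the value at \<open>r\<close> in the Bergman space with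
  the weight \<open>y\<^sub>0\<^sup>i\<close> on the half-space.
\<close>
definition half_space_kernel :: "nat \<Rightarrow> real \<Rightarrow> 'a::hypercomplex \<Rightarrow> 'a" where
  "half_space_kernel i r y = (2 * (-2 * (y \<bullet> 1)) ^ i / fact i) *\<^sub>R cauchy_deriv (Suc i) (of_real r + conjugate y)"

lemma reflected_nonzero: "y \<bullet> 1 > - r \<Longrightarrow> of_real r + conjugate y \<noteq> (0::'a::hypercomplex)"
proof
  assume "y \<bullet> 1 > - r" "of_real r + conjugate y = 0"
  then have "(of_real r + conjugate y) \<bullet> 1 = 0" by simp
  then show False using \<open>y \<bullet> 1 > - r\<close> by (simp add: inner_add_left of_real_def)
qed

lemma taylor_kernel_has_derivative:
  fixes y :: "'a::hypercomplex"
  assumes "d > 0" and y: "y \<bullet> 1 > - r"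
  shows "(taylor_kernel d k r has_derivative taylor_kernel' d k r y) (at y)"
proof -
  have 1: "((\<lambda>y. smooth_cauchy d (of_real r - y)) has_derivative (\<lambda>h. smooth_cauchy' d (of_real r - y) (- h))) (at y)"
    by (rule has_derivative_compose[where f="\<lambda>y. of_real r - y", OF _ smooth_cauchy_has_derivative[OF assms(1)]])
      (auto intro!: derivative_eq_intros)
  have lin: "smooth_cauchy' d \<nu> (- h) = - smooth_cauchy' d \<nu> h" for \<nu> h :: 'a
    using smooth_cauchy_has_derivative[OF assms(1), of \<nu>] by (simp add: has_derivative_linear linear_neg)
  have c: "((\<lambda>y. of_real r + conjugate y) has_derivative conjugate) (at y)"
    using has_derivative_add[OF has_derivative_const bounded_linear_imp_has_derivative[OF linear_conjugate]] by simp
  have 2: "((\<lambda>y. cauchy_deriv j (of_real r + conjugate y)) has_derivative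
      (\<lambda>h. cauchy_deriv' j (of_real r + conjugate y) (conjugate h))) (at y)" for j
    by (rule has_derivative_compose[OF c cauchy_deriv_has_derivative[OF reflected_nonzero[OF y]]])
  have 3: "((\<lambda>y::'a. (-2 * (y \<bullet> 1)) ^ j / fact j) has_derivative
      (\<lambda>h. real j * (-2 * (h \<bullet> 1)) * (-2 * (y \<bullet> 1)) ^ (j - 1) / fact j)) (at y)" for j
  proof -
    have "((\<lambda>y::'a. -2 * (y \<bullet> 1)) has_derivative (\<lambda>h. -2 * (h \<bullet> 1))) (at y)"
      by (auto intro!: derivative_eq_intros)
    from has_derivative_mult_left[OF has_derivative_power[OF this, of j], where y="inverse (fact j :: real)"]
    show ?thesis unfolding divide_inverse .
  qed
  show ?thesis
    unfolding taylor_kernel_def[abs_def] taylor_kernel'_def[abs_def]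
    by (intro has_derivative_diff has_derivative_sum has_derivative_scaleR 2 3
        has_derivative_eq_rhs[OF 1]) (simp add: lin)
qed

text \<open>
  Right regularity of the kernels leaves two contributions of each summand: one from the factor
  \<open>(-2 y\<^sub>0)\<^sup>j\<close>, one from the reflection, where \<open>conjugate e = 2 (e \<bullet> 1) - e\<close>. The former cancels the latter of the
  preceding summand, and only the last one remains.
\<close>
lemma taylor_kernel_right_derivative:
  fixes y :: "'a::hypercomplex"
  assumes "d > 0" and y: "y \<bullet> 1 > - r"
  shows "(\<Sum>e\<in>Basis. taylor_kernel' d (Suc i) r y e * e) =
    - of_real (bump TYPE('a) d ((of_real r - y) \<bullet> (of_real r - y))) - half_space_kernel i r y"
proof -
  let ?\<nu> = "of_real r + conjugate y" and ?z = "-2 * (y \<bullet> 1)"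
  have nz: "?\<nu> \<noteq> 0" by (rule reflected_nonzero[OF y])
  have one: "(\<Sum>e\<in>Basis. (e \<bullet> 1) *\<^sub>R e) = (1::'a)"
    using euclidean_representation[of "1::'a"] by (simp add: inner_commute)
  have cd: "(\<Sum>e\<in>Basis. cauchy_deriv' j ?\<nu> (conjugate e) * e) = 2 *\<^sub>R cauchy_deriv (Suc j) ?\<nu>" for j
  proof -
    have L: "linear (cauchy_deriv' j ?\<nu>)" by (rule has_derivative_linear[OF cauchy_deriv_has_derivative[OF nz]])
    have "cauchy_deriv' j ?\<nu> (conjugate e) = (2 * (e \<bullet> 1)) *\<^sub>R cauchy_deriv (Suc j) ?\<nu> - cauchy_deriv' j ?\<nu> e" for e
      unfolding conjugate_eq[of e] linear_diff[OF L] linear_cmul[OF L] cauchy_deriv'_one ..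
    then have "cauchy_deriv' j ?\<nu> (conjugate e) * e = (2 *\<^sub>R cauchy_deriv (Suc j) ?\<nu>) * ((e \<bullet> 1) *\<^sub>R e) - cauchy_deriv' j ?\<nu> e * e" for e
      by (simp add: left_diff_distrib mult.commute[of "e \<bullet> 1"])
    then have "(\<Sum>e\<in>Basis. cauchy_deriv' j ?\<nu> (conjugate e) * e) =
        (2 *\<^sub>R cauchy_deriv (Suc j) ?\<nu>) * (\<Sum>e\<in>Basis. (e \<bullet> 1) *\<^sub>R e) - (\<Sum>e\<in>Basis. cauchy_deriv' j ?\<nu> e * e)"
      by (simp only: sum_subtractf sum_distrib_left)
    then show ?thesis by (simp add: one cauchy_deriv_right_regular[OF nz])
  qed
  let ?t = "\<lambda>j h. (?z ^ j / fact j) *\<^sub>R cauchy_deriv' j ?\<nu> (conjugate h) +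
        (real j * (-2 * (h \<bullet> 1)) * ?z ^ (j - 1) / fact j) *\<^sub>R cauchy_deriv j ?\<nu>"
  have t: "(\<Sum>e\<in>Basis. ?t j e * e) = half_space_kernel j r y - (if j = 0 then 0 else half_space_kernel (j - 1) r y)" for j
  proof -
    have "(\<Sum>e\<in>Basis. ?t j e * e) = (\<Sum>e\<in>Basis. (?z ^ j / fact j) *\<^sub>R (cauchy_deriv' j ?\<nu> (conjugate e) * e) +
        (real j * (-2) * ?z ^ (j - 1) / fact j) *\<^sub>R (cauchy_deriv j ?\<nu> * ((e \<bullet> 1) *\<^sub>R e)))"
      by (intro sum.cong refl) (simp add: distrib_right left_diff_distrib mult_ac)
    also have "\<dots> = (?z ^ j / fact j) *\<^sub>R (\<Sum>e\<in>Basis. cauchy_deriv' j ?\<nu> (conjugate e) * e) +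
        (real j * (-2) * ?z ^ (j - 1) / fact j) *\<^sub>R (cauchy_deriv j ?\<nu> * (\<Sum>e\<in>Basis. (e \<bullet> 1) *\<^sub>R e))"
      by (simp only: sum.distrib scaleR_sum_right sum_distrib_left)
    also have "\<dots> = half_space_kernel j r y + (real j * (-2) * ?z ^ (j - 1) / fact j) *\<^sub>R cauchy_deriv j ?\<nu>"
      by (simp add: one cd half_space_kernel_def mult_ac)
    also have "(real j * (-2) * ?z ^ (j - 1) / fact j) *\<^sub>R cauchy_deriv j ?\<nu> = - (if j = 0 then 0 else half_space_kernel (j - 1) r y)"
    proof (cases j)
      case (Suc l)
      have "real j * (-2) * ?z ^ (j - 1) / fact j = - (2 * ?z ^ l / fact l)"
        unfolding Suc by (simp add: divide_simps del: of_nat_Suc)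
      then show ?thesis by (simp add: Suc half_space_kernel_def)
    qed simp
    finally show ?thesis by simp
  qed
  have tel: "(\<Sum>j<Suc i. half_space_kernel j r y - (if j = 0 then 0 else half_space_kernel (j - 1) r y)) = half_space_kernel i r y"
    by (induction i) auto
  have "(\<Sum>e\<in>Basis. taylor_kernel' d (Suc i) r y e * e) =
      (\<Sum>e\<in>Basis. - (smooth_cauchy' d (of_real r - y) e * e) - (\<Sum>j<Suc i. ?t j e * e))"
    by (simp only: taylor_kernel'_def left_diff_distrib mult_minus_left sum_distrib_right)
  also have "\<dots> = - (\<Sum>e\<in>Basis. smooth_cauchy' d (of_real r - y) e * e) - (\<Sum>j<Suc i. \<Sum>e\<in>Basis. ?t j e * e)"
    by (simp only: sum_subtractf sum_negf sum.swap[of _ _ "{..<Suc i}"])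
  also have "\<dots> = - of_real (bump TYPE('a) d ((of_real r - y) \<bullet> (of_real r - y))) - half_space_kernel i r y"
    by (simp only: t tel smooth_cauchy_right_derivative[OF assms(1)] mult_1_right)
  finally show ?thesis .
qed

lemma taylor_kernel_boundary:
  fixes y :: "'a::hypercomplex"
  assumes "d > 0" "d \<le> r\<^sup>2" "y \<bullet> 1 = 0"
  shows "taylor_kernel d (Suc i) r y = 0"
proof -
  have "(of_real r - y) \<bullet> (of_real r - y) = r\<^sup>2 + y \<bullet> y"
    using assms(3) by (simp add: inner_diff_left inner_diff_right of_real_def inner_commute power2_eq_square)
  then have "smooth_cauchy d (of_real r - y) = cauchy_deriv 0 (of_real r - y)"
    using assms inner_ge_zero[of y] by (intro smooth_cauchy_far) linarith+
  moreover have "conjugate y = - y" using assms(3) by (simp add: conjugate_eq)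
  moreover have "(\<Sum>j<Suc i. ((-2 * (y \<bullet> 1)) ^ j / fact j) *\<^sub>R cauchy_deriv j (of_real r + conjugate y)) =
      cauchy_deriv 0 (of_real r + conjugate y)"
    unfolding sum.lessThan_Suc_shift assms(3) by simp
  ultimately show ?thesis by (simp add: taylor_kernel_def)
qed

lemma reflected_lower_bound:
  fixes y :: "'a::hypercomplex"
  assumes "r > 0" "y \<bullet> 1 \<ge> 0"
  shows "min 1 r / 2 * (1 + norm y) \<le> norm (of_real r + conjugate y)"
proof (rule power2_le_imp_le)
  have "(norm (of_real r + conjugate y))\<^sup>2 = r\<^sup>2 + 2 * r * (y \<bullet> 1) + (norm y)\<^sup>2"
  proof -
    have "(of_real r :: 'a) \<bullet> conjugate y = r * (y \<bullet> 1)"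
      by (simp add: of_real_def inner_commute[of 1])
    then show ?thesis using dot_norm[of "of_real r" "conjugate y"] by (simp add: field_simps)
  qed
  then have "(norm (of_real r + conjugate y))\<^sup>2 \<ge> r\<^sup>2 + (norm y)\<^sup>2" using assms by simp
  moreover have "(min 1 r / 2 * (1 + norm y))\<^sup>2 \<le> r\<^sup>2 + (norm y)\<^sup>2"
  proof -
    have "min 1 r * (1 + norm y) \<le> r + norm y"
      using assms by (simp add: distrib_left min_def mult_right_mono mult_left_le_one_le)
    then have "(min 1 r * (1 + norm y))\<^sup>2 \<le> (r + norm y)\<^sup>2"
      using assms by (intro power_mono) auto
    also have "\<dots> \<le> 2 * (r\<^sup>2 + (norm y)\<^sup>2)"
      using sum_squares_bound[of r "norm y"] by (simp add: power2_sum)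
    also have "\<dots> \<le> 4 * (r\<^sup>2 + (norm y)\<^sup>2)" by simp
    finally have "(min 1 r * (1 + norm y))\<^sup>2 \<le> 4 * (r\<^sup>2 + (norm y)\<^sup>2)" .
    then show ?thesis by (simp add: power_mult_distrib power_divide)
  qed
  ultimately show "(min 1 r / 2 * (1 + norm y))\<^sup>2 \<le> (norm (of_real r + conjugate y))\<^sup>2" by linarith
qed simp

lemma cauchy_deriv_reflected_bound:
  assumes "r > 0"
  obtains C where "C \<ge> 0"
    "\<And>y::'a::hypercomplex. y \<bullet> 1 \<ge> 0 \<Longrightarrow> norm (cauchy_deriv j (of_real r + conjugate y)) \<le> C * decay y ^ (DIM('a) - 1 + j)"
proof -
  let ?q = "DIM('a) - 1 + j" and ?\<kappa> = "min 1 r / 2"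
  obtain C where C: "C \<ge> 0" "\<And>\<nu>::'a. \<nu> \<noteq> 0 \<Longrightarrow> norm (cauchy_deriv j \<nu>) \<le> C * inverse (norm \<nu>) ^ ?q"
    using cauchy_deriv_bound by blast
  have \<kappa>: "?\<kappa> > 0" using assms by simp
  have "norm (cauchy_deriv j (of_real r + conjugate y)) \<le> (C * inverse ?\<kappa> ^ ?q) * decay y ^ ?q" if y: "y \<bullet> 1 \<ge> 0" for y :: 'a
  proof -
    have nz: "of_real r + conjugate y \<noteq> 0" using y assms by (intro reflected_nonzero) auto
    have pos: "0 < ?\<kappa> * (1 + norm y)" using \<kappa> by (intro mult_pos_pos) (auto simp: add_pos_nonneg)
    have "inverse (norm (of_real r + conjugate y)) \<le> inverse (?\<kappa> * (1 + norm y))"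
      by (rule le_imp_inverse_le[OF reflected_lower_bound[OF assms y] pos])
    then have "inverse (norm (of_real r + conjugate y)) ^ ?q \<le> (inverse ?\<kappa> * decay y) ^ ?q"
      unfolding inverse_mult_distrib[of ?\<kappa>] by (rule power_mono) simp
    then have "C * inverse (norm (of_real r + conjugate y)) ^ ?q \<le> C * (inverse ?\<kappa> * decay y) ^ ?q"
      using C(1) by (rule mult_left_mono)
    with C(2)[OF nz] show ?thesis by (simp only: power_mult_distrib mult.assoc)
  qed
  moreover have "C * inverse ?\<kappa> ^ ?q \<ge> 0" using C(1) \<kappa> by simp
  ultimately show ?thesis using that by blast
qed

text \<open>
  A power of \<open>y\<^sub>0\<close> costs one order of decay, and each further derivative wins it back.
\<close>
lemma weighted_cauchy_deriv_bound:
  assumes "r > 0"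
  obtains C where "C \<ge> 0"
    "\<And>y::'a::hypercomplex. y \<bullet> 1 \<ge> 0 \<Longrightarrow>
      \<bar>y \<bullet> 1\<bar> ^ l * norm (cauchy_deriv (l + j) (of_real r + conjugate y)) \<le> C * decay y ^ (DIM('a) - 1 + j)"
proof -
  obtain C where C: "C \<ge> 0"
    "\<And>y::'a. y \<bullet> 1 \<ge> 0 \<Longrightarrow> norm (cauchy_deriv (l + j) (of_real r + conjugate y)) \<le> C * decay y ^ (DIM('a) - 1 + (l + j))"
    using cauchy_deriv_reflected_bound[OF assms] by blast
  have "\<bar>y \<bullet> 1\<bar> ^ l * norm (cauchy_deriv (l + j) (of_real r + conjugate y)) \<le> C * decay y ^ (DIM('a) - 1 + j)"
    if y: "y \<bullet> 1 \<ge> 0" for y :: 'a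
  proof -
    have "\<bar>y \<bullet> 1\<bar> \<le> norm y * norm (1::'a)" by (rule Cauchy_Schwarz_ineq2)
    then have "\<bar>y \<bullet> 1\<bar> ^ l \<le> (1 + norm y) ^ l" by (intro power_mono) auto
    then have "\<bar>y \<bullet> 1\<bar> ^ l * norm (cauchy_deriv (l + j) (of_real r + conjugate y)) \<le>
        (1 + norm y) ^ l * (C * decay y ^ (DIM('a) - 1 + (l + j)))"
      using C(2)[OF y] by (intro mult_mono) auto
    also have "decay y ^ (DIM('a) - 1 + (l + j)) = decay y ^ l * decay y ^ (DIM('a) - 1 + j)"
      unfolding power_add[symmetric] using DIM_positive[where 'a='a]
      by (intro arg_cong[where f="\<lambda>k. decay y ^ k"]) linarith
    also have "(1 + norm y) ^ l * (C * (decay y ^ l * decay y ^ (DIM('a) - 1 + j))) =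
        ((1 + norm y) * decay y) ^ l * (C * decay y ^ (DIM('a) - 1 + j))"
      by (simp only: power_mult_distrib mult_ac)
    also have "(1 + norm y) * decay y = 1" using norm_ge_zero[of y] by (intro right_inverse) linarith
    finally show ?thesis by simp
  qed
  then show ?thesis using C(1) that by blast
qed

section \<open>A reproducing formula on the half-space\<close>

lemma continuous_on_smooth_cauchy': "d > 0 \<Longrightarrow> continuous_on UNIV (\<lambda>\<nu>. smooth_cauchy' d \<nu> (h::'a::hypercomplex))"
  unfolding smooth_cauchy'_def
  by (intro continuous_intros continuous_on_compose2[OF continuous_on_smooth_inverse])
    (auto simp: max_def)

lemma continuous_on_reflected:
  assumes "continuous_on (- {0}) f"
  shows "continuous_on {y. y \<bullet> 1 > - r} (\<lambda>y::'a::hypercomplex. f (of_real r + conjugate y))"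
  by (rule continuous_on_compose2[OF assms])
    (auto intro!: continuous_intros dest: reflected_nonzero)

lemma continuous_on_taylor_kernel':
  "d > 0 \<Longrightarrow> continuous_on {y. y \<bullet> 1 > - r} (\<lambda>y::'a::hypercomplex. taylor_kernel' d k r y h)"
  unfolding taylor_kernel'_def
  by (intro continuous_intros continuous_on_reflected[OF continuous_on_cauchy_deriv] continuous_on_reflected[OF continuous_on_cauchy_deriv']
      continuous_on_compose2[OF continuous_on_smooth_cauchy']) auto

lemma continuous_on_taylor_kernel: "d > 0 \<Longrightarrow> continuous_on {y. y \<bullet> 1 > - r} (taylor_kernel d k r :: 'a::hypercomplex \<Rightarrow> 'a)"
  by (rule has_derivative_continuous_on) (use taylor_kernel_has_derivative has_derivative_at_withinI in blast)

lemma continuous_on_half_space_kernel: "continuous_on {y. y \<bullet> 1 > - r} (half_space_kernel i r :: 'a::hypercomplex \<Rightarrow> 'a)"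
  unfolding half_space_kernel_def
  by (intro continuous_intros continuous_on_reflected[OF continuous_on_cauchy_deriv]) auto

lemma half_space_kernel_bound:
  assumes "r > 0"
  obtains C where "C \<ge> 0" "\<And>y::'a::hypercomplex. y \<bullet> 1 \<ge> 0 \<Longrightarrow> norm (half_space_kernel i r y) \<le> C * decay y ^ DIM('a)"
proof -
  obtain C where C: "C \<ge> 0"
    "\<And>y::'a. y \<bullet> 1 \<ge> 0 \<Longrightarrow> \<bar>y \<bullet> 1\<bar> ^ i * norm (cauchy_deriv (i + 1) (of_real r + conjugate y)) \<le> C * decay y ^ (DIM('a) - 1 + 1)"
    using weighted_cauchy_deriv_bound[OF assms] by blast
  have "norm (half_space_kernel i r y) \<le> (2 * 2 ^ i / fact i * C) * decay y ^ DIM('a)" if "y \<bullet> 1 \<ge> 0" for y :: 'a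
  proof -
    have "norm (half_space_kernel i r y) = 2 * 2 ^ i / fact i * (\<bar>y \<bullet> 1\<bar> ^ i * norm (cauchy_deriv (i + 1) (of_real r + conjugate y)))"
      by (simp add: half_space_kernel_def abs_mult power_abs power_mult_distrib)
    also have "\<dots> \<le> 2 * 2 ^ i / fact i * (C * decay y ^ (DIM('a) - 1 + 1))"
      by (intro mult_left_mono C(2) that) auto
    finally show ?thesis using DIM_positive[where 'a='a] by (simp add: mult_ac)
  qed
  moreover have "2 * 2 ^ i / fact i * C \<ge> 0" using C(1) by simp
  ultimately show ?thesis using that by blast
qed

lemma taylor_part_bound:
  assumes "r > 0"
  shows "\<exists>C\<ge>0. \<forall>y::'a::hypercomplex. y \<bullet> 1 \<ge> 0 \<longrightarrow>
    norm (\<Sum>j<k. ((-2 * (y \<bullet> 1)) ^ j / fact j) *\<^sub>R cauchy_deriv j (of_real r + conjugate y)) \<le> C * decay y ^ (DIM('a) - 1)"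
proof (induction k)
  case 0
  show ?case by (intro exI[of _ 0]) simp
next
  case (Suc k)
  let ?t = "\<lambda>j y::'a. ((-2 * (y \<bullet> 1)) ^ j / fact j) *\<^sub>R cauchy_deriv j (of_real r + conjugate y)"
  obtain C where C: "C \<ge> 0" "\<And>y::'a. y \<bullet> 1 \<ge> 0 \<Longrightarrow> norm (\<Sum>j<k. ?t j y) \<le> C * decay y ^ (DIM('a) - 1)"
    using Suc.IH by blast
  obtain D where D: "D \<ge> 0"
    "\<And>y::'a. y \<bullet> 1 \<ge> 0 \<Longrightarrow> \<bar>y \<bullet> 1\<bar> ^ k * norm (cauchy_deriv (k + 0) (of_real r + conjugate y)) \<le> D * decay y ^ (DIM('a) - 1 + 0)"
    using weighted_cauchy_deriv_bound[OF assms] by blast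
  have "norm (\<Sum>j<Suc k. ?t j y) \<le> (C + 2 ^ k / fact k * D) * decay y ^ (DIM('a) - 1)" if "y \<bullet> 1 \<ge> 0" for y :: 'a
  proof -
    have "norm (?t k y) = 2 ^ k / fact k * (\<bar>y \<bullet> 1\<bar> ^ k * norm (cauchy_deriv (k + 0) (of_real r + conjugate y)))"
      by (simp add: abs_mult power_abs power_mult_distrib)
    also have "\<dots> \<le> 2 ^ k / fact k * (D * decay y ^ (DIM('a) - 1 + 0))"
      by (intro mult_left_mono D(2) that) auto
    finally have "norm (?t k y) \<le> 2 ^ k / fact k * D * decay y ^ (DIM('a) - 1)" by (simp add: mult_ac)
    moreover have "norm (\<Sum>j<Suc k. ?t j y) \<le> norm (\<Sum>j<k. ?t j y) + norm (?t k y)"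
      unfolding sum.lessThan_Suc by (rule norm_triangle_ineq)
    ultimately show ?thesis using C(2)[OF that] by (simp add: distrib_right)
  qed
  moreover have "C + 2 ^ k / fact k * D \<ge> 0" using C(1) D(1) by simp
  ultimately show ?case by blast
qed

lemma smooth_cauchy_bound:
  assumes "r > 0" "d > 0"
  obtains C where "C \<ge> 0" "\<And>y::'a::hypercomplex. norm (smooth_cauchy d (of_real r - y)) \<le> C * decay y ^ (DIM('a) - 1)"
proof -
  let ?q = "DIM('a) - 1"
  obtain C where C: "C \<ge> 0" "\<And>\<nu>::'a. \<nu> \<noteq> 0 \<Longrightarrow> norm (cauchy_deriv 0 \<nu>) \<le> C * inverse (norm \<nu>) ^ (?q + 0)"
    using cauchy_deriv_bound by blast
  show ?thesis
  proof (rule decay_bound_of_eventual)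
    have "continuous_on UNIV (smooth_cauchy d :: 'a \<Rightarrow> 'a)"
      by (rule has_derivative_continuous_on) (use smooth_cauchy_has_derivative[OF assms(2)] has_derivative_at_withinI in blast)
    then show "continuous_on UNIV (\<lambda>y::'a. smooth_cauchy d (of_real r - y))"
      by (rule continuous_on_compose2) (auto intro!: continuous_intros)
    show "norm (smooth_cauchy d (of_real r - y)) \<le> (C * 4 ^ ?q) * decay y ^ ?q" if "norm y > 2 * r + sqrt d + 1" for y :: 'a
    proof -
      have sd: "sqrt d > 0" using assms by simp
      have "norm y - norm (of_real r :: 'a) \<le> norm (of_real r - y)"
        by (metis norm_minus_commute norm_triangle_ineq2)
      then have n: "norm (of_real r - y) \<ge> norm y - r" using assms by simp
      have "sqrt d \<le> norm (of_real r - y)" using n that assms by linarith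
      then have "(sqrt d)\<^sup>2 \<le> (norm (of_real r - y))\<^sup>2" using sd by (intro power_mono) auto
      then have "d \<le> (of_real r - y) \<bullet> (of_real r - y)"
        unfolding power2_norm_eq_inner using assms by simp
      then have far: "smooth_cauchy d (of_real r - y) = cauchy_deriv 0 (of_real r - y)" by (rule smooth_cauchy_far[OF assms(2)])
      have nz: "of_real r - y \<noteq> 0" using \<open>sqrt d \<le> norm (of_real r - y)\<close> sd by auto
      have "1 + norm y \<le> 4 * (norm y - r)" using that assms(1) sd by argo
      then have "(1 + norm y) / 4 \<le> norm y - r" by (simp add: field_simps)
      then have "(1 + norm y) / 4 \<le> norm (of_real r - y)" using n by (rule order_trans)
      then have "inverse (norm (of_real r - y)) \<le> inverse ((1 + norm y) / 4)"
        by (rule le_imp_inverse_le) (simp add: add_pos_nonneg)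
      then have "inverse (norm (of_real r - y)) ^ ?q \<le> inverse ((1 + norm y) / 4) ^ ?q"
        by (rule power_mono) simp
      moreover have "inverse ((1 + norm y) / 4) = 4 * decay y"
        unfolding inverse_divide by (rule divide_inverse)
      ultimately have "inverse (norm (of_real r - y)) ^ ?q \<le> 4 ^ ?q * decay y ^ ?q"
        by (simp only: power_mult_distrib)
      then have "C * inverse (norm (of_real r - y)) ^ ?q \<le> C * (4 ^ ?q * decay y ^ ?q)"
        using C(1) by (rule mult_left_mono)
      then show ?thesis using C(2)[OF nz] by (simp add: far mult.assoc)
    qed
  qed (use that in blast)
qed

lemma taylor_kernel_bound:
  assumes "r > 0" "d > 0"
  obtains C where "C \<ge> 0" "\<And>y::'a::hypercomplex. y \<bullet> 1 \<ge> 0 \<Longrightarrow> norm (taylor_kernel d k r y) \<le> C * decay y ^ (DIM('a) - 1)"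
proof -
  obtain C where C: "C \<ge> 0" "\<And>y::'a. norm (smooth_cauchy d (of_real r - y)) \<le> C * decay y ^ (DIM('a) - 1)"
    using smooth_cauchy_bound[OF assms] by blast
  obtain D where D: "D \<ge> 0" "\<And>y::'a. y \<bullet> 1 \<ge> 0 \<Longrightarrow>
      norm (\<Sum>j<k. ((-2 * (y \<bullet> 1)) ^ j / fact j) *\<^sub>R cauchy_deriv j (of_real r + conjugate y)) \<le> D * decay y ^ (DIM('a) - 1)"
    using taylor_part_bound[OF assms(1)] by blast
  have "norm (taylor_kernel d k r y) \<le> (C + D) * decay y ^ (DIM('a) - 1)" if "y \<bullet> 1 \<ge> 0" for y :: 'a
    unfolding taylor_kernel_def distrib_right
    by (rule order_trans[OF norm_triangle_ineq4]) (intro add_mono C(2) D(2) that)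
  then show ?thesis using that[of "C + D"] C(1) D(1) by simp
qed

lemma bump_bound:
  assumes "r > 0" "d > 0"
  obtains C where "C \<ge> 0"
    "\<And>y::'a::hypercomplex. bump TYPE('a) d ((of_real r - y) \<bullet> (of_real r - y)) \<le> C * decay y ^ DIM('a)"
proof -
  let ?f = "\<lambda>y::'a. bump TYPE('a) d ((of_real r - y) \<bullet> (of_real r - y))"
  obtain C where C: "C \<ge> 0" "\<And>y. norm (?f y) \<le> C * decay y ^ DIM('a)"
  proof (rule decay_bound_of_eventual)
    show "continuous_on UNIV ?f"
      by (intro continuous_on_compose2[OF continuous_on_bump[OF assms(2)]] continuous_intros) auto
    show "norm (?f y) \<le> 0 * decay y ^ DIM('a)" if "norm y > r + sqrt d" for y
    proof -
      have "norm y - norm (of_real r :: 'a) \<le> norm (of_real r - y)"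
        by (metis norm_minus_commute norm_triangle_ineq2)
      then have "sqrt d \<le> norm (of_real r - y)" using that assms by simp
      then have "(sqrt d)\<^sup>2 \<le> (norm (of_real r - y))\<^sup>2" using assms by (intro power_mono) auto
      then have "d \<le> (of_real r - y) \<bullet> (of_real r - y)"
        unfolding power2_norm_eq_inner using assms by simp
      then show ?thesis using bump_far[OF assms(2)] by simp
    qed
  qed blast
  have "?f y \<le> C * decay y ^ DIM('a)" for y
    using C(2)[of y] by simp
  then show ?thesis using C(1) that by blast
qed

text \<open>
  The weight \<open>decay y ^ DIM('a)\<close> is square integrable, so its product with the square integrable \<open>G\<close> is
  integrable.
\<close>
lemma integrable_decay_times:
  fixes f G :: "'a::hypercomplex \<Rightarrow> 'a"
  assumes "continuous_on {y. y \<bullet> 1 > 0} f" and contG: "continuous_on {y. y \<bullet> 1 > 0} G"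
    and L2: "(\<integral>\<^sup>+y. indicator {y. y \<bullet> 1 > 0} y * ennreal ((norm (G y))\<^sup>2) \<partial>lborel) < \<infinity>"
    and f: "\<And>y. y \<bullet> 1 > 0 \<Longrightarrow> norm (f y) \<le> C * decay y ^ DIM('a)"
  shows "integrable lborel (\<lambda>y. indicator {y. y \<bullet> 1 > 0} y *\<^sub>R (f y * G y))"
    and "integrable lborel (\<lambda>y. indicator {y. y \<bullet> 1 > 0} y * (decay y ^ DIM('a) * norm (G y)))"
proof -
  have op: "{y::'a. y \<bullet> 1 > 0} \<in> sets borel"
    by (intro borel_open) (simp add: open_halfspace_component_gt)
  have [measurable]: "(\<lambda>y. indicator {y. y \<bullet> 1 > 0} y *\<^sub>R G y) \<in> borel_measurable borel"
    by (rule borel_measurable_continuous_on_indicator[OF op contG])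
  have "(\<lambda>y. norm (indicator {y. y \<bullet> 1 > 0} y *\<^sub>R G y)) \<in> borel_measurable borel" by measurable
  moreover have "(\<lambda>y. norm (indicator {y. y \<bullet> 1 > 0} y *\<^sub>R G y)) = (\<lambda>y. indicator {y. y \<bullet> 1 > 0} y * norm (G y))"
    by (auto simp: indicator_def)
  ultimately have m [measurable]: "(\<lambda>y. indicator {y. y \<bullet> 1 > 0} y * norm (G y)) \<in> borel_measurable borel" by simp
  have L2': "integrable lborel (\<lambda>y. (indicator {y. y \<bullet> 1 > 0} y * norm (G y))\<^sup>2)"
  proof (rule integrableI_nonneg)
    have "(\<integral>\<^sup>+y. ennreal ((indicator {y. y \<bullet> 1 > 0} y * norm (G y))\<^sup>2) \<partial>lborel) =
        (\<integral>\<^sup>+y. indicator {y. y \<bullet> 1 > 0} y * ennreal ((norm (G y))\<^sup>2) \<partial>lborel)"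
      by (intro nn_integral_cong) (auto simp: indicator_def)
    then show "(\<integral>\<^sup>+y. ennreal ((indicator {y. y \<bullet> 1 > 0} y * norm (G y))\<^sup>2) \<partial>lborel) < \<infinity>"
      using L2 by simp
  qed auto
  have sum: "integrable lborel (\<lambda>y::'a. decay y ^ (2 * DIM('a)) + (indicator {y. y \<bullet> 1 > 0} y * norm (G y))\<^sup>2)"
    by (intro Bochner_Integration.integrable_add integrable_decay L2')
  show maj: "integrable lborel (\<lambda>y. indicator {y. y \<bullet> 1 > 0} y * (decay y ^ DIM('a) * norm (G y)))"
  proof (rule Bochner_Integration.integrable_bound[OF sum])
    have "(\<lambda>y::'a. decay y ^ DIM('a) * (indicator {y. y \<bullet> 1 > 0} y * norm (G y))) \<in> borel_measurable lborel" by measurable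
    then show "(\<lambda>y. indicator {y. y \<bullet> 1 > 0} y * (decay y ^ DIM('a) * norm (G y))) \<in> borel_measurable lborel"
      by (simp only: mult_ac)
    have "\<bar>a * b\<bar> \<le> \<bar>a\<^sup>2 + b\<^sup>2\<bar>" if "a \<ge> 0" "b \<ge> 0" for a b :: real
    proof -
      have "2 * (a * b) \<le> a\<^sup>2 + b\<^sup>2" using sum_squares_bound[of a b] by (simp add: mult.assoc)
      moreover have "0 \<le> a * b" using that by simp
      ultimately show ?thesis by linarith
    qed
    from this[of "decay _ ^ DIM('a)" "indicator {y. y \<bullet> 1 > 0} _ * norm (G _)"]
    show "AE y in lborel. norm (indicator {y. y \<bullet> 1 > 0} y * (decay y ^ DIM('a) * norm (G y)))
        \<le> norm (decay y ^ (2 * DIM('a)) + (indicator {y. y \<bullet> 1 > 0} y * norm (G y))\<^sup>2)"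
      by (intro AE_I2) (simp add: power_mult[symmetric] mult.commute mult.left_commute)
  qed
  show "integrable lborel (\<lambda>y. indicator {y. y \<bullet> 1 > 0} y *\<^sub>R (f y * G y))"
  proof (rule Bochner_Integration.integrable_bound[OF integrable_mult_right[OF maj, of C]])
    show "(\<lambda>y. indicator {y. y \<bullet> 1 > 0} y *\<^sub>R (f y * G y)) \<in> borel_measurable lborel"
      using borel_measurable_continuous_on_indicator[OF op continuous_on_mult[OF assms(1) contG]] by simp
    have "norm (f y * G y) \<le> \<bar>C * (decay y ^ DIM('a) * norm (G y))\<bar>" if "y \<bullet> 1 > 0" for y
    proof -
      have "norm (f y * G y) \<le> (C * decay y ^ DIM('a)) * norm (G y)"
        unfolding norm_mult by (intro mult_right_mono f that) simp
      then show ?thesis by (simp add: mult.assoc)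
    qed
    then show "AE y in lborel. norm (indicator {y. y \<bullet> 1 > 0} y *\<^sub>R (f y * G y)) \<le>
        norm (C * (indicator {y. y \<bullet> 1 > 0} y * (decay y ^ DIM('a) * norm (G y))))"
      by (intro AE_I2) (simp add: indicator_def)
  qed
qed

text \<open>
  The divergence theorem for \<open>cutoff * W e G\<close>, summed over \<open>e\<close>. The derivative of the cutoff is
  bounded by a multiple of the weight \<open>decay\<close>, which makes up for the one order of decay that \<open>W\<close> lacks;
  so dominated convergence removes the cutoff.
\<close>
lemma half_space_identity:
  fixes G :: "'a::hypercomplex \<Rightarrow> 'a"
  assumes r: "r > 0" and \<epsilon>: "\<epsilon> > 0" and d: "d > 0" "d \<le> r\<^sup>2"
    and deriv: "\<And>y. y \<bullet> 1 > - \<epsilon> \<Longrightarrow> (G has_derivative blinfun_apply (G' y)) (at y)"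
    and contG': "continuous_on {y. y \<bullet> 1 > - \<epsilon>} G'"
    and reg: "\<And>y. y \<bullet> 1 > - \<epsilon> \<Longrightarrow> (\<Sum>e\<in>Basis. e * G' y e) = 0"
    and L2: "(\<integral>\<^sup>+y. indicator {y. y \<bullet> 1 > 0} y * ennreal ((norm (G y))\<^sup>2) \<partial>lborel) < \<infinity>"
  shows "(\<integral>y. indicator {y. y \<bullet> 1 > 0} y *\<^sub>R
      ((- of_real (bump TYPE('a) d ((of_real r - y) \<bullet> (of_real r - y))) - half_space_kernel i r y) * G y) \<partial>lborel) = 0"
proof -
  let ?P = "{y::'a. y \<bullet> 1 > 0}" and ?W = "taylor_kernel d (Suc i) r :: 'a \<Rightarrow> 'a" and ?W' = "taylor_kernel' d (Suc i) r :: 'a \<Rightarrow> 'a \<Rightarrow> 'a"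
  let ?m = "DIM('a)"
  define V where "V = (\<lambda>y::'a. - of_real (bump TYPE('a) d ((of_real r - y) \<bullet> (of_real r - y))) - half_space_kernel i r y)"
  define c where "c = (\<lambda>n s. - 2 * max 0 (1 - s / (real (Suc n))\<^sup>2) / (real (Suc n))\<^sup>2)"
  define \<delta> where "\<delta> = min \<epsilon> r"
  have \<delta>: "\<delta> > 0" "\<And>y::'a. y \<bullet> 1 > - \<delta> \<Longrightarrow> y \<bullet> 1 > - \<epsilon>" "\<And>y::'a. y \<bullet> 1 > - \<delta> \<Longrightarrow> y \<bullet> 1 > - r"
    using r \<epsilon> by (auto simp: \<delta>_def)
  have sub: "{y::'a. y \<bullet> 1 > - \<delta>} \<subseteq> {y. y \<bullet> 1 > - \<epsilon>}" "{y::'a. y \<bullet> 1 > - \<delta>} \<subseteq> {y. y \<bullet> 1 > - r}"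
    "?P \<subseteq> {y. y \<bullet> 1 > - \<epsilon>}" "?P \<subseteq> {y. y \<bullet> 1 > - r}"
    using \<delta>(2,3) r \<epsilon> by auto
  have contG: "continuous_on {y. y \<bullet> 1 > - \<epsilon>} G"
    by (rule has_derivative_continuous_on) (use deriv has_derivative_at_withinI in blast)
  note contW = continuous_on_taylor_kernel[OF d(1), of r "Suc i"] and contW' = continuous_on_taylor_kernel'[OF d(1), of r "Suc i"]
  define u where "u = (\<lambda>n e y. cutoff (real (Suc n)) (y \<bullet> y) *\<^sub>R (?W y * (e * G y)))"
  define u' where "u' = (\<lambda>n e y h. cutoff (real (Suc n)) (y \<bullet> y) *\<^sub>R (?W y * (e * G' y h) + ?W' y h * (e * G y)) +
     (c n (y \<bullet> y) * (2 * (y \<bullet> h))) *\<^sub>R (?W y * (e * G y)))"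
  have cutd: "((\<lambda>y::'a. cutoff (real (Suc n)) (y \<bullet> y)) has_derivative (\<lambda>h. c n (y \<bullet> y) * (2 * (y \<bullet> h)))) (at y)" for n y
  proof -
    have 2: "((\<lambda>\<nu>::'a. \<nu> \<bullet> \<nu>) has_derivative (\<lambda>h. 2 * (y \<bullet> h))) (at y)"
      by (auto intro!: derivative_eq_intros simp: inner_commute fun_eq_iff)
    show ?thesis
      unfolding c_def by (rule has_derivative_compose[OF 2 cutoff_derivative[unfolded has_field_derivative_def]])
  qed
  have ud: "(u n e has_derivative u' n e y) (at y)" if "y \<bullet> 1 > - \<delta>" for n e y
  proof -
    have eG: "((\<lambda>y. e * G y) has_derivative (\<lambda>h. e * G' y h)) (at y)"
      using that \<delta> by (intro has_derivative_mult_right deriv) auto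
    have "(?W has_derivative ?W' y) (at y)" using that \<delta> by (intro taylor_kernel_has_derivative d) auto
    from has_derivative_scaleR[OF cutd has_derivative_mult[OF this eG]] show ?thesis
      unfolding u_def u'_def .
  qed
  have contc: "continuous_on UNIV (\<lambda>y::'a. c n (y \<bullet> y))" for n
    unfolding c_def by (rule continuous_on_compose2[OF continuous_on_cutoff']) (auto intro!: continuous_intros)
  have contcut: "continuous_on UNIV (\<lambda>y::'a. cutoff (real (Suc n)) (y \<bullet> y))" for n
    by (rule continuous_on_compose2[OF continuous_on_cutoff]) (auto intro!: continuous_intros)
  have contu': "continuous_on {y. y \<bullet> 1 > - \<delta>} (\<lambda>y. u' n e y e)" for n e
    unfolding u'_def
    by (intro continuous_intros continuous_on_subset[OF contW sub(2)] continuous_on_subset[OF contW' sub(2)]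
      continuous_on_subset[OF contG sub(1)] continuous_on_subset[OF contG' sub(1)]
      continuous_on_subset[OF contc] continuous_on_subset[OF contcut]) auto
  have suppu: "u n e y = 0" if "norm y > real (Suc n)" for n e y
  proof -
    have "(real (Suc n))\<^sup>2 \<le> (norm y)\<^sup>2" using that by (intro power_mono) auto
    then have "cutoff (real (Suc n)) (y \<bullet> y) = 0" by (intro cutoff_far) (auto simp: power2_norm_eq_inner)
    then show ?thesis by (simp add: u_def)
  qed
  have vanu: "u n e y = 0" if "y \<bullet> 1 = 0" for n e y
    using taylor_kernel_boundary[OF d that, of i] by (simp add: u_def)
  note div = half_space_divergence[OF \<delta>(1) ud contu' suppu vanu]
  have sum_u': "(\<Sum>e\<in>Basis. u' n e y e) =
      cutoff (real (Suc n)) (y \<bullet> y) *\<^sub>R (V y * G y) + (2 * c n (y \<bullet> y)) *\<^sub>R (?W y * (y * G y))" if y: "y \<bullet> 1 > 0" for n y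
  proof -
    have y': "y \<bullet> 1 > - \<epsilon>" "y \<bullet> 1 > - r" using y r \<epsilon> by auto
    have "(\<Sum>e\<in>Basis. u' n e y e) = (\<Sum>e\<in>Basis. cutoff (real (Suc n)) (y \<bullet> y) *\<^sub>R (?W y * (e * G' y e) + (?W' y e * e) * G y) +
        (2 * c n (y \<bullet> y)) *\<^sub>R (?W y * (((y \<bullet> e) *\<^sub>R e) * G y)))"
      by (intro sum.cong refl) (simp add: u'_def mult.assoc mult.left_commute[of 2])
    also have "\<dots> = cutoff (real (Suc n)) (y \<bullet> y) *\<^sub>R (?W y * (\<Sum>e\<in>Basis. e * G' y e) + (\<Sum>e\<in>Basis. ?W' y e * e) * G y) +
        (2 * c n (y \<bullet> y)) *\<^sub>R (?W y * ((\<Sum>e\<in>Basis. (y \<bullet> e) *\<^sub>R e) * G y))"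
      by (simp only: sum.distrib scaleR_sum_right[symmetric] sum_distrib_left[symmetric] sum_distrib_right[symmetric])
    also have "\<dots> = cutoff (real (Suc n)) (y \<bullet> y) *\<^sub>R (V y * G y) + (2 * c n (y \<bullet> y)) *\<^sub>R (?W y * (y * G y))"
      unfolding reg[OF y'(1)] taylor_kernel_right_derivative[OF d(1) y'(2)] euclidean_representation V_def by simp
    finally show ?thesis .
  qed
  define s where "s = (\<lambda>n y. indicator ?P y *\<^sub>R (\<Sum>e\<in>Basis. u' n e y e))"
  have s_eq: "s n = (\<lambda>y. \<Sum>e\<in>Basis. indicator ?P y *\<^sub>R u' n e y e)" for n
    by (simp add: s_def scaleR_sum_right)
  have int_s: "integrable lborel (s n)" for n
    unfolding s_eq by (rule Bochner_Integration.integrable_sum) (rule div(2))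
  have int_s_0: "integral\<^sup>L lborel (s n) = 0" for n
  proof -
    have "integral\<^sup>L lborel (s n) = (\<Sum>e\<in>Basis. \<integral>y. indicator ?P y *\<^sub>R u' n e y e \<partial>lborel)"
      unfolding s_eq by (rule Bochner_Integration.integral_sum) (rule div(2))
    also have "\<dots> = 0" by (simp only: div(1) sum.neutral_const)
    finally show ?thesis .
  qed
  obtain CV1 where CV1: "CV1 \<ge> 0" "\<And>y::'a. y \<bullet> 1 \<ge> 0 \<Longrightarrow> norm (half_space_kernel i r y) \<le> CV1 * decay y ^ ?m"
    using half_space_kernel_bound[OF r] by blast
  obtain CV2 where CV2: "CV2 \<ge> 0" "\<And>y::'a. bump TYPE('a) d ((of_real r - y) \<bullet> (of_real r - y)) \<le> CV2 * decay y ^ ?m"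
    using bump_bound[OF r d(1)] by blast
  have V_bound: "norm (V y) \<le> (CV2 + CV1) * decay y ^ ?m" if "y \<bullet> 1 > 0" for y
  proof -
    have "norm (V y) \<le> norm (- of_real (bump TYPE('a) d ((of_real r - y) \<bullet> (of_real r - y))) :: 'a) + norm (half_space_kernel i r y)"
      unfolding V_def by (rule norm_triangle_ineq4)
    also have "norm (- of_real (bump TYPE('a) d ((of_real r - y) \<bullet> (of_real r - y))) :: 'a) =
        bump TYPE('a) d ((of_real r - y) \<bullet> (of_real r - y))" by (simp add: bump_nonneg[OF d(1)])
    finally show ?thesis using CV1(2)[of y] CV2(2)[of y] that by (simp add: distrib_right)
  qed
  obtain CW where CW: "CW \<ge> 0" "\<And>y::'a. y \<bullet> 1 \<ge> 0 \<Longrightarrow> norm (?W y) \<le> CW * decay y ^ (?m - 1)"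
    using taylor_kernel_bound[OF r d(1)] by blast
  have c_bound: "\<bar>2 * c n (y \<bullet> y)\<bar> * norm y \<le> 8 * decay y" for n and y :: 'a
  proof (cases "norm y < real (Suc n)")
    case False
    then have "(real (Suc n))\<^sup>2 \<le> y \<bullet> y" unfolding power2_norm_eq_inner[symmetric] by (intro power_mono) auto
    then have "c n (y \<bullet> y) = 0" by (simp add: c_def max_def)
    then show ?thesis using decay_pos[of y] by simp
  next
    case True
    let ?N = "real (Suc n)"
    have "max 0 (1 - (y \<bullet> y) / ?N\<^sup>2) \<le> 1" by simp
    then have "\<bar>2 * c n (y \<bullet> y)\<bar> \<le> 4 / ?N\<^sup>2"
      unfolding c_def by (simp add: abs_mult divide_right_mono)
    then have "\<bar>2 * c n (y \<bullet> y)\<bar> * norm y \<le> 4 / ?N\<^sup>2 * norm y" by (rule mult_right_mono) simp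
    also have "\<dots> \<le> 8 * decay y"
    proof -
      have "norm y * (1 + norm y) \<le> ?N * (?N + ?N)" using True by (intro mult_mono) auto
      then have "4 * (norm y * (1 + norm y)) \<le> 8 * ?N\<^sup>2" by (simp add: power2_eq_square algebra_simps)
      moreover have "1 + norm y > 0" "?N\<^sup>2 > 0" by (auto simp: add_pos_nonneg)
      ultimately show ?thesis by (simp add: divide_simps)
    qed
    finally show ?thesis .
  qed
  have contV: "continuous_on ?P V"
    unfolding V_def
    by (intro continuous_intros continuous_on_subset[OF continuous_on_half_space_kernel sub(4)]
        continuous_on_compose2[OF continuous_on_bump[OF d(1)]] continuous_on_of_real) auto
  note maj = integrable_decay_times[OF contV continuous_on_subset[OF contG sub(3)] L2 V_bound]
  have "(\<lambda>n. integral\<^sup>L lborel (s n)) \<longlonglongrightarrow> (\<integral>y. indicator ?P y *\<^sub>R (V y * G y) \<partial>lborel)"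
  proof (rule integral_dominated_convergence)
    show "integrable lborel (\<lambda>y. (CV2 + CV1 + 8 * CW) * (indicator ?P y * (decay y ^ ?m * norm (G y))))"
      by (intro integrable_mult_right maj(2))
    show "AE y in lborel. (\<lambda>n. s n y) \<longlonglongrightarrow> indicator ?P y *\<^sub>R (V y * G y)"
    proof (intro AE_I2)
      fix y :: 'a
      have "(\<lambda>n. 2 * c n (y \<bullet> y)) \<longlonglongrightarrow> 2 * (- 2 * max 0 (1 - (y \<bullet> y) * 0\<^sup>2) * 0\<^sup>2)"
        unfolding c_def divide_inverse power_inverse[symmetric]
        by (intro tendsto_intros LIMSEQ_inverse_real_of_nat)
      then have "(\<lambda>n. cutoff (real (Suc n)) (y \<bullet> y) *\<^sub>R (V y * G y) + (2 * c n (y \<bullet> y)) *\<^sub>R (?W y * (y * G y))) \<longlonglongrightarrow>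
          1 *\<^sub>R (V y * G y) + 0 *\<^sub>R (?W y * (y * G y))"
        by (intro tendsto_intros cutoff_tendsto_1) simp
      then show "(\<lambda>n. s n y) \<longlonglongrightarrow> indicator ?P y *\<^sub>R (V y * G y)"
        by (cases "y \<bullet> 1 > 0") (simp_all add: s_def sum_u')
    qed
    show "AE y in lborel. norm (s n y) \<le> (CV2 + CV1 + 8 * CW) * (indicator ?P y * (decay y ^ ?m * norm (G y)))" for n
    proof (intro AE_I2)
      fix y :: 'a
      show "norm (s n y) \<le> (CV2 + CV1 + 8 * CW) * (indicator ?P y * (decay y ^ ?m * norm (G y)))"
      proof (cases "y \<bullet> 1 > 0")
        case True
        have pw: "decay y ^ ?m = decay y * decay y ^ (?m - 1)"
          using DIM_positive[where 'a='a] by (metis Suc_diff_1 power_Suc)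
        have "norm (cutoff (real (Suc n)) (y \<bullet> y) *\<^sub>R (V y * G y)) \<le> 1 * (((CV2 + CV1) * decay y ^ ?m) * norm (G y))"
          unfolding norm_scaleR norm_mult
        proof (intro mult_mono V_bound True)
          show "0 \<le> (CV2 + CV1) * decay y ^ ?m"
            using CV1(1) CV2(1) decay_pos[of y] by (intro mult_nonneg_nonneg zero_le_power) auto
          then show "0 \<le> norm (V y) * norm (G y)" by simp
        qed (auto simp: cutoff_nonneg cutoff_le_1)
        moreover have "norm ((2 * c n (y \<bullet> y)) *\<^sub>R (?W y * (y * G y))) =
            (\<bar>2 * c n (y \<bullet> y)\<bar> * norm y) * norm (?W y) * norm (G y)"
          by (simp add: norm_mult)
        moreover have "(\<bar>2 * c n (y \<bullet> y)\<bar> * norm y) * norm (?W y) * norm (G y) \<le>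
            (8 * decay y) * (CW * decay y ^ (?m - 1)) * norm (G y)"
          using True decay_pos[of y] CW(1) by (intro mult_mono c_bound CW mult_nonneg_nonneg zero_le_power) auto
        moreover have "(8 * decay y) * (CW * decay y ^ (?m - 1)) * norm (G y) = 8 * CW * decay y ^ ?m * norm (G y)"
          unfolding pw by simp
        moreover have "norm (s n y) \<le> norm (cutoff (real (Suc n)) (y \<bullet> y) *\<^sub>R (V y * G y)) +
            norm ((2 * c n (y \<bullet> y)) *\<^sub>R (?W y * (y * G y)))"
          using True by (simp add: s_def sum_u' norm_triangle_ineq del: norm_scaleR)
        ultimately have "norm (s n y) \<le> (CV2 + CV1) * decay y ^ ?m * norm (G y) + 8 * CW * decay y ^ ?m * norm (G y)"
          by linarith
        then show ?thesis using True by (simp add: distrib_right mult.assoc)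
      qed (simp add: s_def)
    qed
  qed (use int_s maj(1) in \<open>auto intro: borel_measurable_integrable\<close>)
  then have "(\<integral>y. indicator ?P y *\<^sub>R (V y * G y) \<partial>lborel) = 0"
    by (simp add: int_s_0 LIMSEQ_const_iff)
  then show ?thesis by (simp add: V_def)
qed

text \<open>
  As \<open>d \<rightarrow> 0\<close> the bumps in \<open>half_space_identity\<close> concentrate at \<open>r\<close>, while the other term does not
  depend on \<open>d\<close>.
\<close>
lemma half_space_formula:
  fixes G :: "'a::hypercomplex \<Rightarrow> 'a"
  assumes r: "r > 0" and \<epsilon>: "\<epsilon> > 0"
    and deriv: "\<And>y. y \<bullet> 1 > - \<epsilon> \<Longrightarrow> (G has_derivative blinfun_apply (G' y)) (at y)"
    and contG': "continuous_on {y. y \<bullet> 1 > - \<epsilon>} G'"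
    and reg: "\<And>y. y \<bullet> 1 > - \<epsilon> \<Longrightarrow> (\<Sum>e\<in>Basis. e * G' y e) = 0"
    and L2: "(\<integral>\<^sup>+y. indicator {y. y \<bullet> 1 > 0} y * ennreal ((norm (G y))\<^sup>2) \<partial>lborel) < \<infinity>"
  shows "G (of_real r) = - (\<integral>y. indicator {y. y \<bullet> 1 > 0} y *\<^sub>R (half_space_kernel i r y * G y) \<partial>lborel)"
    and "integrable lborel (\<lambda>y. indicator {y. y \<bullet> 1 > 0} y *\<^sub>R (half_space_kernel i r y * G y))"
proof -
  let ?P = "{y::'a. y \<bullet> 1 > 0}"
  let ?b = "\<lambda>d y::'a. bump TYPE('a) d ((of_real r - y) \<bullet> (of_real r - y))"
  define K where "K = (\<integral>y. indicator ?P y *\<^sub>R (half_space_kernel i r y * G y) \<partial>lborel)"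
  have contG: "continuous_on {y. y \<bullet> 1 > - \<epsilon>} G"
    by (rule has_derivative_continuous_on) (use deriv has_derivative_at_withinI in blast)
  have contGP: "continuous_on ?P G" by (rule continuous_on_subset[OF contG]) (use \<epsilon> in auto)
  obtain C1 where C1: "\<And>y::'a. y \<bullet> 1 \<ge> 0 \<Longrightarrow> norm (half_space_kernel i r y) \<le> C1 * decay y ^ DIM('a)"
    using half_space_kernel_bound[OF r] by blast
  have cont_rest: "continuous_on ?P (half_space_kernel i r)"
    by (rule continuous_on_subset[OF continuous_on_half_space_kernel[of r]]) (use r in auto)
  show int_rest: "integrable lborel (\<lambda>y. indicator ?P y *\<^sub>R (half_space_kernel i r y * G y))"
    by (rule integrable_decay_times(1)[OF cont_rest contGP L2, where C=C1]) (simp add: C1)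
  have int_bump: "integrable lborel (\<lambda>y. indicator ?P y *\<^sub>R (of_real (?b d y) * G y))"
    and bump_K: "(\<integral>y. indicator ?P y *\<^sub>R (of_real (?b d y) * G y) \<partial>lborel) = - K"
    if d: "d > 0" "d \<le> r\<^sup>2" for d
  proof -
    obtain C2 where C2: "\<And>y::'a. ?b d y \<le> C2 * decay y ^ DIM('a)"
      using bump_bound[OF r d(1)] by blast
    have cb: "continuous_on ?P (\<lambda>y. of_real (?b d y) :: 'a)"
      by (intro continuous_intros continuous_on_compose2[OF continuous_on_bump[OF d(1)]] continuous_on_of_real) auto
    show int_bump: "integrable lborel (\<lambda>y. indicator ?P y *\<^sub>R (of_real (?b d y) * G y))"
      by (rule integrable_decay_times(1)[OF cb contGP L2, where C=C2]) (simp add: C2 bump_nonneg[OF d(1)])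
    have "0 = (\<integral>y. indicator ?P y *\<^sub>R ((- of_real (?b d y) - half_space_kernel i r y) * G y) \<partial>lborel)"
      using half_space_identity[OF r \<epsilon> d deriv contG' reg L2] by simp
    also have "\<dots> = (\<integral>y. - (indicator ?P y *\<^sub>R (of_real (?b d y) * G y)) - indicator ?P y *\<^sub>R (half_space_kernel i r y * G y) \<partial>lborel)"
      by (intro Bochner_Integration.integral_cong refl) (simp add: left_diff_distrib scaleR_right_diff_distrib)
    also have "\<dots> = - (\<integral>y. indicator ?P y *\<^sub>R (of_real (?b d y) * G y) \<partial>lborel) - K"
      unfolding K_def
      by (subst Bochner_Integration.integral_diff) (use int_bump int_rest in auto)
    finally show "(\<integral>y. indicator ?P y *\<^sub>R (of_real (?b d y) * G y) \<partial>lborel) = - K"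
      by (simp add: algebra_simps)
  qed
  have "norm (- K - G (of_real r)) \<le> \<eta>" if "\<eta> > 0" for \<eta>
  proof -
    have rP: "(of_real r :: 'a) \<bullet> 1 > 0" using r by (simp add: of_real_def)
    have "isCont G (of_real r)"
      using deriv[of "of_real r"] rP \<epsilon> by (intro has_derivative_continuous) auto
    then obtain \<delta> where \<delta>: "\<delta> > 0" "\<And>y. norm (y - of_real r) < \<delta> \<Longrightarrow> norm (G y - G (of_real r)) < \<eta>"
      using \<open>\<eta> > 0\<close> unfolding continuous_at_eps_delta by (auto simp: dist_norm)
    \<comment> \<open>The bump lives where \<open>|r - y|\<^sup>2 < d\<close>: inside the half-space and where \<open>G\<close> is close to \<open>G(r)\<close>.\<close>
    define d where "d = (min r \<delta>)\<^sup>2"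
    have d: "d > 0" "d \<le> r\<^sup>2" using r \<delta> by (auto simp: d_def intro!: power_mono)
    have near: "norm (of_real r - y) < min r \<delta>" if "?b d y \<noteq> 0" for y
    proof -
      have "(of_real r - y) \<bullet> (of_real r - y) < d" using that bump_far[OF d(1)] by (meson not_less)
      then have "(norm (of_real r - y))\<^sup>2 < (min r \<delta>)\<^sup>2" by (simp add: d_def power2_norm_eq_inner)
      then show ?thesis by (rule power_less_imp_less_base) (use r \<delta> in auto)
    qed
    have ind: "indicator ?P y *\<^sub>R (of_real (?b d y) * G y) = ?b d y *\<^sub>R G y" for y
    proof (cases "?b d y = 0")
      case False
      have "r - y \<bullet> 1 = (of_real r - y) \<bullet> 1" by (simp add: inner_diff_left of_real_def)
      also have "\<dots> \<le> norm (of_real r - y) * norm (1::'a)" by (rule norm_cauchy_schwarz)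
      also have "\<dots> < r" using near[OF False] by simp
      finally show ?thesis by (simp add: scaleR_conv_of_real)
    qed simp
    have hb: "has_bochner_integral lborel (?b d) 1"
    proof (rule has_bochner_integral_nn_integral)
      have [measurable]: "bump TYPE('a) d \<in> borel_measurable borel"
        by (rule borel_measurable_continuous_onI[OF continuous_on_bump[OF d(1)]])
      show "?b d \<in> borel_measurable lborel" by measurable
      show "AE y in lborel. 0 \<le> ?b d y" by (simp add: bump_nonneg[OF d(1)])
      have "(\<integral>\<^sup>+y. ennreal (?b d y) \<partial>lborel) =
          (\<integral>\<^sup>+(y::'a). ennreal (bump TYPE('a) d ((y + (- of_real r)) \<bullet> (y + (- of_real r)))) \<partial>lborel)"
        by (intro nn_integral_cong) (simp add: inner_diff_left inner_diff_right algebra_simps)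
      also have "\<dots> = (\<integral>\<^sup>+(y::'a). ennreal (bump TYPE('a) d (y \<bullet> y)) \<partial>lborel)"
        by (rule nn_integral_lborel_translate) measurable
      finally show "(\<integral>\<^sup>+y. ennreal (?b d y) \<partial>lborel) = ennreal 1"
        by (simp add: nn_integral_bump[OF d(1)])
    qed simp
    have int_b: "integrable lborel (?b d)" and int_b1: "integral\<^sup>L lborel (?b d) = 1"
      using hb by (auto simp: has_bochner_integral_iff)
    have int_bG: "integrable lborel (\<lambda>y. ?b d y *\<^sub>R G y)" using int_bump[OF d] unfolding ind .
    have "- K - G (of_real r) = (\<integral>y. ?b d y *\<^sub>R G y \<partial>lborel) - (\<integral>y. ?b d y *\<^sub>R G (of_real r) \<partial>lborel)"
      using bump_K[OF d] int_b int_b1 unfolding ind by simp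
    also have "\<dots> = (\<integral>y. ?b d y *\<^sub>R G y - ?b d y *\<^sub>R G (of_real r) \<partial>lborel)"
      using int_bG int_b by (subst Bochner_Integration.integral_diff) auto
    also have "norm \<dots> \<le> (\<integral>y. \<eta> * ?b d y \<partial>lborel)"
    proof (rule order_trans[OF Bochner_Integration.integral_norm_bound integral_mono])
      show "integrable lborel (\<lambda>y. norm (?b d y *\<^sub>R G y - ?b d y *\<^sub>R G (of_real r)))"
        using int_bG int_b by (intro Bochner_Integration.integrable_norm Bochner_Integration.integrable_diff) auto
      show "integrable lborel (\<lambda>y. \<eta> * ?b d y)" using int_b by auto
      show "norm (?b d y *\<^sub>R G y - ?b d y *\<^sub>R G (of_real r)) \<le> \<eta> * ?b d y" for y
      proof (cases "?b d y = 0")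
        case False
        then have "norm (G y - G (of_real r)) < \<eta>"
          using near[OF False] by (intro \<delta>(2)) (simp add: norm_minus_commute)
        then show ?thesis
          by (simp flip: scaleR_right_diff_distrib add: mult.commute mult_right_mono bump_nonneg[OF d(1)])
      qed simp
    qed
    also have "\<dots> = \<eta>" using int_b1 by simp
    finally show ?thesis .
  qed
  then have "norm (- K - G (of_real r)) \<le> 0" by (rule field_le_epsilon) simp
  then show "G (of_real r) = - (\<integral>y. indicator ?P y *\<^sub>R (half_space_kernel i r y * G y) \<partial>lborel)"
    by (simp add: K_def)
qed

section \<open>Reproduction on the axis\<close>

lemma DIM_vec_half:
  "DIM('a::hypercomplex ^ 'n::finite) = 2 * (DIM('a) * CARD('n) div 2)" "DIM('a) * CARD('n) div 2 > 0"
proof -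
  obtain p where p: "p > 0" "DIM('a) = 2 * p" using half_DIM_cases[where 'a='a] by metis
  show "DIM('a ^ 'n) = 2 * (DIM('a) * CARD('n) div 2)" by (simp add: p)
  show "DIM('a) * CARD('n) div 2 > 0" using p by simp
qed

lemma strip_param_continuous: "continuous_on UNIV (strip_param :: ('a::hypercomplex ^ 'n::finite) \<times> 'a \<Rightarrow> _)"
  unfolding strip_param_def case_prod_beta by (intro continuous_intros)

lemma strip_param_simps [simp]: "fst (strip_param z) = fst z" "snd (strip_param z) = of_real (fst z \<bullet> fst z) + imag (snd z)"
  by (simp_all add: strip_param_def case_prod_beta)

lemma distr_strip_snd_param:
  "distr (strip :: (('a::hypercomplex ^ 'n::finite) \<times> 'a) measure) borel (\<lambda>z. snd (strip_param z)) =
    density lborel (\<lambda>y. ennreal (radial_weight (DIM('a) * CARD('n) div 2) (y \<bullet> 1)))"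
  using distr_strip_paraboloid[OF DIM_vec_half[where 'a='a and 'n='n], where 'a='a]
  by (simp add: case_prod_beta')

lemma snd_strip_param_measurable [measurable]:
  "(\<lambda>z. snd (strip_param z)) \<in> borel_measurable (strip :: (('a::hypercomplex ^ 'n::finite) \<times> 'a) measure)"
  by (subst measurable_cong_sets[OF sets_strip refl])
    (intro borel_measurable_continuous_onI continuous_intros continuous_on_compose2[OF strip_param_continuous], auto)

lemma nn_integral_strip_radial:
  assumes [measurable]: "f \<in> borel_measurable borel"
  shows "(\<integral>\<^sup>+z. f (snd (strip_param z)) \<partial>(strip :: (('a::hypercomplex ^ 'n::finite) \<times> 'a) measure)) =
    (\<integral>\<^sup>+y. ennreal (radial_weight (DIM('a) * CARD('n) div 2) (y \<bullet> 1)) * f y \<partial>lborel)"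
proof -
  have "(\<integral>\<^sup>+z. f (snd (strip_param z)) \<partial>(strip :: (('a ^ 'n) \<times> 'a) measure)) =
      (\<integral>\<^sup>+y. f y \<partial>distr (strip :: (('a ^ 'n) \<times> 'a) measure) borel (\<lambda>z. snd (strip_param z)))"
    by (rule nn_integral_distr[symmetric]) measurable
  then show ?thesis unfolding distr_strip_snd_param by (simp add: nn_integral_density)
qed

lemma integral_strip_radial:
  fixes f :: "'a::hypercomplex \<Rightarrow> 'w::euclidean_space"
  assumes [measurable]: "f \<in> borel_measurable borel"
  shows "(\<integral>z. f (snd (strip_param z)) \<partial>(strip :: (('a ^ 'n::finite) \<times> 'a) measure)) =
      (\<integral>y. radial_weight (DIM('a) * CARD('n) div 2) (y \<bullet> 1) *\<^sub>R f y \<partial>lborel)"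
    and "integrable (strip :: (('a ^ 'n) \<times> 'a) measure) (\<lambda>z. f (snd (strip_param z))) \<longleftrightarrow>
      integrable lborel (\<lambda>y. radial_weight (DIM('a) * CARD('n) div 2) (y \<bullet> 1) *\<^sub>R f y)"
proof -
  have "(\<integral>z. f (snd (strip_param z)) \<partial>(strip :: (('a ^ 'n) \<times> 'a) measure)) =
      (\<integral>y. f y \<partial>distr (strip :: (('a ^ 'n) \<times> 'a) measure) borel (\<lambda>z. snd (strip_param z)))"
    by (rule integral_distr[symmetric]) measurable
  then show "(\<integral>z. f (snd (strip_param z)) \<partial>(strip :: (('a ^ 'n::finite) \<times> 'a) measure)) =
      (\<integral>y. radial_weight (DIM('a) * CARD('n) div 2) (y \<bullet> 1) *\<^sub>R f y \<partial>lborel)"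
    unfolding distr_strip_snd_param by (simp add: integral_density)
  have "integrable (strip :: (('a ^ 'n) \<times> 'a) measure) (\<lambda>z. f (snd (strip_param z))) \<longleftrightarrow>
      integrable (distr (strip :: (('a ^ 'n) \<times> 'a) measure) borel (\<lambda>z. snd (strip_param z))) f"
    by (rule integrable_distr_eq[symmetric]) measurable
  then show "integrable (strip :: (('a ^ 'n) \<times> 'a) measure) (\<lambda>z. f (snd (strip_param z))) \<longleftrightarrow>
      integrable lborel (\<lambda>y. radial_weight (DIM('a) * CARD('n) div 2) (y \<bullet> 1) *\<^sub>R f y)"
    unfolding distr_strip_snd_param by (simp add: integrable_density)
qed

lemma integral_strip_iterated:
  fixes f :: "'v::euclidean_space \<times> 'a::hypercomplex \<Rightarrow> 'w::euclidean_space"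
  assumes "integrable strip f"
  shows "(\<integral>z. f z \<partial>strip) = (\<integral>y. indicator {0..1} (y \<bullet> 1) *\<^sub>R (\<integral>x. f (x, y) \<partial>lborel) \<partial>lborel)"
proof -
  have strip: "(strip :: ('v \<times> 'a) measure) = density lborel (\<lambda>z. ennreal (indicator {0..1} (snd z \<bullet> 1)))"
    unfolding strip_def ennreal_indicator ..
  have f [measurable]: "f \<in> borel_measurable borel"
    using borel_measurable_integrable[OF assms] by (simp cong: measurable_cong_sets)
  have ind [measurable]: "(\<lambda>z::'v \<times> 'a. indicator {0..1} (snd z \<bullet> 1) :: real) \<in> borel_measurable lborel"
    using measurable_compose[OF borel_measurable_snd_inner borel_measurable_indicator[of "{0..1}"]] by simp
  have int: "integrable (lborel \<Otimes>\<^sub>M lborel) (\<lambda>z. indicator {0..1} (snd z \<bullet> 1) *\<^sub>R f z)"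
    using assms unfolding strip lborel_prod by (subst (asm) integrable_density) auto
  have "(\<integral>z. f z \<partial>strip) = (\<integral>z. indicator {0..1} (snd z \<bullet> 1) *\<^sub>R f z \<partial>(lborel \<Otimes>\<^sub>M lborel))"
    unfolding strip lborel_prod by (subst integral_density) auto
  also have "\<dots> = (\<integral>y. \<integral>x. indicator {0..1} (y \<bullet> 1) *\<^sub>R f (x, y) \<partial>lborel \<partial>lborel)"
    using lborel_pair.integral_snd[of "\<lambda>x y. indicator {0..1} (y \<bullet> 1) *\<^sub>R f (x, y)"] int
    by (simp add: case_prod_beta')
  finally show ?thesis by simp
qed

lemma integrable_mult_of_square_integrable:
  fixes f g :: "'b \<Rightarrow> 'a::hypercomplex"
  assumes [measurable]: "f \<in> borel_measurable M" "g \<in> borel_measurable M"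
    and "(\<integral>\<^sup>+z. ennreal ((norm (f z))\<^sup>2) \<partial>M) < \<infinity>" "(\<integral>\<^sup>+z. ennreal ((norm (g z))\<^sup>2) \<partial>M) < \<infinity>"
  shows "integrable M (\<lambda>z. f z * g z)"
proof -
  have "integrable M (\<lambda>z. (norm (f z))\<^sup>2)" "integrable M (\<lambda>z. (norm (g z))\<^sup>2)"
    using assms(3,4) by (auto intro!: integrableI_nonneg)
  then have sum: "integrable M (\<lambda>z. (norm (f z))\<^sup>2 + (norm (g z))\<^sup>2)" by simp
  show ?thesis
  proof (rule Bochner_Integration.integrable_bound[OF sum])
    show "AE z in M. norm (f z * g z) \<le> norm ((norm (f z))\<^sup>2 + (norm (g z))\<^sup>2)"
    proof (intro AE_I2)
      fix z
      have "2 * (norm (f z) * norm (g z)) \<le> (norm (f z))\<^sup>2 + (norm (g z))\<^sup>2"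
        using sum_squares_bound[of "norm (f z)" "norm (g z)"] by (simp add: mult.assoc)
      moreover have "0 \<le> norm (f z) * norm (g z)" by simp
      ultimately have "norm (f z) * norm (g z) \<le> (norm (f z))\<^sup>2 + (norm (g z))\<^sup>2" by linarith
      then show "norm (f z * g z) \<le> norm ((norm (f z))\<^sup>2 + (norm (g z))\<^sup>2)" by (simp add: norm_mult)
    qed
  qed measurable
qed

text \<open>
  The kernel at the point \<open>(0, r)\<close>, as a function of the last variable of the boundary point.
\<close>
definition szego_vertex :: "nat \<Rightarrow> real \<Rightarrow> 'a::hypercomplex \<Rightarrow> 'a" where
  "szego_vertex k r y = ((- 2 / pi) ^ k) *\<^sub>R cauchy_deriv k (of_real r + conjugate y)"

lemma borel_measurable_szego_vertex [measurable]: "szego_vertex k r \<in> borel_measurable borel"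
  unfolding szego_vertex_def by measurable

text \<open>
  The square of \<open>E\<^sup>(\<^sup>k\<^sup>)\<close> decays with the order \<open>2 (m - 1 + k)\<close>, of which the density
  \<open>y\<^sub>0\<^sup>k\<^sup>-\<^sup>1\<close> takes \<open>k - 1\<close>; the order \<open>2 m\<close> of the integrable weight remains.
\<close>
lemma szego_vertex_square_integrable:
  fixes r :: real
  assumes r: "r > 0"
  defines "k \<equiv> DIM('a::hypercomplex) * CARD('n::finite) div 2"
  shows "(\<integral>\<^sup>+z. ennreal ((norm (szego_vertex k r (snd (strip_param z)) :: 'a))\<^sup>2)
      \<partial>(strip :: (('a ^ 'n) \<times> 'a) measure)) < \<infinity>"
proof -
  let ?m = "DIM('a)"
  have k: "k > 0" unfolding k_def by (rule DIM_vec_half(2))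
  obtain C where C: "C \<ge> 0" "\<And>y::'a. y \<bullet> 1 \<ge> 0 \<Longrightarrow> norm (cauchy_deriv k (of_real r + conjugate y)) \<le> C * decay y ^ (?m - 1 + k)"
    using cauchy_deriv_reflected_bound[OF r] by blast
  let ?c = "pi ^ k / fact (k - 1)" and ?p = "(2 / pi) ^ k"
  let ?D = "?c * (?p * C)\<^sup>2"
  have le: "radial_weight k (y \<bullet> 1) * (norm (szego_vertex k r y))\<^sup>2 \<le> ?D * decay y ^ (2 * ?m)" for y :: 'a
  proof (cases "y \<bullet> 1 > 0")
    case False
    then show ?thesis using C(1) decay_pos[of y] by (simp add: radial_weight_def)
  next
    case True
    have d01: "0 < decay y" "decay y \<le> 1" using decay_pos[of y] by (auto simp: inverse_le_1_iff)
    have "norm (szego_vertex k r y) = ?p * norm (cauchy_deriv k (of_real r + conjugate y))"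
      by (simp add: szego_vertex_def power_abs)
    also have "\<dots> \<le> ?p * (C * decay y ^ (?m - 1 + k))"
      using True by (intro mult_left_mono C(2)) auto
    finally have 1: "(norm (szego_vertex k r y))\<^sup>2 \<le> (?p * (C * decay y ^ (?m - 1 + k)))\<^sup>2"
      by (intro power_mono) auto
    have "y \<bullet> 1 \<le> norm y * norm (1::'a)" by (rule norm_cauchy_schwarz)
    then have "(y \<bullet> 1) ^ (k - 1) \<le> (1 + norm y) ^ (k - 1)" using True by (intro power_mono) auto
    then have 2: "radial_weight k (y \<bullet> 1) \<le> ?c * (1 + norm y) ^ (k - 1)"
      using True by (simp add: radial_weight_def divide_right_mono)
    have "radial_weight k (y \<bullet> 1) * (norm (szego_vertex k r y))\<^sup>2 \<le>
        (?c * (1 + norm y) ^ (k - 1)) * (?p * (C * decay y ^ (?m - 1 + k)))\<^sup>2"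
      by (intro mult_mono 1 2) auto
    also have "\<dots> = ?D * ((1 + norm y) ^ (k - 1) * decay y ^ ((?m - 1 + k) * 2))"
      by (simp add: power_mult_distrib power_mult)
    also have "(1 + norm y) ^ (k - 1) * decay y ^ ((?m - 1 + k) * 2) = decay y ^ (2 * (?m - 1 + k) - (k - 1))"
    proof -
      have "(?m - 1 + k) * 2 = (k - 1) + (2 * (?m - 1 + k) - (k - 1))" by simp
      then have "decay y ^ ((?m - 1 + k) * 2) = decay y ^ (k - 1) * decay y ^ (2 * (?m - 1 + k) - (k - 1))"
        by (metis power_add)
      moreover have "(1 + norm y) ^ (k - 1) * decay y ^ (k - 1) = 1"
        using d01 by (simp flip: power_mult_distrib)
      ultimately show ?thesis by simp
    qed
    also have "?D * decay y ^ (2 * (?m - 1 + k) - (k - 1)) \<le> ?D * decay y ^ (2 * ?m)"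
      using d01 k DIM_positive[where 'a='a] by (intro mult_left_mono power_decreasing) auto
    finally show ?thesis .
  qed
  have "(\<integral>\<^sup>+z. ennreal ((norm (szego_vertex k r (snd (strip_param z)) :: 'a))\<^sup>2) \<partial>(strip :: (('a ^ 'n) \<times> 'a) measure)) =
      (\<integral>\<^sup>+y. ennreal (radial_weight k (y \<bullet> 1)) * ennreal ((norm (szego_vertex k r y :: 'a))\<^sup>2) \<partial>lborel)"
    unfolding k_def by (rule nn_integral_strip_radial) measurable
  also have "\<dots> \<le> (\<integral>\<^sup>+(y::'a). ennreal (?D * decay y ^ (2 * ?m)) \<partial>lborel)"
  proof (rule nn_integral_mono)
    fix y :: 'a
    have "ennreal (radial_weight k (y \<bullet> 1)) * ennreal ((norm (szego_vertex k r y))\<^sup>2) =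
        ennreal (radial_weight k (y \<bullet> 1) * (norm (szego_vertex k r y))\<^sup>2)"
      by (simp add: ennreal_mult)
    also have "\<dots> \<le> ennreal (?D * decay y ^ (2 * ?m))" by (rule ennreal_leI[OF le])
    finally show "ennreal (radial_weight k (y \<bullet> 1)) * ennreal ((norm (szego_vertex k r y))\<^sup>2) \<le>
        ennreal (?D * decay y ^ (2 * ?m))" .
  qed
  also have "\<dots> < \<infinity>"
    using integrable_mult_right[OF integrable_decay[where 'a='a], of ?D]
    unfolding real_integrable_def by (simp add: top.not_eq_extremum)
  finally show ?thesis .
qed

text \<open>
  The properties of \<open>F\<^sub>\<epsilon>\<close> that the formula at \<open>(0, r)\<close> uses: regularity on a neighbourhood of the closure of
  the domain and a uniform \<open>L\<^sup>2\<close> bound on the translates of the boundary.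
\<close>
locale paraboloid_regular =
  fixes H :: "('a::hypercomplex ^ 'n::finite) \<times> 'a \<Rightarrow> 'a"
    and H' :: "('a ^ 'n) \<times> 'a \<Rightarrow> (('a ^ 'n) \<times> 'a) \<Rightarrow>\<^sub>L 'a"
    and \<epsilon> :: real and B :: ennreal
  assumes \<epsilon>: "\<epsilon> > 0"
    and deriv: "\<And>p. fst p \<bullet> fst p - \<epsilon> < snd p \<bullet> 1 \<Longrightarrow> (H has_derivative blinfun_apply (H' p)) (at p)"
    and contH': "continuous_on {p. fst p \<bullet> fst p - \<epsilon> < snd p \<bullet> 1} H'"
    and reg: "\<And>p j. fst p \<bullet> fst p - \<epsilon> < snd p \<bullet> 1 \<Longrightarrow> (\<Sum>e\<in>Basis. e * H' p (axis j e, 0)) = 0"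
    and reg_last: "\<And>p. fst p \<bullet> fst p - \<epsilon> < snd p \<bullet> 1 \<Longrightarrow> (\<Sum>e\<in>Basis. e * H' p (0, e)) = 0"
    and B: "B < \<infinity>"
    and bound: "\<And>h. h > - \<epsilon> \<Longrightarrow>
      (\<integral>\<^sup>+z. ennreal ((norm (H (strip_param z + (0, of_real h))))\<^sup>2) \<partial>strip) \<le> B"
begin

lemma contH: "continuous_on {p. fst p \<bullet> fst p - \<epsilon> < snd p \<bullet> 1} H"
  by (rule has_derivative_continuous_on) (use deriv has_derivative_at_withinI in blast)

lemma cont_paraboloid:
  assumes "- \<epsilon> < w \<bullet> 1"
  shows "continuous_on UNIV (\<lambda>x. H (x, of_real (x \<bullet> x) + w))"
    and "continuous_on UNIV (\<lambda>x::'a^'n. H (0, of_real (x \<bullet> x) + w))"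
proof -
  have "- \<epsilon> < (x \<bullet> x) + w \<bullet> 1" for x :: "'a ^ 'n"
    using assms inner_ge_zero[of x] by linarith
  then show "continuous_on UNIV (\<lambda>x::'a^'n. H (0, of_real (x \<bullet> x) + w))"
    by (intro continuous_on_compose2[OF contH] continuous_intros continuous_on_of_real)
      (auto simp: inner_add_left of_real_def)
  show "continuous_on UNIV (\<lambda>x. H (x, of_real (x \<bullet> x) + w))"
    by (intro continuous_on_compose2[OF contH] continuous_intros continuous_on_of_real)
      (use assms in \<open>auto simp: inner_add_left of_real_def\<close>)
qed

lemma mean_value:
  assumes w: "- \<epsilon> < w \<bullet> 1"
    and h: "\<And>s. s \<ge> 0 \<Longrightarrow> (h has_vector_derivative h' s) (at s)" "continuous_on {0..} h'" "\<And>s. s \<ge> R \<Longrightarrow> h s = 0"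
  shows "(\<integral>(x::'a^'n). h (x \<bullet> x) * H (x, of_real (x \<bullet> x) + w) \<partial>lborel) =
    (\<integral>(x::'a^'n). h (x \<bullet> x) * H (0, of_real (x \<bullet> x) + w) \<partial>lborel)"
proof (rule radial_mean_value[where D="{p. fst p \<bullet> fst p - \<epsilon> < snd p \<bullet> 1}"])
  show "(s *\<^sub>R x, of_real (x \<bullet> x) + w) \<in> {p. fst p \<bullet> fst p - \<epsilon> < snd p \<bullet> 1}" if "0 \<le> s" "s \<le> 1" for s and x :: "'a ^ 'n"
  proof -
    have "s * (s * (x \<bullet> x)) \<le> x \<bullet> x"
      using that by (simp add: mult_left_le_one_le mult_nonneg_nonneg mult_le_one flip: mult.assoc)
    then show ?thesis using w by (simp add: inner_add_left of_real_def)
  qed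
qed (use deriv contH' reg h in auto)

text \<open>
  The mean value property with the weight \<open>conjugate G\<close>, where \<open>G\<close> is the slice of \<open>H\<close>, turns
  \<open>\<integral> |G|\<^sup>2\<close> into \<open>\<integral> (conjugate G) H\<close>, and \<open>2 |G| |H| \<le> |G|\<^sup>2 + |H|\<^sup>2\<close>.
\<close>
lemma slice_norm_le:
  assumes w: "- \<epsilon> < w \<bullet> 1"
  shows "(\<integral>\<^sup>+x. ennreal ((norm (H (0, of_real ((x::'a^'n) \<bullet> x) + w)))\<^sup>2) \<partial>lborel) \<le>
    (\<integral>\<^sup>+x. ennreal ((norm (H (x, of_real (x \<bullet> x) + w)))\<^sup>2) \<partial>lborel)" (is "_ \<le> ?rhs")
proof -
  define G where "G = (\<lambda>s. H (0, of_real s + w))"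
  define G' where "G' = (\<lambda>s. H' (0, of_real s + w) (0, 1))"
  define F where "F = (\<lambda>x::'a^'n. H (x, of_real (x \<bullet> x) + w))"
  let ?c = "\<lambda>n (x::'a^'n). cutoff (real (Suc n)) (x \<bullet> x)"
  have Gx: "H (0, of_real s + w) = G s" for s by (simp add: G_def)
  have dom: "- \<epsilon> < s + w \<bullet> 1" if "s \<ge> 0" for s using that w by linarith
  have Gd: "(G has_vector_derivative G' s) (at s)" if "s \<ge> 0" for s
  proof -
    have "((\<lambda>s. H ((0, w) + s *\<^sub>R (0, 1))) has_vector_derivative G' s) (at s)"
      unfolding G'_def by (rule has_derivative_line)
        (use deriv[of "(0, of_real s + w)"] dom[OF that] in \<open>simp add: of_real_def add.commute inner_add_left\<close>)
    then show ?thesis by (simp add: G_def of_real_def add.commute)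
  qed
  have contG': "continuous_on {0..} G'"
    unfolding G'_def
    by (intro continuous_intros continuous_on_compose2[OF contH'] continuous_on_of_real)
      (use dom in \<open>auto simp: inner_add_left of_real_def\<close>)
  have contG: "continuous_on {0..} G"
    by (rule continuous_at_imp_continuous_on) (auto intro: has_vector_derivative_continuous Gd)
  have contGx: "continuous_on UNIV (\<lambda>x::'a^'n. G (x \<bullet> x))"
    unfolding G_def by (rule cont_paraboloid(2)[OF w])
  have contF: "continuous_on UNIV F"
    unfolding F_def by (rule cont_paraboloid(1)[OF w])
  have contc: "continuous_on UNIV (?c n)" for n
    by (rule continuous_on_compose2[OF continuous_on_cutoff]) (auto intro!: continuous_intros)
  have c0: "?c n x = 0" if "norm x > real (Suc n)" for n x
  proof -
    have "(real (Suc n))\<^sup>2 \<le> (norm x)\<^sup>2" using that by (intro power_mono) auto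
    then show ?thesis by (intro cutoff_far) (auto simp: power2_norm_eq_inner)
  qed
  have int: "integrable lborel (\<lambda>x. ?c n x *\<^sub>R f x)" if "continuous_on UNIV f" for n and f :: "'a^'n \<Rightarrow> 'b::euclidean_space"
    by (rule integrable_continuous_bounded_support[OF continuous_on_scaleR[OF contc that], where R="real (Suc n)"])
      (simp only: c0 scaleR_zero_left)
  have intG: "integrable lborel (\<lambda>x. ?c n x *\<^sub>R (norm (G (x \<bullet> x)))\<^sup>2)"
    and intF: "integrable lborel (\<lambda>x. ?c n x *\<^sub>R (norm (F x))\<^sup>2)" for n
    by (intro int continuous_intros contGx contF)+
  have key: "(\<integral>x. ?c n x *\<^sub>R (norm (G (x \<bullet> x)))\<^sup>2 \<partial>lborel) \<le> (\<integral>x. ?c n x *\<^sub>R (norm (F x))\<^sup>2 \<partial>lborel)"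
    (is "?A \<le> ?B") for n
  proof -
    have "(\<integral>x. (?c n x *\<^sub>R conjugate (G (x \<bullet> x))) * F x \<partial>lborel) =
        (\<integral>x. (?c n x *\<^sub>R conjugate (G (x \<bullet> x))) * H (0, of_real (x \<bullet> x) + w) \<partial>lborel)"
      unfolding F_def
    proof (rule mean_value[OF w, where h="\<lambda>s. cutoff (real (Suc n)) s *\<^sub>R conjugate (G s)"])
      show "((\<lambda>s. cutoff (real (Suc n)) s *\<^sub>R conjugate (G s)) has_vector_derivative
          (cutoff (real (Suc n)) s *\<^sub>R conjugate (G' s) +
          (- 2 * max 0 (1 - s / (real (Suc n))\<^sup>2) / (real (Suc n))\<^sup>2) *\<^sub>R conjugate (G s))) (at s)" if "s \<ge> 0" for s
        by (intro has_vector_derivative_scaleR cutoff_derivative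
            bounded_linear.has_vector_derivative[OF linear_conjugate] Gd that)
      show "continuous_on {0..} (\<lambda>s. cutoff (real (Suc n)) s *\<^sub>R conjugate (G' s) +
          (- 2 * max 0 (1 - s / (real (Suc n))\<^sup>2) / (real (Suc n))\<^sup>2) *\<^sub>R conjugate (G s))"
        by (intro continuous_intros contG contG' continuous_on_subset[OF continuous_on_cutoff]
          continuous_on_subset[OF continuous_on_cutoff']) auto
      show "cutoff (real (Suc n)) s *\<^sub>R conjugate (G s) = 0" if "s \<ge> (real (Suc n))\<^sup>2" for s
        using cutoff_far[OF _ that] by simp
    qed
    also have "\<dots> = (\<integral>x. (?c n x *\<^sub>R (norm (G (x \<bullet> x)))\<^sup>2) *\<^sub>R 1 \<partial>lborel)"
      by (intro Bochner_Integration.integral_cong refl) (simp add: Gx conjugate_mult_self scaleR_conv_of_real mult.assoc)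
    also have "\<dots> = ?A *\<^sub>R 1"
      by (intro integral_scaleR_left int) (auto intro!: continuous_intros contGx)
    finally have "?A = norm (\<integral>x. (?c n x *\<^sub>R conjugate (G (x \<bullet> x))) * F x \<partial>lborel)"
      by (simp add: integral_nonneg cutoff_nonneg)
    also have "\<dots> \<le> (\<integral>x. norm ((?c n x *\<^sub>R conjugate (G (x \<bullet> x))) * F x) \<partial>lborel)"
      by (rule Bochner_Integration.integral_norm_bound)
    also have "\<dots> \<le> (\<integral>x. ?c n x *\<^sub>R ((norm (G (x \<bullet> x)))\<^sup>2 / 2 + (norm (F x))\<^sup>2 / 2) \<partial>lborel)"
    proof (rule integral_mono)
      show "integrable lborel (\<lambda>x. norm ((?c n x *\<^sub>R conjugate (G (x \<bullet> x))) * F x))"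
        unfolding mult_scaleR_left by (intro Bochner_Integration.integrable_norm int continuous_intros contGx contF)
      show "integrable lborel (\<lambda>x. ?c n x *\<^sub>R ((norm (G (x \<bullet> x)))\<^sup>2 / 2 + (norm (F x))\<^sup>2 / 2))"
        by (intro int continuous_intros contGx contF) auto
      fix x
      have "norm (G (x \<bullet> x)) * norm (F x) \<le> (norm (G (x \<bullet> x)))\<^sup>2 / 2 + (norm (F x))\<^sup>2 / 2"
        using sum_squares_bound[of "norm (G (x \<bullet> x))" "norm (F x)"] by simp
      then show "norm ((?c n x *\<^sub>R conjugate (G (x \<bullet> x))) * F x) \<le> ?c n x *\<^sub>R ((norm (G (x \<bullet> x)))\<^sup>2 / 2 + (norm (F x))\<^sup>2 / 2)"
        by (simp add: norm_mult cutoff_nonneg mult.assoc mult_left_mono)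
    qed
    also have "\<dots> = ?A / 2 + ?B / 2"
    proof -
      have "(\<integral>x. ?c n x *\<^sub>R ((norm (G (x \<bullet> x)))\<^sup>2 / 2 + (norm (F x))\<^sup>2 / 2) \<partial>lborel) =
          (\<integral>x. (?c n x *\<^sub>R (norm (G (x \<bullet> x)))\<^sup>2) / 2 + (?c n x *\<^sub>R (norm (F x))\<^sup>2) / 2 \<partial>lborel)"
        by (intro Bochner_Integration.integral_cong refl) (simp add: distrib_left)
      also have "\<dots> = ?A / 2 + ?B / 2"
        using intG[of n] intF[of n] by (subst Bochner_Integration.integral_add) auto
      finally show ?thesis .
    qed
    finally show ?thesis by simp
  qed
  have [measurable]: "F \<in> borel_measurable borel" "(\<lambda>x::'a^'n. G (x \<bullet> x)) \<in> borel_measurable borel"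
    by (intro borel_measurable_continuous_onI contF contGx)+
  have [measurable]: "?c n \<in> borel_measurable borel" for n
    by (intro borel_measurable_continuous_onI contc)
  have key': "(\<integral>\<^sup>+x. ennreal (?c n x * (norm (G (x \<bullet> x)))\<^sup>2) \<partial>lborel) \<le> ?rhs" for n
  proof -
    have "(\<integral>\<^sup>+x. ennreal (?c n x * (norm (G (x \<bullet> x)))\<^sup>2) \<partial>lborel) = ennreal (\<integral>x. ?c n x *\<^sub>R (norm (G (x \<bullet> x)))\<^sup>2 \<partial>lborel)"
      by (subst nn_integral_eq_integral[OF intG, symmetric]) (auto simp: cutoff_nonneg)
    also have "\<dots> \<le> ennreal (\<integral>x. ?c n x *\<^sub>R (norm (F x))\<^sup>2 \<partial>lborel)" by (rule ennreal_leI[OF key])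
    also have "\<dots> = (\<integral>\<^sup>+x. ennreal (?c n x * (norm (F x))\<^sup>2) \<partial>lborel)"
      by (subst nn_integral_eq_integral[OF intF, symmetric]) (auto simp: cutoff_nonneg)
    also have "\<dots> \<le> (\<integral>\<^sup>+x. ennreal ((norm (F x))\<^sup>2) \<partial>lborel)"
      by (intro nn_integral_mono ennreal_leI mult_left_le_one_le) (auto simp: cutoff_nonneg cutoff_le_1)
    finally show ?thesis by (simp add: F_def)
  qed
  have "(\<integral>\<^sup>+(x::'a^'n). ennreal ((norm (G (x \<bullet> x)))\<^sup>2) \<partial>lborel) =
      (\<integral>\<^sup>+(x::'a^'n). liminf (\<lambda>n. ennreal (?c n x * (norm (G (x \<bullet> x)))\<^sup>2)) \<partial>lborel)"
  proof (intro nn_integral_cong)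
    fix x :: "'a ^ 'n"
    have "(\<lambda>n. ennreal (?c n x * (norm (G (x \<bullet> x)))\<^sup>2)) \<longlonglongrightarrow> ennreal (1 * (norm (G (x \<bullet> x)))\<^sup>2)"
      by (intro tendsto_ennrealI tendsto_intros cutoff_tendsto_1)
    then show "ennreal ((norm (G (x \<bullet> x)))\<^sup>2) = liminf (\<lambda>n. ennreal (?c n x * (norm (G (x \<bullet> x)))\<^sup>2))"
      by (simp add: lim_imp_Liminf)
  qed
  also have "\<dots> \<le> liminf (\<lambda>n. \<integral>\<^sup>+x. ennreal (?c n x * (norm (G (x \<bullet> x)))\<^sup>2) \<partial>lborel)"
    by (rule nn_integral_liminf) measurable
  also have "\<dots> \<le> ?rhs"
    using key' by (intro Liminf_le) auto
  finally show ?thesis by (simp add: G_def)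
qed

lemma cont_shifted: "h > - \<epsilon> \<Longrightarrow> continuous_on UNIV (\<lambda>z. H (strip_param z + (0, of_real h)))"
  by (rule continuous_on_compose2[OF contH])
    (auto intro!: continuous_intros strip_param_continuous simp: of_real_def inner_add_left)

text \<open>
  The slice is square integrable for the weight \<open>y\<^sub>0\<^sup>k\<^sup>-\<^sup>1\<close> on the larger half-space
  \<open>y\<^sub>0 > - \<epsilon> / 2\<close>, measured from its own boundary, and there the weight is bounded below on \<open>y\<^sub>0 > 0\<close>.
\<close>
lemma slice_square_integrable:
  "(\<integral>\<^sup>+y. indicator {y. y \<bullet> 1 > 0} y * ennreal ((norm (H (0, y)))\<^sup>2) \<partial>lborel) < \<infinity>"
proof -
  let ?k = "DIM('a) * CARD('n) div 2"
  \<comment> \<open>Half of the room below the boundary is given away to bound the weight from below.\<close>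
  define h where "h = - (\<epsilon> / 2)"
  have h: "h > - \<epsilon>" "h < 0" using \<epsilon> by (auto simp: h_def)
  let ?Q = "{y::'a. y \<bullet> 1 \<ge> 0}"
  define g where "g = (\<lambda>y. indicator ?Q y *\<^sub>R H (0, y + of_real h))"
  have [measurable]: "g \<in> borel_measurable borel"
    unfolding g_def
  proof (rule borel_measurable_continuous_on_indicator)
    show "?Q \<in> sets borel" by (intro borel_closed) (simp add: closed_halfspace_component_ge)
    show "continuous_on ?Q (\<lambda>y. H (0, y + of_real h))"
      by (rule continuous_on_compose2[OF contH])
        (use h in \<open>auto intro!: continuous_intros simp: of_real_def inner_add_left\<close>)
  qed
  have [measurable]: "(\<lambda>z. H (strip_param z + (0, of_real h))) \<in> borel_measurable borel"
    by (rule borel_measurable_continuous_onI[OF cont_shifted[OF h(1)]])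
  have [measurable]: "(\<lambda>z::('a^'n)\<times>'a. snd (strip_param z)) \<in> borel_measurable borel"
    using snd_strip_param_measurable by (simp cong: measurable_cong_sets)
  let ?I = "\<lambda>y::'a. indicator {0..1} (y \<bullet> 1) :: ennreal"
  have "(\<integral>\<^sup>+y. ennreal (radial_weight ?k (y \<bullet> 1)) * ennreal ((norm (g y))\<^sup>2) \<partial>lborel) =
      (\<integral>\<^sup>+z. ennreal ((norm (g (snd (strip_param z))))\<^sup>2) \<partial>(strip :: (('a^'n) \<times> 'a) measure))"
    by (rule nn_integral_strip_radial[symmetric]) measurable
  also have "\<dots> = (\<integral>\<^sup>+(x::'a^'n). \<integral>\<^sup>+y. ?I y * ennreal ((norm (g (snd (strip_param (x, y)))))\<^sup>2) \<partial>lborel \<partial>lborel)"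
    by (rule nn_integral_strip) measurable
  also have "\<dots> = (\<integral>\<^sup>+y. \<integral>\<^sup>+(x::'a^'n). ?I y * ennreal ((norm (g (snd (strip_param (x, y)))))\<^sup>2) \<partial>lborel \<partial>lborel)"
    by (rule lborel_pair.Fubini') measurable
  also have "\<dots> = (\<integral>\<^sup>+y. \<integral>\<^sup>+(x::'a^'n). ?I y * ennreal ((norm (H (0, of_real (x \<bullet> x) + (imag y + of_real h))))\<^sup>2) \<partial>lborel \<partial>lborel)"
    by (intro nn_integral_cong) (simp add: g_def inner_add_left of_real_def add.assoc)
  also have "\<dots> = (\<integral>\<^sup>+y. ?I y * (\<integral>\<^sup>+(x::'a^'n). ennreal ((norm (H (0, of_real (x \<bullet> x) + (imag y + of_real h))))\<^sup>2) \<partial>lborel) \<partial>lborel)"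
  proof (intro nn_integral_cong nn_integral_cmult)
    fix y :: 'a
    have "- \<epsilon> < (imag y + of_real h) \<bullet> 1" using h by (simp add: inner_add_left of_real_def)
    from borel_measurable_continuous_onI[OF cont_paraboloid(2)[OF this]]
    show "(\<lambda>x::'a^'n. ennreal ((norm (H (0, of_real (x \<bullet> x) + (imag y + of_real h))))\<^sup>2)) \<in> borel_measurable lborel"
      by simp
  qed
  also have "\<dots> \<le> (\<integral>\<^sup>+y. ?I y * (\<integral>\<^sup>+x. ennreal ((norm (H (x, of_real (x \<bullet> x) + (imag y + of_real h))))\<^sup>2) \<partial>lborel) \<partial>lborel)"
    using h by (intro nn_integral_mono mult_left_mono slice_norm_le) (auto simp: inner_add_left of_real_def)
  also have "\<dots> = (\<integral>\<^sup>+y. (\<integral>\<^sup>+x. ?I y * ennreal ((norm (H (x, of_real (x \<bullet> x) + (imag y + of_real h))))\<^sup>2) \<partial>lborel) \<partial>lborel)"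
  proof (intro nn_integral_cong nn_integral_cmult[symmetric])
    fix y :: 'a
    have "- \<epsilon> < (imag y + of_real h) \<bullet> 1" using h by (simp add: inner_add_left of_real_def)
    from borel_measurable_continuous_onI[OF cont_paraboloid(1)[OF this]]
    show "(\<lambda>x. ennreal ((norm (H (x, of_real (x \<bullet> x) + (imag y + of_real h))))\<^sup>2)) \<in> borel_measurable lborel"
      by simp
  qed
  also have "\<dots> = (\<integral>\<^sup>+y. (\<integral>\<^sup>+x. ?I y * ennreal ((norm (H (strip_param (x, y) + (0, of_real h))))\<^sup>2) \<partial>lborel) \<partial>lborel)"
    by (intro nn_integral_cong) (simp add: strip_param_def add.assoc)
  also have "\<dots> = (\<integral>\<^sup>+x. (\<integral>\<^sup>+y. ?I y * ennreal ((norm (H (strip_param (x, y) + (0, of_real h))))\<^sup>2) \<partial>lborel) \<partial>lborel)"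
    by (rule lborel_pair.Fubini') measurable
  also have "\<dots> = (\<integral>\<^sup>+z. ennreal ((norm (H (strip_param z + (0, of_real h))))\<^sup>2) \<partial>strip)"
    by (rule nn_integral_strip[symmetric]) measurable
  also have "\<dots> \<le> B" by (rule bound[OF h(1)])
  finally have wB: "(\<integral>\<^sup>+y. ennreal (radial_weight ?k (y \<bullet> 1)) * ennreal ((norm (g y))\<^sup>2) \<partial>lborel) \<le> B" .
  let ?w = "radial_weight ?k (\<epsilon> / 2)"
  have w: "?w > 0" using \<epsilon> by (simp add: radial_weight_def)
  have op: "{y::'a. y \<bullet> 1 > 0} \<in> sets borel" by (intro borel_open) (simp add: open_halfspace_component_gt)
  have gm: "(\<lambda>y. indicator {y. y \<bullet> 1 > 0} y *\<^sub>R H (0, y)) \<in> borel_measurable borel"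
    by (rule borel_measurable_continuous_on_indicator[OF op])
      (rule continuous_on_compose2[OF contH], use \<epsilon> in \<open>auto intro!: continuous_intros\<close>)
  have gm': "(\<lambda>y. indicator {y. y \<bullet> 1 > 0} y * ennreal ((norm (H (0, y)))\<^sup>2)) =
      (\<lambda>y. ennreal ((norm (indicator {y. y \<bullet> 1 > 0} y *\<^sub>R H (0, y)))\<^sup>2))"
    by (auto simp: indicator_def)
  have "(\<lambda>y. indicator {y. y \<bullet> 1 > 0} y * ennreal ((norm (H (0, y)))\<^sup>2)) \<in> borel_measurable borel"
    unfolding gm' using gm by measurable
  from nn_integral_lborel_translate[OF this, of "of_real h"]
  have "(\<integral>\<^sup>+y. indicator {y. y \<bullet> 1 > 0} y * ennreal ((norm (H (0, y)))\<^sup>2) \<partial>lborel) =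
      (\<integral>\<^sup>+y. indicator {y. y \<bullet> 1 > 0} (y + of_real h) * ennreal ((norm (H (0, y + of_real h)))\<^sup>2) \<partial>lborel)" by simp
  also have "\<dots> \<le> (\<integral>\<^sup>+y. ennreal (inverse ?w) * (ennreal (radial_weight ?k (y \<bullet> 1)) * ennreal ((norm (g y))\<^sup>2)) \<partial>lborel)"
  proof (rule nn_integral_mono)
    fix y :: 'a
    show "indicator {y. y \<bullet> 1 > 0} (y + of_real h) * ennreal ((norm (H (0, y + of_real h)))\<^sup>2) \<le>
        ennreal (inverse ?w) * (ennreal (radial_weight ?k (y \<bullet> 1)) * ennreal ((norm (g y))\<^sup>2))"
    proof (cases "y \<bullet> 1 > \<epsilon> / 2")
      case True
      then have "?w \<le> radial_weight ?k (y \<bullet> 1)"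
        using \<epsilon> by (auto simp: radial_weight_def intro!: mult_left_mono divide_right_mono power_mono)
      then have "1 \<le> inverse ?w * radial_weight ?k (y \<bullet> 1)" using w by (simp add: field_simps)
      then have "1 * (norm (g y))\<^sup>2 \<le> (inverse ?w * radial_weight ?k (y \<bullet> 1)) * (norm (g y))\<^sup>2"
        by (rule mult_right_mono) simp
      moreover have "g y = H (0, y + of_real h)" using True \<epsilon> by (simp add: g_def)
      ultimately show ?thesis
        using w by (simp add: ennreal_mult[symmetric] mult.assoc indicator_def ennreal_leI)
    next
      case False
      then have "\<not> (y + of_real h) \<bullet> 1 > 0" by (simp add: h_def inner_diff_left inner_add_left of_real_def)
      then show ?thesis by simp
    qed
  qed
  also have "\<dots> = ennreal (inverse ?w) * (\<integral>\<^sup>+y. ennreal (radial_weight ?k (y \<bullet> 1)) * ennreal ((norm (g y))\<^sup>2) \<partial>lborel)"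
    by (rule nn_integral_cmult) measurable
  also have "\<dots> \<le> ennreal (inverse ?w) * B" by (intro mult_left_mono wB) simp
  also have "\<dots> < \<infinity>" using B by (simp add: ennreal_mult_less_top)
  finally show ?thesis .
qed

lemma integrable_szego_vertex_times:
  assumes r: "r > 0"
  defines "k \<equiv> DIM('a) * CARD('n) div 2"
  shows "integrable strip (\<lambda>z. szego_vertex k r (snd (strip_param z)) * H (strip_param z))"
proof -
  have Hm [measurable]: "(\<lambda>z. H (strip_param z)) \<in> borel_measurable strip"
    using borel_measurable_continuous_onI[OF cont_shifted[of 0]] \<epsilon>
    by (simp add: zero_prod_def[symmetric] cong: measurable_cong_sets)
  have "(\<lambda>z::('a^'n)\<times>'a. szego_vertex k r (snd (strip_param z)) :: 'a) \<in> borel_measurable strip" by measurable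
  then show ?thesis
  proof (rule integrable_mult_of_square_integrable[OF _ Hm])
    show "(\<integral>\<^sup>+z. ennreal ((norm (szego_vertex k r (snd (strip_param z)) :: 'a))\<^sup>2)
      \<partial>(strip :: (('a ^ 'n) \<times> 'a) measure)) < \<infinity>"
      unfolding k_def by (rule szego_vertex_square_integrable[OF r])
    show "(\<integral>\<^sup>+z. ennreal ((norm (H (strip_param z)))\<^sup>2) \<partial>strip) < \<infinity>"
      using bound[of 0] B \<epsilon> by (simp add: order_le_less_trans zero_prod_def[symmetric])
  qed
qed

text \<open>
  The density \<open>\<pi>\<^sup>k y\<^sub>0\<^sup>k\<^sup>-\<^sup>1 / (k-1)!\<close> times the factor \<open>(-2 / \<pi>)\<^sup>k\<close> in the Szego kernel is exactly the
  factor in the half-space formula with \<open>i = k - 1\<close>.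
\<close>
lemma szego_vertex_slice:
  assumes r: "r > 0"
  defines "k \<equiv> DIM('a) * CARD('n) div 2"
  shows "integrable (strip :: (('a^'n) \<times> 'a) measure) (\<lambda>z. szego_vertex k r (snd (strip_param z)) * H (0, snd (strip_param z)))"
    and "(\<integral>z. szego_vertex k r (snd (strip_param z)) * H (0, snd (strip_param z)) \<partial>(strip :: (('a^'n) \<times> 'a) measure)) =
      H (0, of_real r)"
proof -
  have k: "k > 0" unfolding k_def by (rule DIM_vec_half(2))
  define i where "i = k - 1"
  have ki: "k = Suc i" using k by (simp add: i_def)
  let ?Q = "{y::'a. y \<bullet> 1 \<ge> 0}"
  \<comment> \<open>The closed half-space: \<open>|x|\<^sup>2\<close> may be 0.\<close>
  define f where "f = (\<lambda>y. indicator ?Q y *\<^sub>R (szego_vertex k r y * H (0, y)))"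
  have contQ: "continuous_on ?Q (\<lambda>y. szego_vertex k r y * H (0, y))"
    unfolding szego_vertex_def
    by (intro continuous_intros continuous_on_compose2[OF contH]
        continuous_on_subset[OF continuous_on_reflected[OF continuous_on_cauchy_deriv, of r]])
      (use \<epsilon> r in auto)
  have f [measurable]: "f \<in> borel_measurable borel"
    unfolding f_def
    by (rule borel_measurable_continuous_on_indicator[OF _ contQ])
      (intro borel_closed, simp add: closed_halfspace_component_ge)
  have feq: "f (snd (strip_param z)) = szego_vertex k r (snd (strip_param z)) * H (0, snd (strip_param z))" for z :: "('a^'n) \<times> 'a"
    by (simp add: f_def inner_add_left of_real_def)
  define rest where "rest = (\<lambda>y. indicator {y. y \<bullet> 1 > 0} y *\<^sub>R (half_space_kernel i r y * H (0, y)))"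
  have wf: "radial_weight k (y \<bullet> 1) *\<^sub>R f y = - rest y" for y
  proof (cases "y \<bullet> 1 > 0")
    case True
    have "pi ^ k / fact i * (y \<bullet> 1) ^ i * (- 2 / pi) ^ k = - (2 * (- 2 * (y \<bullet> 1)) ^ i / fact i)"
    proof -
      have "pi ^ k * (- 2 / pi) ^ k = (- 2) ^ k" by (simp flip: power_mult_distrib)
      then have "pi ^ k / fact i * (y \<bullet> 1) ^ i * (- 2 / pi) ^ k = (- 2) ^ k * (y \<bullet> 1) ^ i / fact i"
        by (simp add: mult_ac)
      then show ?thesis unfolding ki power_mult_distrib by simp
    qed
    then show ?thesis
      using True by (simp add: f_def rest_def half_space_kernel_def szego_vertex_def radial_weight_def ki del: power_Suc)
  qed (simp add: radial_weight_def rest_def)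
  define G' where "G' = (\<lambda>y. H' (0, y) o\<^sub>L Blinfun (\<lambda>h. (0::'a^'n, h)))"
  have bl: "bounded_linear (\<lambda>h::'a. (0::'a^'n, h))"
    by (intro bounded_linear_Pair bounded_linear_zero bounded_linear_ident)
  have G'_apply: "G' y h = H' (0, y) (0, h)" for y h
    by (simp add: G'_def bounded_linear_Blinfun_apply[OF bl])
  have Gd: "((\<lambda>y. H (0, y)) has_derivative blinfun_apply (G' y)) (at y)" if "y \<bullet> 1 > - \<epsilon>" for y
  proof -
    have "((\<lambda>y. H (0, y)) has_derivative (\<lambda>h. H' (0, y) (0, h))) (at y)"
      by (rule has_derivative_compose[OF bounded_linear_imp_has_derivative[OF bl] deriv]) (use that in simp)
    then show ?thesis by (simp add: G'_apply[abs_def])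
  qed
  have contG': "continuous_on {y. y \<bullet> 1 > - \<epsilon>} G'"
    unfolding G'_def
    by (intro bounded_bilinear.continuous_on[OF bounded_bilinear_blinfun_compose] continuous_on_compose2[OF contH'] continuous_intros)
      auto
  have Greg: "(\<Sum>e\<in>Basis. e * G' y e) = 0" if "y \<bullet> 1 > - \<epsilon>" for y
    using reg_last[of "(0, y)"] that by (simp add: G'_apply)
  note hs = half_space_formula[OF r \<epsilon> Gd contG' Greg slice_square_integrable, of i]
  have rest: "integrable lborel rest" "H (0, of_real r) = - integral\<^sup>L lborel rest"
    using hs unfolding rest_def by simp_all
  show "integrable (strip :: (('a^'n) \<times> 'a) measure) (\<lambda>z. szego_vertex k r (snd (strip_param z)) * H (0, snd (strip_param z)))"
    using integral_strip_radial(2)[OF f, where 'n='n] rest(1)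
    unfolding feq k_def[symmetric] wf by simp
  show "(\<integral>z. szego_vertex k r (snd (strip_param z)) * H (0, snd (strip_param z)) \<partial>(strip :: (('a^'n) \<times> 'a) measure)) =
      H (0, of_real r)"
    using integral_strip_radial(1)[OF f, where 'n='n] rest(2)
    unfolding feq k_def[symmetric] wf by simp
qed

text \<open>
  For a fixed imaginary part the kernel is a function of \<open>|x|\<^sup>2\<close>, so the mean value property
  exchanges \<open>H\<close> for its slice.
\<close>
lemma reproducing_at_vertex:
  assumes r: "r > 0"
  defines "k \<equiv> DIM('a) * CARD('n) div 2"
  shows "(\<integral>z. szego_vertex k r (snd (strip_param z)) * H (strip_param z) \<partial>strip) = H (0, of_real r)"
proof -
  let ?S = "\<lambda>z::('a^'n)\<times>'a. szego_vertex k r (snd (strip_param z)) :: 'a"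
  let ?c = "\<lambda>n (z::('a^'n)\<times>'a). cutoff (real (Suc n)) (fst z \<bullet> fst z)"
  define f where "f = (\<lambda>z. ?S z * H (strip_param z))"
  define g where "g = (\<lambda>z. ?S z * H (0, snd (strip_param z)))"
  have int_f: "integrable strip f" unfolding f_def k_def by (rule integrable_szego_vertex_times[OF r])
  have int_g: "integrable strip g" unfolding g_def k_def by (rule szego_vertex_slice(1)[OF r])
  have [measurable]: "?c n \<in> borel_measurable strip" for n
    by (subst measurable_cong_sets[OF sets_strip refl])
      (intro borel_measurable_continuous_onI continuous_on_compose2[OF continuous_on_cutoff] continuous_intros, auto)
  have c1: "norm (?c n z *\<^sub>R x) \<le> norm x" for n z and x :: 'a
    by (simp add: cutoff_nonneg cutoff_le_1 mult_left_le_one_le)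
  have int_c: "integrable strip (\<lambda>z. ?c n z *\<^sub>R u z)" if "integrable strip u" for n and u :: "_ \<Rightarrow> 'a"
  proof (rule Bochner_Integration.integrable_bound[OF that])
    show "(\<lambda>z. ?c n z *\<^sub>R u z) \<in> borel_measurable strip"
      using borel_measurable_integrable[OF that] by measurable
  qed (use c1 in simp)
  have lim: "(\<lambda>n. \<integral>z. ?c n z *\<^sub>R u z \<partial>strip) \<longlonglongrightarrow> integral\<^sup>L strip u" if "integrable strip u" for u :: "_ \<Rightarrow> 'a"
  proof (rule integral_dominated_convergence[where w="\<lambda>z. norm (u z)"])
    show "AE z in strip. (\<lambda>n. ?c n z *\<^sub>R u z) \<longlonglongrightarrow> u z"
    proof (intro AE_I2)
      fix z :: "('a^'n)\<times>'a"
      have "(\<lambda>n. ?c n z *\<^sub>R u z) \<longlonglongrightarrow> 1 *\<^sub>R u z" by (intro tendsto_intros cutoff_tendsto_1)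
      then show "(\<lambda>n. ?c n z *\<^sub>R u z) \<longlonglongrightarrow> u z" by simp
    qed
    show "(\<lambda>z. ?c n z *\<^sub>R u z) \<in> borel_measurable strip" for n
      using borel_measurable_integrable[OF int_c[OF that]] .
  qed (use that c1 in auto)
  have eq: "(\<integral>z. ?c n z *\<^sub>R f z \<partial>strip) = (\<integral>z. ?c n z *\<^sub>R g z \<partial>strip)" for n
  proof -
    have inner: "(\<integral>x. ?c n (x, y) *\<^sub>R f (x, y) \<partial>lborel) = (\<integral>x. ?c n (x, y) *\<^sub>R g (x, y) \<partial>lborel)" for y
    proof -
      let ?\<nu> = "\<lambda>s. of_real r + conjugate (of_real s + imag y)"
      let ?p = "(- 2 / pi) ^ k :: real"
      have \<nu>: "?\<nu> s = (of_real r + conjugate (imag y)) + s *\<^sub>R 1" for s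
        unfolding conjugate_add conjugate_of_real by (simp add: of_real_def add_ac)
      have nz: "?\<nu> s \<noteq> 0" if "s \<ge> 0" for s
        using reflected_nonzero[of r "of_real s + imag y"] that r by (simp add: inner_add_left of_real_def)
      have Ed: "((\<lambda>s. szego_vertex k r (of_real s + imag y)) has_vector_derivative ?p *\<^sub>R cauchy_deriv' k (?\<nu> s) 1) (at s)"
        if "s \<ge> 0" for s
      proof -
        have "((\<lambda>s. cauchy_deriv k (?\<nu> s)) has_vector_derivative cauchy_deriv' k (?\<nu> s) 1) (at s)"
          unfolding \<nu> by (rule has_derivative_line) (use cauchy_deriv_has_derivative[OF nz[OF that]] \<nu> in simp)
        then show ?thesis
          unfolding szego_vertex_def
          by (rule bounded_linear.has_vector_derivative[OF bounded_linear_scaleR_right])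
      qed
      have contE: "continuous_on {0..} (\<lambda>s. szego_vertex k r (of_real s + imag y))"
        by (rule continuous_at_imp_continuous_on) (auto intro: has_vector_derivative_continuous Ed)
      have contE': "continuous_on {0..} (\<lambda>s. ?p *\<^sub>R cauchy_deriv' k (?\<nu> s) 1)"
        by (intro continuous_intros continuous_on_compose2[OF continuous_on_cauchy_deriv'] continuous_on_of_real) (use nz in auto)
      let ?h = "\<lambda>s. cutoff (real (Suc n)) s *\<^sub>R szego_vertex k r (of_real s + imag y)"
      have "(\<integral>(x::'a^'n). ?h (x \<bullet> x) * H (x, of_real (x \<bullet> x) + imag y) \<partial>lborel) =
          (\<integral>(x::'a^'n). ?h (x \<bullet> x) * H (0, of_real (x \<bullet> x) + imag y) \<partial>lborel)"
      proof (rule mean_value)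
        show "- \<epsilon> < imag y \<bullet> 1" using \<epsilon> by simp
        show "(?h has_vector_derivative (cutoff (real (Suc n)) s *\<^sub>R (?p *\<^sub>R cauchy_deriv' k (?\<nu> s) 1) +
          (- 2 * max 0 (1 - s / (real (Suc n))\<^sup>2) / (real (Suc n))\<^sup>2) *\<^sub>R szego_vertex k r (of_real s + imag y))) (at s)"
          if "s \<ge> 0" for s
          by (intro has_vector_derivative_scaleR cutoff_derivative Ed that)
        show "continuous_on {0..} (\<lambda>s. cutoff (real (Suc n)) s *\<^sub>R (?p *\<^sub>R cauchy_deriv' k (?\<nu> s) 1) +
          (- 2 * max 0 (1 - s / (real (Suc n))\<^sup>2) / (real (Suc n))\<^sup>2) *\<^sub>R szego_vertex k r (of_real s + imag y))"
          by (intro continuous_on_add continuous_on_scaleR contE contE' continuous_on_subset[OF continuous_on_cutoff]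
            continuous_on_subset[OF continuous_on_cutoff']) auto
        show "?h s = 0" if "s \<ge> (real (Suc n))\<^sup>2" for s
          using cutoff_far[OF _ that] by simp
      qed
      then show ?thesis by (simp add: f_def g_def strip_param_def)
    qed
    show ?thesis
      unfolding integral_strip_iterated[OF int_c[OF int_f]] integral_strip_iterated[OF int_c[OF int_g]] inner ..
  qed
  have "integral\<^sup>L strip f = integral\<^sup>L strip g"
    by (rule LIMSEQ_unique[OF lim[OF int_f, unfolded eq] lim[OF int_g]])
  then show ?thesis
    unfolding f_def g_def k_def by (simp only: szego_vertex_slice(2)[OF r])
qed

end

section \<open>Boundary automorphisms and the reproducing formula\<close>

lemma conj_dot_inner_one: "conj_dot z x \<bullet> 1 = z \<bullet> (x :: 'a::hypercomplex ^ 'n::finite)"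
proof -
  have "(conjugate (z $ i) * x $ i) \<bullet> 1 = z $ i \<bullet> x $ i" for i
    unfolding inner_conjugate_mult by (simp add: inner_commute)
  then show ?thesis by (simp add: conj_dot_def inner_sum_left inner_vec_def)
qed

lemma conjugate_conj_dot: "conjugate (conj_dot z x) = conj_dot x (z :: 'a::hypercomplex ^ 'n::finite)"
  by (simp add: conj_dot_def conjugate_sum conjugate_mult)

lemma conj_dot_self: "conj_dot z z = of_real (z \<bullet> (z :: 'a::hypercomplex ^ 'n::finite))"
  by (simp add: conj_dot_def conjugate_mult_self inner_vec_def power2_norm_eq_inner del: of_real_power)

lemma conj_dot_add_left: "conj_dot (x + y) z = conj_dot x z + conj_dot y (z :: 'a::hypercomplex ^ 'n::finite)"
  by (simp add: conj_dot_def conjugate_add distrib_right sum.distrib)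

lemma conj_dot_axis: "conj_dot z (axis j e) = conjugate (z $ j) * (e :: 'a::hypercomplex)"
proof -
  have "conj_dot z (axis j e) = (\<Sum>i\<in>UNIV. if i = j then conjugate (z $ j) * e else 0)"
    unfolding conj_dot_def by (intro sum.cong refl) (auto simp: axis_def)
  then show ?thesis by simp
qed

lemma bounded_linear_conj_dot: "bounded_linear (conj_dot (z :: 'a::hypercomplex ^ 'n::finite))"
  unfolding conj_dot_def[abs_def]
  by (intro bounded_linear_sum bounded_linear_const_mult bounded_linear_vec_nth)

lemmas continuous_on_conj_dot [continuous_intros] = bounded_linear.continuous_on[OF bounded_linear_conj_dot]

lemma continuous_on_conj_dot_left [continuous_intros]:
  "continuous_on S f \<Longrightarrow> continuous_on S (\<lambda>x. conj_dot (f x) (z :: 'a::hypercomplex ^ 'n::finite))"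
  unfolding conj_dot_def by (intro continuous_intros)

text \<open>
  In coordinates on the strip the boundary automorphisms are shears in imaginary directions followed by
  translations.
\<close>
lemma distr_strip_shear:
  fixes c :: "'v::euclidean_space \<Rightarrow> 'a::hypercomplex" and z :: 'v
  assumes c: "continuous_on UNIV c" "\<And>x. c x \<bullet> 1 = 0"
  defines "T \<equiv> \<lambda>p. (fst p + z, snd p + c (fst p))"
  shows "distr strip borel T = strip" and "T \<in> borel_measurable strip"
proof -
  have [measurable]: "c \<in> borel_measurable borel" by (rule borel_measurable_continuous_onI[OF c(1)])
  have "T \<in> borel_measurable borel"
    unfolding T_def by (intro borel_measurable_continuous_onI continuous_intros continuous_on_compose2[OF c(1)]) auto
  then show T [measurable]: "T \<in> borel_measurable strip" by (simp cong: measurable_cong_sets)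
  show "distr strip borel T = strip"
  proof (rule measure_eqI)
    fix X assume "X \<in> sets (distr strip borel T)"
    then have [measurable]: "X \<in> sets borel" by simp
    let ?I = "indicator {0..1::real} :: real \<Rightarrow> ennreal"
    have "emeasure (distr strip borel T) X = (\<integral>\<^sup>+p. indicator X p \<partial>distr strip borel T)" by simp
    also have "\<dots> = (\<integral>\<^sup>+p. indicator X (T p) \<partial>strip)" by (rule nn_integral_distr) auto
    also have "\<dots> = (\<integral>\<^sup>+x. \<integral>\<^sup>+y. ?I (y \<bullet> 1) * indicator X (T (x, y)) \<partial>lborel \<partial>lborel)"
      using \<open>T \<in> borel_measurable borel\<close> by (intro nn_integral_strip) measurable
    also have "\<dots> = (\<integral>\<^sup>+x. \<integral>\<^sup>+y. ?I ((y + c x) \<bullet> 1) * indicator X (x + z, y + c x) \<partial>lborel \<partial>lborel)"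
      by (simp add: T_def inner_add_left c(2))
    also have "\<dots> = (\<integral>\<^sup>+x. \<integral>\<^sup>+y. ?I (y \<bullet> 1) * indicator X (x + z, y) \<partial>lborel \<partial>lborel)"
      by (intro nn_integral_cong nn_integral_lborel_translate) measurable
    also have "\<dots> = (\<integral>\<^sup>+x. \<integral>\<^sup>+y. ?I (y \<bullet> 1) * indicator X (x, y) \<partial>lborel \<partial>lborel)"
      by (rule nn_integral_lborel_translate) measurable
    also have "\<dots> = (\<integral>\<^sup>+p. indicator X p \<partial>strip)" by (rule nn_integral_strip[symmetric]) measurable
    finally show "emeasure (distr strip borel T) X = emeasure strip X" by simp
  qed simp
qed

lemma nn_integral_boundary:
  assumes "f \<in> borel_measurable (restrict_space borel siegel_boundary)"
  shows "(\<integral>\<^sup>+\<omega>. f \<omega> \<partial>(boundary_measure :: ('a::hypercomplex, 'n::finite) point measure)) =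
    (\<integral>\<^sup>+p. f (strip_param p) \<partial>strip)"
  unfolding boundary_measure_eq_strip nn_integral_completion
  using assms by (intro nn_integral_distr) auto

lemma integral_boundary:
  fixes f :: "_ \<Rightarrow> 'w::euclidean_space"
  assumes "f \<in> borel_measurable (restrict_space borel siegel_boundary)"
  shows "(\<integral>\<omega>. f \<omega> \<partial>(boundary_measure :: ('a::hypercomplex, 'n::finite) point measure)) =
    (\<integral>p. f (strip_param p) \<partial>strip)"
proof -
  have "(\<integral>\<omega>. f \<omega> \<partial>(boundary_measure :: ('a, 'n) point measure)) =
      (\<integral>\<omega>. f \<omega> \<partial>distr strip (restrict_space borel siegel_boundary) (strip_param :: _ \<Rightarrow> ('a, 'n) point))"
    unfolding boundary_measure_eq_strip using assms by (intro integral_completion) auto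
  also have "\<dots> = (\<integral>p. f (strip_param p) \<partial>strip)"
    using assms by (intro integral_distr) auto
  finally show ?thesis .
qed

lemma measurable_boundary_measureI:
  "f \<in> borel_measurable (restrict_space borel siegel_boundary) \<Longrightarrow>
    f \<in> borel_measurable (boundary_measure :: ('a::hypercomplex, 'n::finite) point measure)"
  unfolding boundary_measure_eq_strip
  by (rule measurable_completion) (simp add: measurable_distr_eq1)

lemma dir_deriv_eq:
  assumes "(f has_derivative f') (at x)"
  shows "dir_deriv v f x = f' v"
proof -
  have "((\<lambda>t. f (x + t *\<^sub>R v)) has_vector_derivative f' v) (at 0)"
    by (rule has_derivative_line) (use assms in simp)
  then show ?thesis unfolding dir_deriv_def by (rule vector_derivative_at)
qed

text \<open>
  For imaginary \<open>\<tau>\<close> this is the left translation by \<open>(z, \<tau>)\<close> in the Heisenberg group, extended to the domain.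
\<close>
definition heisenberg :: "('a::hypercomplex ^ 'n::finite) \<Rightarrow> 'a \<Rightarrow> ('a, 'n) point \<Rightarrow> ('a, 'n) point" where
  "heisenberg z \<tau> p = (fst p + z, snd p + (of_real (z \<bullet> z) + 2 * conj_dot z (fst p) + \<tau>))"

lemma inner_two_mult: "(2 * a) \<bullet> b = 2 * (a \<bullet> (b::'a::hypercomplex))"
  unfolding mult_2 by (rule inner_add_left)

lemma conjugate_two_mult: "conjugate (2 * a) = 2 * conjugate (a::'a::hypercomplex)"
  unfolding mult_2 by (rule conjugate_add)

text \<open>
  The height above the boundary is invariant, so the translations preserve the domain and every translate of
  the boundary.
\<close>
lemma heisenberg_height:
  assumes "\<tau> \<bullet> 1 = 0"
  shows "snd (heisenberg z \<tau> p) \<bullet> 1 - fst (heisenberg z \<tau> p) \<bullet> fst (heisenberg z \<tau> p) = snd p \<bullet> 1 - fst p \<bullet> fst p"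
proof -
  have "snd (heisenberg z \<tau> p) \<bullet> 1 = snd p \<bullet> 1 + (z \<bullet> z + 2 * (z \<bullet> fst p))"
    using assms by (simp add: heisenberg_def inner_add_left inner_two_mult of_real_def conj_dot_inner_one)
  moreover have "fst (heisenberg z \<tau> p) \<bullet> fst (heisenberg z \<tau> p) = fst p \<bullet> fst p + 2 * (z \<bullet> fst p) + z \<bullet> z"
    by (simp add: heisenberg_def inner_add_left inner_add_right inner_commute[of "fst p" z])
  ultimately show ?thesis by simp
qed

lemma heisenberg_strip_param:
  assumes "\<tau> \<bullet> 1 = 0"
  shows "heisenberg z \<tau> (strip_param p) =
    strip_param (fst p + z, snd p + (imag (2 * conj_dot z (fst p)) + \<tau>))"
proof -
  let ?D = "conj_dot z (fst p)"
  have add: "imag (a + b) = imag a + imag b" for a b :: 'a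
    by (rule linear_add[OF bounded_linear.linear[OF linear_imag]])
  have "imag (2 * ?D) = 2 * ?D - of_real (2 * (z \<bullet> fst p))"
    by (simp add: imag_def of_real_def inner_two_mult conj_dot_inner_one)
  moreover have "imag (imag (2 * ?D)) = imag (2 * ?D)" "imag \<tau> = \<tau>"
    using assms by (simp_all add: imag_def inner_diff_left)
  ultimately have "imag (snd p + (imag (2 * ?D) + \<tau>)) = imag (snd p) + ((2 * ?D - of_real (2 * (z \<bullet> fst p))) + \<tau>)"
    by (simp only: add)
  moreover have "(fst p + z) \<bullet> (fst p + z) = fst p \<bullet> fst p + 2 * (z \<bullet> fst p) + z \<bullet> z"
    by (simp add: inner_add_left inner_add_right inner_commute[of "fst p" z])
  then have "(of_real ((fst p + z) \<bullet> (fst p + z)) :: 'a) =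
      of_real (fst p \<bullet> fst p) + of_real (2 * (z \<bullet> fst p)) + of_real (z \<bullet> z)"
    by (simp only: of_real_add)
  ultimately show ?thesis
    by (simp add: heisenberg_def strip_param_def case_prod_beta)
qed

lemma siegel_domain_iff: "p \<in> siegel_domain \<longleftrightarrow> fst p \<bullet> fst p < snd (p :: ('a::hypercomplex, 'n::finite) point) \<bullet> 1"
  by (simp add: siegel_domain_def case_prod_beta re_part_def norm_sq_eq)

text \<open>
  Invariance of the argument of \<open>s\<close> in the Szego kernel under a simultaneous translation of both points.
\<close>
lemma szego_kernel_heisenberg:
  fixes p :: "('a::hypercomplex, 'n::finite) point"
  assumes \<tau>: "\<tau> \<bullet> 1 = 0"
  shows "snd (heisenberg z \<tau> (0, of_real r)) + conjugate (snd (heisenberg z \<tau> p)) - 2 * conj_dot (fst (heisenberg z \<tau> p)) z =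
    of_real r + conjugate (snd p)"
proof -
  have "conjugate \<tau> = - \<tau>" using \<tau> by (simp add: conjugate_eq)
  moreover have "conj_dot z 0 = 0" by (simp add: conj_dot_def)
  ultimately show ?thesis
    by (simp add: heisenberg_def conjugate_add conjugate_two_mult conjugate_conj_dot conj_dot_add_left
        conj_dot_self distrib_left mult_2[of "of_real (z \<bullet> z)"])
qed

text \<open>
  The translation that takes \<open>(0, r)\<close> to \<open>\<zeta>\<close> reduces the formula for each \<open>F\<^sub>\<epsilon>\<close> to the one on the axis; the
  limit \<open>\<epsilon> \<rightarrow> 0\<close> is taken in \<open>L\<^sup>2\<close>.
\<close>
theorem cauchy_szego_reproducing:
  fixes F :: "('a::hypercomplex, 'n::finite) point \<Rightarrow> 'a"
  assumes F: "F \<in> hardy2" and Fb: "is_boundary_limit F Fb" and \<zeta>: "\<zeta> \<in> siegel_domain"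
  shows "has_bochner_integral boundary_measure (\<lambda>\<omega>. szego_kernel \<zeta> \<omega> * Fb \<omega>) (F \<zeta>)"
proof -
  let ?R = "restrict_space borel siegel_boundary :: ('a, 'n) point measure"
  define k where "k = DIM('a) * CARD('n) div 2"
  define z where "z = fst \<zeta>"
  define \<tau> where "\<tau> = imag (snd \<zeta>)"
  define r where "r = snd \<zeta> \<bullet> 1 - z \<bullet> z"
  let ?L = "heisenberg z \<tau>"
  have \<tau>: "\<tau> \<bullet> 1 = 0" by (simp add: \<tau>_def)
  have r: "r > 0" using \<zeta> by (simp add: siegel_domain_iff r_def z_def)
  have L_vertex: "?L (0, of_real r + c) = \<zeta> + (0, c)" for c
    by (cases \<zeta>) (simp add: heisenberg_def z_def \<tau>_def r_def imag_def of_real_def conj_dot_def scaleR_left.diff)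
  define T where "T = (\<lambda>p::('a, 'n) point. (fst p + z, snd p + (imag (2 * conj_dot z (fst p)) + \<tau>)))"
  have T: "distr strip borel T = strip" "T \<in> borel_measurable strip"
    unfolding T_def
    by (rule distr_strip_shear; (intro continuous_intros)?; simp add: inner_add_left \<tau>)+
  have LT: "?L (strip_param p) = strip_param (T p)" for p
    unfolding T_def by (rule heisenberg_strip_param[OF \<tau>])
  have strip_R: "strip_param \<in> strip \<rightarrow>\<^sub>M ?R" by measurable
  have nn_T: "(\<integral>\<^sup>+p. f (strip_param p) \<partial>strip) = (\<integral>\<^sup>+p. f (?L (strip_param p)) \<partial>strip)"
    if f: "f \<in> borel_measurable ?R" for f
  proof -
    have "(\<integral>\<^sup>+p. f (strip_param p) \<partial>strip) = (\<integral>\<^sup>+p. f (strip_param p) \<partial>distr strip borel T)" by (simp add: T(1))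
    also have "\<dots> = (\<integral>\<^sup>+p. f (strip_param (T p)) \<partial>strip)"
      using measurable_compose[OF strip_R f] by (intro nn_integral_distr T(2)) (simp cong: measurable_cong_sets)
    finally show ?thesis by (simp add: LT)
  qed
  have int_T: "(\<integral>p. f (strip_param p) \<partial>strip) = (\<integral>p. f (?L (strip_param p)) \<partial>strip)"
    if f: "f \<in> borel_measurable ?R" for f :: "_ \<Rightarrow> 'a"
  proof -
    have "(\<integral>p. f (strip_param p) \<partial>strip) = (\<integral>p. f (strip_param p) \<partial>distr strip borel T)" by (simp add: T(1))
    also have "\<dots> = (\<integral>p. f (strip_param (T p)) \<partial>strip)"
      using measurable_compose[OF strip_R f] by (intro integral_distr T(2)) (simp cong: measurable_cong_sets)
    finally show ?thesis by (simp add: LT)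
  qed
  from F have lr: "left_regular_on siegel_domain F"
    and sup: "(SUP \<epsilon>\<in>{0<..}. \<integral>\<^sup>+\<omega>. ennreal ((norm (shift \<epsilon> F \<omega>))\<^sup>2) \<partial>boundary_measure) < \<infinity>"
    by (auto simp: hardy2_def)
  define B where "B = (SUP \<epsilon>\<in>{0<..}. \<integral>\<^sup>+\<omega>. ennreal ((norm (shift \<epsilon> F \<omega>))\<^sup>2) \<partial>boundary_measure)"
  have B: "B < \<infinity>" using sup by (simp add: B_def)
  have C1: "C1_on siegel_domain F" using lr by (simp add: left_regular_on_def)
  then obtain F' where Fd: "\<And>p. p \<in> siegel_domain \<Longrightarrow> (F has_derivative blinfun_apply (F' p)) (at p)"
    and contF': "continuous_on siegel_domain F'"
    unfolding C1_on_def by blast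
  have Freg: "(\<Sum>e\<in>Basis. e * F' p (axis j e, 0)) = 0" and Freg_last: "(\<Sum>e\<in>Basis. e * F' p (0, e)) = 0"
    if "p \<in> siegel_domain" for p j
    using lr that unfolding left_regular_on_def by (auto simp: dir_deriv_eq[OF Fd[OF that]])
  have contF: "continuous_on siegel_domain F"
    by (rule has_derivative_continuous_on) (use Fd has_derivative_at_withinI in blast)
  have shift_R: "shift h F \<in> borel_measurable ?R" if "h > 0" for h
  proof (rule borel_measurable_continuous_on_restrict)
    have "continuous_on siegel_boundary (\<lambda>p. F (fst p, snd p + of_real h))"
      by (rule continuous_on_compose2[OF contF])
        (use that in \<open>auto intro!: continuous_intros simp: siegel_domain_iff siegel_boundary_def re_part_def norm_sq_eq inner_add_left of_real_def\<close>)
    then show "continuous_on siegel_boundary (shift h F)" by (simp add: shift_def case_prod_beta')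
  qed
  have shift_eq: "shift h F p = F (p + (0, of_real h))" for h p
    by (cases p) (simp add: shift_def)
  have L_add: "?L (p + (0, c)) = ?L p + (0, c)" for p c
    by (simp add: heisenberg_def)
  have bound_L: "(\<integral>\<^sup>+p. ennreal ((norm (F (?L (strip_param p + (0, of_real h)))))\<^sup>2) \<partial>strip) \<le> B" if "h > 0" for h
  proof -
    have m: "(\<lambda>\<omega>. ennreal ((norm (shift h F \<omega>))\<^sup>2)) \<in> borel_measurable ?R"
      using shift_R[OF that] by measurable
    have "(\<integral>\<^sup>+p. ennreal ((norm (F (?L (strip_param p + (0, of_real h)))))\<^sup>2) \<partial>strip) =
        (\<integral>\<^sup>+p. ennreal ((norm (shift h F (?L (strip_param p))))\<^sup>2) \<partial>strip)"
      by (simp add: shift_eq L_add)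
    also have "\<dots> = (\<integral>\<^sup>+p. ennreal ((norm (shift h F (strip_param p)))\<^sup>2) \<partial>strip)"
      by (rule nn_T[OF m, symmetric])
    also have "\<dots> = (\<integral>\<^sup>+\<omega>. ennreal ((norm (shift h F \<omega>))\<^sup>2) \<partial>boundary_measure)"
      by (rule nn_integral_boundary[OF m, symmetric])
    also have "\<dots> \<le> B" unfolding B_def by (rule SUP_upper) (use that in simp)
    finally show ?thesis .
  qed
  define S where "S = (\<lambda>\<omega>::('a, 'n) point. ((- 2 / pi) ^ k) *\<^sub>R cauchy_deriv k (snd \<zeta> + conjugate (snd \<omega>) - 2 * conj_dot (fst \<omega>) z))"
  have S_eq: "szego_kernel \<zeta> \<omega> = S \<omega>" if "\<omega> \<in> siegel_boundary" for \<omega>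
  proof -
    have "(snd \<zeta> + conjugate (snd \<omega>) - 2 * conj_dot (fst \<omega>) z) \<bullet> 1 =
        snd \<zeta> \<bullet> 1 + snd \<omega> \<bullet> 1 - 2 * (fst \<omega> \<bullet> z)"
      by (simp add: inner_add_left inner_diff_left inner_two_mult conj_dot_inner_one)
    moreover have "snd \<omega> \<bullet> 1 = fst \<omega> \<bullet> fst \<omega>"
      using that by (simp add: siegel_boundary_def case_prod_beta re_part_def norm_sq_eq)
    moreover have "(fst \<omega> - z) \<bullet> (fst \<omega> - z) = fst \<omega> \<bullet> fst \<omega> - 2 * (fst \<omega> \<bullet> z) + z \<bullet> z"
      by (simp add: inner_diff_left inner_diff_right inner_commute[of z "fst \<omega>"])
    moreover have "(fst \<omega> - z) \<bullet> (fst \<omega> - z) \<ge> 0" by simp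
    ultimately have "(snd \<zeta> + conjugate (snd \<omega>) - 2 * conj_dot (fst \<omega>) z) \<bullet> 1 > 0"
      using r unfolding r_def by linarith
    then have "snd \<zeta> + conjugate (snd \<omega>) - 2 * conj_dot (fst \<omega>) z \<noteq> 0" by auto
    then show ?thesis
      by (simp add: szego_kernel_def case_prod_beta szego_s_def S_def k_def z_def dir_deriv_funpow_cauchy_E Let_def)
  qed
  have S_R [measurable]: "S \<in> borel_measurable ?R"
  proof -
    have "(\<lambda>\<omega>::('a, 'n) point. snd \<zeta> + conjugate (snd \<omega>) - 2 * conj_dot (fst \<omega>) z) \<in> borel_measurable borel"
      by (intro borel_measurable_continuous_onI continuous_intros)
    then have "S \<in> borel_measurable borel" unfolding S_def by measurable
    then show ?thesis by (rule measurable_restrict_space1)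
  qed
  have S_L: "S (?L p) = szego_vertex k r (snd p)" for p
    using szego_kernel_heisenberg[OF \<tau>, of z r p] L_vertex[of 0]
    by (simp add: S_def szego_vertex_def)
  have S_L2: "(\<integral>\<^sup>+\<omega>. ennreal ((norm (S \<omega>))\<^sup>2) \<partial>boundary_measure) < \<infinity>"
  proof -
    have "(\<integral>\<^sup>+\<omega>. ennreal ((norm (S \<omega>))\<^sup>2) \<partial>boundary_measure) = (\<integral>\<^sup>+p. ennreal ((norm (S (strip_param p)))\<^sup>2) \<partial>strip)"
      by (rule nn_integral_boundary) measurable
    also have "\<dots> = (\<integral>\<^sup>+p. ennreal ((norm (S (?L (strip_param p))))\<^sup>2) \<partial>strip)"
      by (rule nn_T[where f="\<lambda>\<omega>. ennreal ((norm (S \<omega>))\<^sup>2)"]) measurable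
    finally show ?thesis
      using szego_vertex_square_integrable[OF r, where 'n='n and 'a='a] by (simp add: S_L k_def)
  qed
  have S_M: "S \<in> borel_measurable boundary_measure" by (rule measurable_boundary_measureI[OF S_R])
  \<comment> \<open>The translates of \<open>F\<close> by \<open>\<epsilon>\<close> are regular across the boundary, so the formula at \<open>(0, r)\<close> applies to
    their composition with the boundary automorphism \<open>?L\<close>.\<close>
  have repr: "(\<integral>\<omega>. S \<omega> * shift \<epsilon> F \<omega> \<partial>boundary_measure) = F (\<zeta> + (0, of_real \<epsilon>))" if \<epsilon>: "\<epsilon> > 0" for \<epsilon>
  proof -
    define L0 where "L0 = (\<lambda>h::('a, 'n) point. (fst h, snd h + 2 * conj_dot z (fst h)))"
    have L0: "bounded_linear L0"
      unfolding L0_def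
      by (intro bounded_linear_Pair bounded_linear_add bounded_linear_fst bounded_linear_snd bounded_linear_const_mult
        bounded_linear_compose[OF bounded_linear_conj_dot bounded_linear_fst] bounded_linear_compose[OF bounded_linear_mult_right])
    define M where "M = (\<lambda>p. ?L (p + (0, of_real \<epsilon>)))"
    define H where "H = (\<lambda>p. F (M p))"
    define H' where "H' = (\<lambda>p. F' (M p) o\<^sub>L Blinfun L0)"
    have H'_apply: "H' p h = F' (M p) (L0 h)" for p h
      by (simp add: H'_def bounded_linear_Blinfun_apply[OF L0])
    have M_eq: "M = (\<lambda>p. L0 p + (z, of_real \<epsilon> + of_real (z \<bullet> z) + \<tau>))"
      by (auto simp: M_def L0_def heisenberg_def fun_eq_iff)
    have Md: "(M has_derivative L0) (at p)" for p
      unfolding M_eq using has_derivative_add[OF bounded_linear_imp_has_derivative[OF L0] has_derivative_const] by simp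
    have M_dom: "M p \<in> siegel_domain" if "fst p \<bullet> fst p - \<epsilon> < snd p \<bullet> 1" for p
      using heisenberg_height[OF \<tau>, of z "p + (0, of_real \<epsilon>)"] that
      by (simp add: siegel_domain_iff M_def inner_add_left of_real_def)
    interpret paraboloid_regular H H' \<epsilon> B
    proof
      show "\<epsilon> > 0" "B < \<infinity>" by fact+
      show "(H has_derivative blinfun_apply (H' p)) (at p)" if "fst p \<bullet> fst p - \<epsilon> < snd p \<bullet> 1" for p
        using has_derivative_compose[OF Md Fd[OF M_dom[OF that]]] by (simp add: H_def H'_apply[abs_def])
      show "continuous_on {p. fst p \<bullet> fst p - \<epsilon> < snd p \<bullet> 1} H'"
      proof -
        have "continuous_on {p. fst p \<bullet> fst p - \<epsilon> < snd p \<bullet> 1} M"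
          by (rule has_derivative_continuous_on[where f'="\<lambda>_. L0"]) (rule has_derivative_at_withinI[OF Md])
        then have "continuous_on {p. fst p \<bullet> fst p - \<epsilon> < snd p \<bullet> 1} (\<lambda>p. F' (M p))"
          by (rule continuous_on_compose2[OF contF']) (use M_dom in blast)
        then show ?thesis
          unfolding H'_def
          by (rule bounded_bilinear.continuous_on[OF bounded_bilinear_blinfun_compose _ continuous_on_const])
      qed
      show "(\<Sum>e\<in>Basis. e * H' p (0, e)) = 0" if "fst p \<bullet> fst p - \<epsilon> < snd p \<bullet> 1" for p
        using Freg_last[OF M_dom[OF that]] by (simp add: H'_apply L0_def conj_dot_def)
      show "(\<Sum>e\<in>Basis. e * H' p (axis j e, 0)) = 0" if "fst p \<bullet> fst p - \<epsilon> < snd p \<bullet> 1" for p j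
      proof -
        let ?q = "F' (M p)"
        have lin: "linear (\<lambda>h. ?q (0, h))"
          by (intro bounded_linear.linear bounded_linear_compose[OF blinfun.bounded_linear_right] bounded_linear_Pair bounded_linear_zero bounded_linear_ident)
        have "?q (L0 (axis j e, 0)) = ?q (axis j e, 0) + 2 * ?q (0, conjugate (z $ j) * e)" for e
        proof -
          have "L0 (axis j e, 0) = (axis j e, 0) + ((0, conjugate (z $ j) * e) + (0, conjugate (z $ j) * e))"
            unfolding L0_def fst_conv snd_conv conj_dot_axis mult_2 by simp
          then show ?thesis by (simp only: blinfun.add_right mult_2)
        qed
        then have "(\<Sum>e\<in>Basis. e * H' p (axis j e, 0)) =
            (\<Sum>e\<in>Basis. e * ?q (axis j e, 0) + 2 * (e * ?q (0, conjugate (z $ j) * e)))"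
          by (intro sum.cong refl) (simp only: H'_apply distrib_left mult_2)
        also have "\<dots> = (\<Sum>e\<in>Basis. e * ?q (axis j e, 0)) + 2 * (\<Sum>e\<in>Basis. e * ?q (0, conjugate (z $ j) * e))"
          by (simp only: sum.distrib sum_distrib_left)
        also have "\<dots> = 0"
          using Freg[OF M_dom[OF that]] Freg_last[OF M_dom[OF that]] sum_Basis_mult_conjugate[OF lin, of "z $ j"] by simp
        finally show ?thesis .
      qed
      show "(\<integral>\<^sup>+p. ennreal ((norm (H (strip_param p + (0, of_real h))))\<^sup>2) \<partial>strip) \<le> B" if "h > - \<epsilon>" for h
        using bound_L[of "h + \<epsilon>"] that by (simp add: H_def M_def add.assoc)
    qed
    have m: "(\<lambda>\<omega>. S \<omega> * shift \<epsilon> F \<omega>) \<in> borel_measurable ?R"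
      using shift_R[OF \<epsilon>] by measurable
    have "(\<integral>\<omega>. S \<omega> * shift \<epsilon> F \<omega> \<partial>boundary_measure) = (\<integral>p. S (strip_param p) * shift \<epsilon> F (strip_param p) \<partial>strip)"
      by (rule integral_boundary[OF m])
    also have "\<dots> = (\<integral>p. S (?L (strip_param p)) * shift \<epsilon> F (?L (strip_param p)) \<partial>strip)"
      by (rule int_T[OF m])
    also have "\<dots> = (\<integral>p. szego_vertex k r (snd (strip_param p)) * H (strip_param p) \<partial>strip)"
      by (simp only: S_L shift_eq H_def M_def L_add)
    also have "\<dots> = H (0, of_real r)"
      unfolding k_def by (rule reproducing_at_vertex[OF r])
    also have "\<dots> = F (\<zeta> + (0, of_real \<epsilon>))"
      using L_vertex[of "of_real \<epsilon>"] by (simp add: H_def M_def)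
    finally show ?thesis .
  qed
  \<comment> \<open>Both sides are continuous as \<open>\<epsilon> \<rightarrow> 0\<close>: the left one because \<open>S\<close> is square integrable and the
    translates converge in \<open>L\<^sup>2\<close>, the right one because \<open>\<zeta>\<close> is an interior point.\<close>
  have Fb_M: "Fb \<in> borel_measurable boundary_measure"
    and Fb_L2: "(\<integral>\<^sup>+\<omega>. ennreal ((norm (Fb \<omega>))\<^sup>2) \<partial>boundary_measure) < \<infinity>"
    and Fb_lim: "((\<lambda>\<epsilon>. \<integral>\<^sup>+\<omega>. ennreal ((norm (shift \<epsilon> F \<omega> - Fb \<omega>))\<^sup>2) \<partial>boundary_measure) \<longlongrightarrow> 0) (at_right 0)"
    using Fb by (auto simp: is_boundary_limit_def)
  define I where "I = (\<integral>\<omega>. S \<omega> * Fb \<omega> \<partial>boundary_measure)"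
  have int_SFb: "integrable boundary_measure (\<lambda>\<omega>. S \<omega> * Fb \<omega>)"
    by (rule integrable_mult_of_square_integrable[OF S_M Fb_M S_L2 Fb_L2])
  let ?K = "\<integral>\<^sup>+\<omega>. ennreal ((norm (S \<omega>))\<^sup>2) \<partial>boundary_measure"
  let ?N = "\<lambda>\<epsilon>. \<integral>\<^sup>+\<omega>. ennreal ((norm (shift \<epsilon> F \<omega> - Fb \<omega>))\<^sup>2) \<partial>boundary_measure"
  have est: "(ennreal (norm (F (\<zeta> + (0, of_real \<epsilon>)) - I)))\<^sup>2 \<le> ?K * ?N \<epsilon>" if \<epsilon>: "\<epsilon> > 0" for \<epsilon>
  proof -
    have sh_M: "shift \<epsilon> F \<in> borel_measurable boundary_measure" by (rule measurable_boundary_measureI[OF shift_R[OF \<epsilon>]])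
    have "(\<integral>\<^sup>+\<omega>. ennreal ((norm (shift \<epsilon> F \<omega>))\<^sup>2) \<partial>boundary_measure) \<le> B"
      unfolding B_def by (rule SUP_upper) (use \<epsilon> in simp)
    then have "integrable boundary_measure (\<lambda>\<omega>. S \<omega> * shift \<epsilon> F \<omega>)"
      using B by (intro integrable_mult_of_square_integrable[OF S_M sh_M S_L2]) simp
    then have "F (\<zeta> + (0, of_real \<epsilon>)) - I = (\<integral>\<omega>. S \<omega> * shift \<epsilon> F \<omega> - S \<omega> * Fb \<omega> \<partial>boundary_measure)"
      using int_SFb by (simp add: I_def repr[OF \<epsilon>])
    also have "\<dots> = (\<integral>\<omega>. S \<omega> * (shift \<epsilon> F \<omega> - Fb \<omega>) \<partial>boundary_measure)"
      by (simp add: right_diff_distrib)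
    finally have "F (\<zeta> + (0, of_real \<epsilon>)) - I = (\<integral>\<omega>. S \<omega> * (shift \<epsilon> F \<omega> - Fb \<omega>) \<partial>boundary_measure)" .
    moreover have "ennreal (norm (\<integral>\<omega>. S \<omega> * (shift \<epsilon> F \<omega> - Fb \<omega>) \<partial>boundary_measure)) \<le>
        (\<integral>\<^sup>+\<omega>. ennreal (norm (S \<omega> * (shift \<epsilon> F \<omega> - Fb \<omega>))) \<partial>boundary_measure)"
    proof (rule integral_norm_bound_ennreal)
      have "integrable boundary_measure (\<lambda>\<omega>. S \<omega> * shift \<epsilon> F \<omega> - S \<omega> * Fb \<omega>)"
        using int_SFb \<open>integrable boundary_measure (\<lambda>\<omega>. S \<omega> * shift \<epsilon> F \<omega>)\<close> by simp
      then show "integrable boundary_measure (\<lambda>\<omega>. S \<omega> * (shift \<epsilon> F \<omega> - Fb \<omega>))" by (simp add: right_diff_distrib)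
    qed
    ultimately have "ennreal (norm (F (\<zeta> + (0, of_real \<epsilon>)) - I)) \<le>
        (\<integral>\<^sup>+\<omega>. ennreal (norm (S \<omega>)) * ennreal (norm (shift \<epsilon> F \<omega> - Fb \<omega>)) \<partial>boundary_measure)"
      by (simp add: norm_mult ennreal_mult)
    then have "(ennreal (norm (F (\<zeta> + (0, of_real \<epsilon>)) - I)))\<^sup>2 \<le>
        (\<integral>\<^sup>+\<omega>. ennreal (norm (S \<omega>)) * ennreal (norm (shift \<epsilon> F \<omega> - Fb \<omega>)) \<partial>boundary_measure)\<^sup>2"
      by (rule power_mono) simp
    also have "\<dots> \<le> (\<integral>\<^sup>+\<omega>. (ennreal (norm (S \<omega>)))\<^sup>2 \<partial>boundary_measure) *
        (\<integral>\<^sup>+\<omega>. (ennreal (norm (shift \<epsilon> F \<omega> - Fb \<omega>)))\<^sup>2 \<partial>boundary_measure)"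
      by (intro Cauchy_Schwarz_nn_integral measurable_compose[OF _ measurable_ennreal]
          measurable_compose[OF _ borel_measurable_norm]
          borel_measurable_diff S_M sh_M Fb_M)
    finally show ?thesis by (simp add: ennreal_power)
  qed
  have "((\<lambda>\<epsilon>. ?K * ?N \<epsilon>) \<longlongrightarrow> ?K * 0) (at_right 0)"
    using S_L2 by (intro ennreal_tendsto_cmult Fb_lim) auto
  moreover have "((\<lambda>\<epsilon>. (ennreal (norm (F (\<zeta> + (0, of_real \<epsilon>)) - I)))\<^sup>2) \<longlongrightarrow> (ennreal (norm (F \<zeta> - I)))\<^sup>2) (at_right 0)"
  proof -
    have "isCont F \<zeta>" using Fd[OF \<zeta>] by (rule has_derivative_continuous)
    moreover have "((\<lambda>\<epsilon>. \<zeta> + (0, of_real \<epsilon>)) \<longlongrightarrow> \<zeta> + (0, of_real 0)) (at_right 0)"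
      by (intro tendsto_intros)
    ultimately have "((\<lambda>\<epsilon>. F (\<zeta> + (0, of_real \<epsilon>))) \<longlongrightarrow> F \<zeta>) (at_right 0)"
      by (intro isCont_tendsto_compose[of _ F]) (auto simp: zero_prod_def[symmetric])
    then have "((\<lambda>\<epsilon>. ennreal ((norm (F (\<zeta> + (0, of_real \<epsilon>)) - I))\<^sup>2)) \<longlongrightarrow> ennreal ((norm (F \<zeta> - I))\<^sup>2)) (at_right 0)"
      by (intro tendsto_ennrealI tendsto_intros)
    then show ?thesis by (simp add: ennreal_power)
  qed
  ultimately have "(ennreal (norm (F \<zeta> - I)))\<^sup>2 \<le> ?K * 0"
    by (rule tendsto_le[rotated 1]) (auto intro!: eventually_mono[OF eventually_at_right_less] est)
  then have "I = F \<zeta>" by simp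
  then have "has_bochner_integral boundary_measure (\<lambda>\<omega>. S \<omega> * Fb \<omega>) (F \<zeta>)"
    using int_SFb by (simp add: has_bochner_integral_iff I_def)
  then show ?thesis
    by (subst has_bochner_integral_cong[OF refl _ refl]) (simp_all add: S_eq space_boundary_measure)
qed

theorem theorem1p2:
  shows
    "(\<forall>(F :: (complex, 'n::finite) point \<Rightarrow> complex) Fb \<zeta>.
        F \<in> hardy2 \<longrightarrow> is_boundary_limit F Fb \<longrightarrow> \<zeta> \<in> siegel_domain \<longrightarrow>
        has_bochner_integral boundary_measure (\<lambda>\<omega>. szego_kernel \<zeta> \<omega> * Fb \<omega>) (F \<zeta>)) \<and>
     (\<forall>(F :: (quat, 'n) point \<Rightarrow> quat) Fb \<zeta>.
        F \<in> hardy2 \<longrightarrow> is_boundary_limit F Fb \<longrightarrow> \<zeta> \<in> siegel_domain \<longrightarrow>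
        has_bochner_integral boundary_measure (\<lambda>\<omega>. szego_kernel \<zeta> \<omega> * Fb \<omega>) (F \<zeta>))"
  by (intro conjI allI impI cauchy_szego_reproducing)

end
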